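(* Let $\{V_{k_1}\}_{k_1 \in \mathcal{K}_1}$ be a set of $[[m+t,m]]$ quantum error-correcting codes (each $V_{k_1}$ a unitary mapping Paulis to Paulis under conjugation, up to phase) that is purity testing with error $\varepsilon$. Then the encryption scheme obtained from the canonical encode-encrypt construction, with key $(k_1,k_2)$ uniform in $\mathcal{K}_1\times\{0,1\}^{2(m+t)}$, encryption unitary $U_{k_1,k_2}=P_{k_2}V_{k_1}$ and tag state $\sigma_{k_1,k_2}=|0^t\rangle\langle 0^t|$, is quantum ciphertext $\varepsilon$-authenticating ($\varepsilon$-QCA).
   Context: **Paulis and norms.** $\mathbb{P}_n$ is the $n$-qubit Pauli group modulo phases, with elements $P_\ell$ indexed by $\ell\in\{0,1\}^{2n}$ (bit-flip and phase-flip positions), $P_0=\mathsf{I}^{\otimes n}$. $\|\cdot\|_{\mathrm{tr}}$ is the trace norm and $\|\Psi\|_\diamond=\sup_\rho\|(\mathbb{I}\otimes\Psi)(\rho)\|_{\mathrm{tr}}$ (supremum over density matrices, with arbitrary ancilla) is the diamond norm. All keys are uniformly random, and $\mathbb{E}_k$ is the corresponding average. Unitaries and maps act as the identity on registers not mentioned. **Codes.** An $[[m+t,m]]$ code is given by a unitary $V$ encoding an $m$-qubit state $\rho$ as $V(\rho\otimes|0^t\rangle\langle 0^t|)V^\dagger$. All codes considered satisfy: for every $P_\ell\in\mathbb{P}_{m+t}$ there are $P_{\ell'}\in\mathbb{P}_{m+t}$ and $\theta\in\mathbb{R}$ with $P_\ell V=e^{i\theta}VP_{\ell'}$. Membership of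 $V^\dagger P_\ell V$ in a set of Paulis is understood up to phase. A set $\{V_k\}_{k\in\mathcal{K}}$ is *purity testing* with error $\varepsilon$ if for every $P_\ell\in\mathbb{P}_{m+t}\setminus\{\mathsf{I}^{\otimes(m+t)}\}$, $$\Pr_k\left[V_k^\dagger P_\ell V_k\in(\mathbb{P}_m\setminus\{\mathsf{I}^{\otimes m}\})\otimes\{\mathsf{I},\mathsf{Z}\}^{\otimes t}\right]\le\varepsilon .$$ **Encryption schemes.** A scheme $\{(U_k,\sigma_k)\}_{k\in\mathcal{K}}$ consists of unitaries $U_k$ on a message register $M$ and tag register $T$, and tag states $\sigma_k=\sum_r p_{k,r}|\varphi_{k,r}\rangle\langle\varphi_{k,r}|$ on $T$. Let $\Pi_k^{\mathsf{acc}}$ be the projector onto the support of $\sigma_k$ and $\Pi_k^{\mathsf{rej}}=\mathbb{I}-\Pi_k^{\mathsf{acc}}$. Then $$\mathsf{Encrypt}_k(\rho)=U_k(\rho\otimes\sigma_k)U_k^\dagger,$$ $$\mathsf{Decrypt}_k(\rho)=\mathrm{Tr}_T\big[\Pi_k^{\mathsf{acc}}U_k^\dagger\rho U_k\Pi_k^{\mathsf{acc}}\big]+|\bot\rangle\langle\bot|^M\otimes\mathrm{Tr}_{MT}\big[\Pi_k^{\mathsf{rej}}U_k^\dagger\rho U_k\Pi_k^{\mathsf{rej}}\big],$$ where $|\bot\rangle$ is a dummy reject state orthogonal to all messages (the output register $M$ is enlarged to contain it). **Canonical construction.** Key: $k_1\in\mathcal{K}_1$ and $k_2\in\{0,1\}^{2(m+t)}$,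 uniform and independent. Encryption: $\rho^M\mapsto P_{k_2}V_{k_1}(\rho\otimes|0^t\rangle\langle0^t|^T)V_{k_1}^\dagger P_{k_2}^\dagger$. Decryption: $\rho^{MT}\mapsto\langle0^t|V_{k_1}^\dagger P_{k_2}^\dagger\rho P_{k_2}V_{k_1}|0^t\rangle+|\bot\rangle\langle\bot|^M\otimes\mathrm{Tr}_M\big[\sum_{i\ne0^t}\langle i|V_{k_1}^\dagger P_{k_2}^\dagger\rho P_{k_2}V_{k_1}|i\rangle\big]$, the bras and kets acting on $T$. **$\varepsilon$-QCA.** The scheme is $\varepsilon$-QCA if for every completely positive trace-preserving map $\mathcal{A}$ on $M,T$ and a side-information register $R$ there is a CP map $\mathcal{S}_{\mathsf{rej}}$ on $R$ such that, with $$\mathcal{S}_{\mathsf{acc}}:\rho^R\mapsto\mathbb{E}_{k',r}\Big[\langle\varphi_{k',r}|^T\langle\Phi^+|^{M_1M_2}\,U_{k'}^\dagger\,\mathcal{A}^{M_1TR}\big(U_{k'}^{M_1T}\rho_{k',r}U_{k'}^\dagger\big)U_{k'}\,|\varphi_{k',r}\rangle|\Phi^+\rangle\Big],$$ $$\rho_{k',r}=\rho^R\otimes|\Phi^+\rangle\langle\Phi^+|^{M_1M_2}\otimes|\varphi_{k',r}\rangle\langle\varphi_{k',r}|^T,$$ ($k'$ uniform, $r$ distributed according to $p_{k',r}$, $M_1,M_2$ copies of $M$, $|\Phi^+\rangle$ the maximally entangled state of $M_1M_2$, i.e. EPR pairs), the map $\mathcal{S}_{\mathsf{acc}}+\mathcal{S}_{\mathsf{rej}}$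 is trace preserving and $$\tfrac12\Big\|\mathbb{E}_k\big[\mathsf{Decrypt}_k\circ\mathcal{A}^{MTR}\circ\mathsf{Encrypt}_k\big]-\Big(\mathbb{I}^M\otimes\mathcal{S}_{\mathsf{acc}}^R+|\bot\rangle\langle\bot|^M(\mathrm{Tr}_M\otimes\mathcal{S}_{\mathsf{rej}}^R)\Big)\Big\|_\diamond\le\varepsilon .$$ *)

theory Defs
  imports "HOL-Library.Extended_Real" "Jordan_Normal_Form.Schur_Decomposition"
begin

section \<open>Operators on finite-dimensional registers\<close>

text \<open>
  A register of dimension \<open>d\<close> is the space \<open>carrier_vec d\<close> over the complex numbers, and its
  operators are \<open>carrier_mat d d\<close>. The pair of basis indices \<open>i\<close> (first factor) and \<open>j\<close> (second
  factor, of dimension \<open>b\<close>) of a composite register is the single index \<open>i * b + j\<close>, so that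
  iterated products are associative and the first factor is the most significant one.
\<close>

definition kron :: "complex mat \<Rightarrow> complex mat \<Rightarrow> complex mat" (infixr \<open>\<otimes>\<^sub>k\<close> 75) where
  "A \<otimes>\<^sub>k B = mat (dim_row A * dim_row B) (dim_col A * dim_col B)
     (\<lambda>(i, j). A $$ (i div dim_row B, j div dim_col B) * B $$ (i mod dim_row B, j mod dim_col B))"

text \<open>Finite sums of \<open>n \<times> n\<close> matrices (the matrix type has no global zero).\<close>

definition mat_sum :: "nat \<Rightarrow> 'i set \<Rightarrow> ('i \<Rightarrow> complex mat) \<Rightarrow> complex mat" where
  "mat_sum n I F = mat n n (\<lambda>ij. \<Sum>x\<in>I. F x $$ ij)"

definition mat_avg :: "nat \<Rightarrow> 'i set \<Rightarrow> ('i \<Rightarrow> complex mat) \<Rightarrow> complex mat" where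
  "mat_avg n I F = (1 / of_nat (card I)) \<cdot>\<^sub>m mat_sum n I F"

definition mtrace :: "complex mat \<Rightarrow> complex" where
  "mtrace A = (\<Sum>i<dim_row A. A $$ (i, i))"

definition ket :: "complex vec \<Rightarrow> complex mat" where
  "ket v = mat_of_cols (dim_vec v) [v]"

definition ketbra :: "complex vec \<Rightarrow> complex mat" where
  "ketbra v = ket v * mat_adjoint (ket v)"

definition conj_by :: "complex mat \<Rightarrow> complex mat \<Rightarrow> complex mat" where
  "conj_by B X = B * X * mat_adjoint B"

definition unitary_mat :: "nat \<Rightarrow> complex mat \<Rightarrow> bool" where
  "unitary_mat n U \<longleftrightarrow> U \<in> carrier_mat n n \<and>
     mat_adjoint U * U = 1\<^sub>m n \<and> U * mat_adjoint U = 1\<^sub>m n"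

text \<open>In the order on the complex numbers used here, \<open>0 \<le> z\<close> means that \<open>z\<close> is real and
  nonnegative.\<close>

definition psd :: "nat \<Rightarrow> complex mat \<Rightarrow> bool" where
  "psd n A \<longleftrightarrow> A \<in> carrier_mat n n \<and> (\<forall>v\<in>carrier_vec n. 0 \<le> (A *\<^sub>v v) \<bullet>c v)"

definition density :: "nat \<Rightarrow> complex mat \<Rightarrow> bool" where
  "density n \<rho> \<longleftrightarrow> psd n \<rho> \<and> mtrace \<rho> = 1"

text \<open>Partial trace over the second factor of a register of dimension \<open>a * b\<close>.\<close>

definition ptrace2 :: "nat \<Rightarrow> nat \<Rightarrow> complex mat \<Rightarrow> complex mat" where
  "ptrace2 a b X = mat a a (\<lambda>(i, j). \<Sum>k<b. X $$ (i * b + k, j * b + k))"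

text \<open>The unitary from \<open>A \<otimes> B\<close> to \<open>B \<otimes> A\<close> exchanging the two factors.\<close>

definition swap_mat :: "nat \<Rightarrow> nat \<Rightarrow> complex mat" where
  "swap_mat a b = mat (b * a) (a * b)
     (\<lambda>(i, j). if i div a = j mod b \<and> i mod a = j div b then 1 else 0)"

definition psd_sqrt :: "nat \<Rightarrow> complex mat \<Rightarrow> complex mat" where
  "psd_sqrt n A = (THE B. psd n B \<and> B * B = A)"

definition trace_norm :: "nat \<Rightarrow> complex mat \<Rightarrow> real" where
  "trace_norm n A = Re (mtrace (psd_sqrt n (mat_adjoint A * A)))"

text \<open>The orthogonal projector onto the support (the orthogonal complement of the kernel) of a
  Hermitian \<open>A\<close>.\<close>

definition support_proj :: "nat \<Rightarrow> complex mat \<Rightarrow> complex mat" where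
  "support_proj n A = (THE P. P \<in> carrier_mat n n \<and> mat_adjoint P = P \<and> P * P = P \<and>
     (\<forall>v\<in>carrier_vec n. P *\<^sub>v v = 0\<^sub>v n \<longleftrightarrow> A *\<^sub>v v = 0\<^sub>v n))"


section \<open>Linear maps on operators\<close>

definition linear_superop :: "nat \<Rightarrow> nat \<Rightarrow> (complex mat \<Rightarrow> complex mat) \<Rightarrow> bool" where
  "linear_superop a b \<Phi> \<longleftrightarrow>
     (\<forall>X\<in>carrier_mat a a. \<Phi> X \<in> carrier_mat b b) \<and>
     (\<forall>X\<in>carrier_mat a a. \<forall>Y\<in>carrier_mat a a. \<Phi> (X + Y) = \<Phi> X + \<Phi> Y) \<and>
     (\<forall>c. \<forall>X\<in>carrier_mat a a. \<Phi> (c \<cdot>\<^sub>m X) = c \<cdot>\<^sub>m \<Phi> X)"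

definition mat_unit :: "nat \<Rightarrow> nat \<Rightarrow> nat \<Rightarrow> complex mat" where
  "mat_unit n i j = mat n n (\<lambda>kl. if kl = (i, j) then 1 else 0)"

text \<open>The tensor product of \<open>\<Phi>\<close> (from dimension \<open>a\<close> to \<open>a'\<close>) and \<open>\<Psi>\<close> (from \<open>b\<close> to \<open>b'\<close>), obtained by
  expanding the argument in the basis of matrix units
  \<open>mat_unit a i j \<otimes>\<^sub>k mat_unit b k l\<close>.\<close>

definition tensor_superop ::
  "nat \<Rightarrow> nat \<Rightarrow> nat \<Rightarrow> nat \<Rightarrow> (complex mat \<Rightarrow> complex mat) \<Rightarrow> (complex mat \<Rightarrow> complex mat) \<Rightarrow>
   complex mat \<Rightarrow> complex mat" where
  "tensor_superop a a' b b' \<Phi> \<Psi> X =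
     mat_sum (a' * b') (({..<a} \<times> {..<a}) \<times> ({..<b} \<times> {..<b}))
       (\<lambda>((i, j), (k, l)). X $$ (i * b + k, j * b + l) \<cdot>\<^sub>m
          (\<Phi> (mat_unit a i j) \<otimes>\<^sub>k \<Psi> (mat_unit b k l)))"

definition cp_map :: "nat \<Rightarrow> nat \<Rightarrow> (complex mat \<Rightarrow> complex mat) \<Rightarrow> bool" where
  "cp_map a b \<Phi> \<longleftrightarrow> linear_superop a b \<Phi> \<and>
     (\<forall>c X. psd (c * a) X \<longrightarrow> psd (c * b) (tensor_superop c c a b id \<Phi> X))"

definition trace_preserving :: "nat \<Rightarrow> (complex mat \<Rightarrow> complex mat) \<Rightarrow> bool" where
  "trace_preserving a \<Phi> \<longleftrightarrow> (\<forall>X\<in>carrier_mat a a. mtrace (\<Phi> X) = mtrace X)"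

definition cptp :: "nat \<Rightarrow> nat \<Rightarrow> (complex mat \<Rightarrow> complex mat) \<Rightarrow> bool" where
  "cptp a b \<Phi> \<longleftrightarrow> cp_map a b \<Phi> \<and> trace_preserving a \<Phi>"

text \<open>The supremum is taken in the extended reals, where it always exists. A density matrix has
  trace 1, so the ancilla dimension \<open>c\<close> is automatically positive.\<close>

definition diamond_norm :: "nat \<Rightarrow> nat \<Rightarrow> (complex mat \<Rightarrow> complex mat) \<Rightarrow> ereal" where
  "diamond_norm a b \<Psi> = (SUP (c, \<rho>) \<in> {(c, \<rho>). density (c * a) \<rho>}.
     ereal (trace_norm (c * b) (tensor_superop c c a b id \<Psi> \<rho>)))"


section \<open>Paulis and codes\<close>

text \<open>A Pauli index on \<open>n\<close> qubits is a bit string of length \<open>2 * n\<close>: the first half gives the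
  bit-flip positions and the second half the phase-flip positions. Since Paulis are taken modulo
  phases, \<open>Y\<close> is represented by \<open>X * Z\<close>.\<close>

definition pauli_X :: "complex mat" where
  "pauli_X = mat_of_rows_list 2 [[0, 1], [1, 0]]"

definition pauli_Z :: "complex mat" where
  "pauli_Z = mat_of_rows_list 2 [[1, 0], [0, -1]]"

definition pauli1 :: "bool \<Rightarrow> bool \<Rightarrow> complex mat" where
  "pauli1 x z = (if x then pauli_X else 1\<^sub>m 2) * (if z then pauli_Z else 1\<^sub>m 2)"

definition pauli :: "nat \<Rightarrow> bool list \<Rightarrow> complex mat" where
  "pauli n l = foldr (\<lambda>(x, z) B. pauli1 x z \<otimes>\<^sub>k B) (zip (take n l) (drop n l)) (1\<^sub>m 1)"

definition pauli_index :: "nat \<Rightarrow> bool list set" where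
  "pauli_index n = {l. length l = 2 * n}"

definition paulis :: "nat \<Rightarrow> complex mat set" where
  "paulis n = pauli n ` pauli_index n"

text \<open>The set \<open>{I, Z}\<^sup>\<otimes>\<^sup>t\<close>: no bit flips.\<close>

definition IZ_paulis :: "nat \<Rightarrow> complex mat set" where
  "IZ_paulis t = pauli t ` {l \<in> pauli_index t. \<forall>i<t. \<not> l ! i}"

definition in_up_to_phase :: "complex mat \<Rightarrow> complex mat set \<Rightarrow> bool" where
  "in_up_to_phase A S \<longleftrightarrow> (\<exists>Q\<in>S. \<exists>\<theta>::real. A = cis \<theta> \<cdot>\<^sub>m Q)"

text \<open>The \<open>m\<close> message qubits come first, the \<open>t\<close> tag qubits last.\<close>

definition is_code :: "nat \<Rightarrow> nat \<Rightarrow> complex mat \<Rightarrow> bool" where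
  "is_code m t V \<longleftrightarrow> unitary_mat (2 ^ (m + t)) V \<and>
     (\<forall>P\<in>paulis (m + t). \<exists>P'\<in>paulis (m + t). \<exists>\<theta>::real. P * V = cis \<theta> \<cdot>\<^sub>m (V * P'))"

definition purity_testing :: "nat \<Rightarrow> nat \<Rightarrow> 'k set \<Rightarrow> ('k \<Rightarrow> complex mat) \<Rightarrow> real \<Rightarrow> bool" where
  "purity_testing m t K V \<epsilon> \<longleftrightarrow>
     (\<forall>P \<in> paulis (m + t) - {1\<^sub>m (2 ^ (m + t))}.
        real (card {k \<in> K. in_up_to_phase (mat_adjoint (V k) * P * V k)
                {A \<otimes>\<^sub>k B | A B. A \<in> paulis m - {1\<^sub>m (2 ^ m)} \<and> B \<in> IZ_paulis t}})
          / real (card K) \<le> \<epsilon>)"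


section \<open>Encryption schemes\<close>

text \<open>The tag state is given with its decomposition: for the key \<open>k\<close> it is the mixture of the pure
  states \<open>tag_vec S k r\<close>, \<open>r < tag_num S k\<close>, with probabilities \<open>tag_prob S k r\<close>.\<close>

record 'k scheme =
  keys :: "'k set"
  msg_dim :: nat
  tag_dim :: nat
  enc_unitary :: "'k \<Rightarrow> complex mat"
  tag_num :: "'k \<Rightarrow> nat"
  tag_prob :: "'k \<Rightarrow> nat \<Rightarrow> real"
  tag_vec :: "'k \<Rightarrow> nat \<Rightarrow> complex vec"

definition is_scheme :: "'k scheme \<Rightarrow> bool" where
  "is_scheme S \<longleftrightarrow> finite (keys S) \<and> keys S \<noteq> {} \<and> 0 < msg_dim S \<and> 0 < tag_dim S \<and>
     (\<forall>k\<in>keys S.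
        unitary_mat (msg_dim S * tag_dim S) (enc_unitary S k) \<and>
        (\<forall>r<tag_num S k. tag_vec S k r \<in> carrier_vec (tag_dim S) \<and>
           tag_vec S k r \<bullet>c tag_vec S k r = 1 \<and> 0 \<le> tag_prob S k r) \<and>
        (\<Sum>r<tag_num S k. tag_prob S k r) = 1)"

definition tag_state :: "'k scheme \<Rightarrow> 'k \<Rightarrow> complex mat" where
  "tag_state S k = mat_sum (tag_dim S) {..<tag_num S k}
     (\<lambda>r. of_real (tag_prob S k r) \<cdot>\<^sub>m ketbra (tag_vec S k r))"

definition proj_acc :: "'k scheme \<Rightarrow> 'k \<Rightarrow> complex mat" where
  "proj_acc S k = support_proj (tag_dim S) (tag_state S k)"

definition proj_rej :: "'k scheme \<Rightarrow> 'k \<Rightarrow> complex mat" where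
  "proj_rej S k = 1\<^sub>m (tag_dim S) - proj_acc S k"

text \<open>The output message register has dimension \<open>d + 1\<close>: the first \<open>d\<close> basis vectors are the
  messages, the last one is the reject state.\<close>

definition msg_embed :: "nat \<Rightarrow> complex mat" where
  "msg_embed d = mat (d + 1) d (\<lambda>(i, j). if i = j then 1 else 0)"

definition bot_state :: "nat \<Rightarrow> complex mat" where
  "bot_state d = ketbra (unit_vec (d + 1) d)"

definition encrypt :: "'k scheme \<Rightarrow> 'k \<Rightarrow> complex mat \<Rightarrow> complex mat" where
  "encrypt S k \<rho> = conj_by (enc_unitary S k) (\<rho> \<otimes>\<^sub>k tag_state S k)"

definition decrypt :: "'k scheme \<Rightarrow> 'k \<Rightarrow> complex mat \<Rightarrow> complex mat" where
  "decrypt S k \<rho> =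
     (let d = msg_dim S; e = tag_dim S;
          \<rho>' = conj_by (mat_adjoint (enc_unitary S k)) \<rho>
      in conj_by (msg_embed d) (ptrace2 d e (conj_by (1\<^sub>m d \<otimes>\<^sub>k proj_acc S k) \<rho>'))
         + mtrace (conj_by (1\<^sub>m d \<otimes>\<^sub>k proj_rej S k) \<rho>') \<cdot>\<^sub>m bot_state d)"


section \<open>Quantum ciphertext authentication\<close>

text \<open>
  The side-information register \<open>R\<close> (dimension \<open>r\<close>) is placed first, so the attack acts on \<open>R, M, T\<close>
  in this order. In the definition of the accepting simulator the registers are ordered
  \<open>R, M\<^sub>2, M\<^sub>1, T\<close>, and the attack is applied to \<open>R, M\<^sub>1, T\<close> by first exchanging \<open>R\<close> and \<open>M\<^sub>2\<close>.
\<close>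

definition epr :: "nat \<Rightarrow> complex vec" where
  "epr d = vec (d * d) (\<lambda>i. if i div d = i mod d then 1 / of_real (sqrt (real d)) else 0)"

definition attack_skip ::
  "nat \<Rightarrow> nat \<Rightarrow> nat \<Rightarrow> (complex mat \<Rightarrow> complex mat) \<Rightarrow> complex mat \<Rightarrow> complex mat" where
  "attack_skip r d e \<A> X =
     (let W = swap_mat r d \<otimes>\<^sub>k 1\<^sub>m (d * e); n = r * (d * e)
      in conj_by (mat_adjoint W) (tensor_superop d d n n id \<A> (conj_by W X)))"

definition sim_acc ::
  "'k scheme \<Rightarrow> nat \<Rightarrow> (complex mat \<Rightarrow> complex mat) \<Rightarrow> complex mat \<Rightarrow> complex mat" where
  "sim_acc S r \<A> \<rho> =
     (let d = msg_dim S; e = tag_dim S in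
      mat_avg r (keys S) (\<lambda>k. mat_sum r {..<tag_num S k} (\<lambda>s.
        let U = 1\<^sub>m (r * d) \<otimes>\<^sub>k enc_unitary S k;
            \<rho>\<^sub>k\<^sub>s = \<rho> \<otimes>\<^sub>k ketbra (epr d) \<otimes>\<^sub>k ketbra (tag_vec S k s);
            B = 1\<^sub>m r \<otimes>\<^sub>k ket (epr d) \<otimes>\<^sub>k ket (tag_vec S k s)
        in of_real (tag_prob S k s) \<cdot>\<^sub>m
             conj_by (mat_adjoint B) (conj_by (mat_adjoint U)
               (attack_skip r d e \<A> (conj_by U \<rho>\<^sub>k\<^sub>s))))))"

definition real_map ::
  "'k scheme \<Rightarrow> nat \<Rightarrow> (complex mat \<Rightarrow> complex mat) \<Rightarrow> complex mat \<Rightarrow> complex mat" where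
  "real_map S r \<A> \<rho> =
     (let d = msg_dim S; e = tag_dim S in
      mat_avg (r * (d + 1)) (keys S) (\<lambda>k.
        tensor_superop r r (d * e) (d + 1) id (decrypt S k)
          (\<A> (tensor_superop r r d (d * e) id (encrypt S k) \<rho>))))"

definition ideal_map ::
  "'k scheme \<Rightarrow> nat \<Rightarrow> (complex mat \<Rightarrow> complex mat) \<Rightarrow> (complex mat \<Rightarrow> complex mat) \<Rightarrow>
   complex mat \<Rightarrow> complex mat" where
  "ideal_map S r \<S>\<^sub>a \<S>\<^sub>r \<rho> =
     (let d = msg_dim S in
      tensor_superop r r d (d + 1) \<S>\<^sub>a (conj_by (msg_embed d)) \<rho>
      + \<S>\<^sub>r (ptrace2 r d \<rho>) \<otimes>\<^sub>k bot_state d)"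

definition QCA :: "'k scheme \<Rightarrow> real \<Rightarrow> bool" where
  "QCA S \<epsilon> \<longleftrightarrow> is_scheme S \<and>
     (\<forall>r>0. \<forall>\<A>. cptp (r * (msg_dim S * tag_dim S)) (r * (msg_dim S * tag_dim S)) \<A> \<longrightarrow>
       (\<exists>\<S>\<^sub>r. cp_map r r \<S>\<^sub>r \<and>
          trace_preserving r (\<lambda>\<rho>. sim_acc S r \<A> \<rho> + \<S>\<^sub>r \<rho>) \<and>
          1 / 2 * diamond_norm (r * msg_dim S) (r * (msg_dim S + 1))
            (\<lambda>\<rho>. real_map S r \<A> \<rho> - ideal_map S r (sim_acc S r \<A>) \<S>\<^sub>r \<rho>) \<le> ereal \<epsilon>))"

definition canonical_scheme ::
  "nat \<Rightarrow> nat \<Rightarrow> 'k set \<Rightarrow> ('k \<Rightarrow> complex mat) \<Rightarrow> ('k \<times> bool list) scheme" where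
  "canonical_scheme m t K V = \<lparr>
     keys = K \<times> pauli_index (m + t),
     msg_dim = 2 ^ m,
     tag_dim = 2 ^ t,
     enc_unitary = (\<lambda>(k\<^sub>1, k\<^sub>2). pauli (m + t) k\<^sub>2 * V k\<^sub>1),
     tag_num = (\<lambda>_. 1),
     tag_prob = (\<lambda>_ _. 1),
     tag_vec = (\<lambda>_ _. unit_vec (2 ^ t) 0) \<rparr>"

end

theory Submission
  imports Defs
begin

text \<open>
  Expand the Kraus operators of the attack as \<open>K\<^sub>i = \<Sum>\<^sub>\<ell> A\<^sub>i\<^sub>\<ell> \<otimes> P\<^sub>\<ell>\<close> with \<open>A\<^sub>i\<^sub>\<ell>\<close> acting on the
  side information. Averaging over the Pauli key \<open>k\<^sub>2\<close> removes all cross terms, so that the attack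
  becomes \<open>\<Sum>\<^sub>\<ell> A\<^sub>\<ell> \<otimes> (P\<^sub>\<ell> \<cdot> P\<^sub>\<ell>\<^sup>*)\<close> with \<open>\<Sum>\<^sub>\<ell> A\<^sub>\<ell>\<close> trace preserving, and each \<open>P\<^sub>\<ell>\<close> is pulled back
  by the code to a Pauli \<open>Q\<^sub>1 \<otimes> Q\<^sub>2\<close> on message and tag. The attack is rejected iff \<open>Q\<^sub>2\<close> flips a
  bit, and the EPR test in the accepting simulator passes iff moreover \<open>Q\<^sub>1 = I\<close>. If the rejecting
  simulator collects all the other terms, then the real and the ideal map differ exactly in the
  terms with \<open>Q\<^sub>1 \<noteq> I\<close> and no bit flip in \<open>Q\<^sub>2\<close>, whose total weight is at most \<open>\<epsilon>\<close> by purity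
  testing. There the real map outputs a message and the ideal map outputs \<open>\<bottom>\<close>, so the difference
  is \<open>X - Y\<close> for orthogonal positive \<open>X\<close>, \<open>Y\<close>, and its trace norm is \<open>tr X + tr Y \<le> 2 \<epsilon>\<close>.
\<close>

section \<open>Matrices and Kronecker products\<close>

text \<open>Attack, simulators and error terms are put in Kraus form, where positivity under an
  ancilla and traces become operator algebra. The Kraus operators of the attack come from its Choi
  matrix, which Cholesky elimination splits into rank-one terms. Cross terms cancel because a Pauli
  key changes a conjugated attack Pauli only by the sign of their commutation relation; as functions
  of the key these signs are characters of an abelian group, hence orthogonal. Inputs may be
  entangled with R and an ancilla, yet the identities between maps are proved on product operators:
  \<open>tensor_superop\<close> reads its factors on matrix units only. The weight of an attack
  Pauli does not involve the code, since message Paulis and the reject map preserve the trace. So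
  purity testing applies to each attack Pauli separately, and the weights sum to 1 by a Parseval
  identity. The identity Pauli, which purity testing leaves out, is pulled back to itself and is
  never a forgery. The factor 1/2 in the definition absorbs the two equal traces.\<close>

lemma dim_mat_adjoint [simp]:
  "dim_row (mat_adjoint A) = dim_col A" "dim_col (mat_adjoint A) = dim_row A"
  by (simp_all add: mat_adjoint_def)

lemma mat_adjoint_carrier [simp, intro]:
  "A \<in> carrier_mat a b \<Longrightarrow> mat_adjoint A \<in> carrier_mat b a"
  by (rule carrier_matI) auto

lemma mat_adjoint_index [simp]:
  "i < dim_col A \<Longrightarrow> j < dim_row A \<Longrightarrow> mat_adjoint A $$ (i, j) = cnj (A $$ (j, i))"
  by (simp add: mat_adjoint_def mat_of_rows_index)

lemma mult_mat_index:
  "A \<in> carrier_mat a b \<Longrightarrow> B \<in> carrier_mat b c \<Longrightarrow> i < a \<Longrightarrow> j < c \<Longrightarrow>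
    (A * B) $$ (i, j) = (\<Sum>k<b. A $$ (i, k) * B $$ (k, j))"
  by (auto simp: scalar_prod_def atLeast0LessThan)

text \<open>Entries of products should not unfold into scalar products of rows and columns: the
  rearrangements below work on the plain sums of \<open>mult_mat_index\<close>.\<close>

declare index_mult_mat(1) [simp del]

lemma eq_mat_carrierI:
  assumes "A \<in> carrier_mat a b" "B \<in> carrier_mat a b"
    and "\<And>i j. i < a \<Longrightarrow> j < b \<Longrightarrow> A $$ (i, j) = B $$ (i, j)"
  shows "A = B"
  using assms by (intro eq_matI) auto

lemma mat_adjoint_one [simp]: "mat_adjoint (1\<^sub>m n) = (1\<^sub>m n :: complex mat)"
  by (rule eq_matI) (auto simp: one_mat_def)

lemma mat_adjoint_adjoint [simp]: "mat_adjoint (mat_adjoint A) = (A :: complex mat)"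
  by (rule eq_matI) auto

lemma mat_adjoint_mult:
  fixes A B :: "complex mat"
  assumes "A \<in> carrier_mat a b" "B \<in> carrier_mat b c"
  shows "mat_adjoint (A * B) = mat_adjoint B * mat_adjoint A" (is "_ = ?R")
proof (rule eq_matI)
  fix i j assume "i < dim_row ?R" "j < dim_col ?R"
  then have ij: "i < c" "j < a" using assms by auto
  then have "mat_adjoint (A * B) $$ (i, j) = cnj ((A * B) $$ (j, i))"
    using assms by (subst mat_adjoint_index) auto
  also have "\<dots> = (\<Sum>k<b. cnj (A $$ (j, k)) * cnj (B $$ (k, i)))"
    using ij by (simp add: mult_mat_index[OF assms])
  also have "\<dots> = ?R $$ (i, j)"
    using ij assms by (subst mult_mat_index[of _ c b _ a])
        (auto intro!: sum.cong simp: mult.commute)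
  finally show "mat_adjoint (A * B) $$ (i, j) = ?R $$ (i, j)" .
qed (use assms in auto)

lemma mat_adjoint_smult: "mat_adjoint (c \<cdot>\<^sub>m A) = cnj c \<cdot>\<^sub>m mat_adjoint A"
  by (rule eq_matI) auto

lemma mat_adjoint_minus:
  fixes A B :: "complex mat"
  assumes "A \<in> carrier_mat a b" "B \<in> carrier_mat a b"
  shows "mat_adjoint (A - B) = mat_adjoint A - mat_adjoint B"
  using assms by (intro eq_matI) auto

section \<open>Pair indices of composite registers\<close>

lemma sum_lessThan_times:
  fixes f :: "nat \<Rightarrow> 'a::comm_monoid_add"
  shows "(\<Sum>k<a * b. f k) = (\<Sum>i<a. \<Sum>j<b. f (i * b + j))"
proof -
  have "(\<Sum>k<a * b. f k) = (\<Sum>(i, j)\<in>{..<a} \<times> {..<b}. f (i * b + j))"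
  proof (rule sum.reindex_bij_witness[where i = "\<lambda>(i, j). i * b + j" and j
      = "\<lambda>k. (k div b, k mod b)"])
    fix k assume k: "k \<in> {..<a * b}"
    then have "b > 0" by (cases b) auto
    with k show "(k div b, k mod b) \<in> {..<a} \<times> {..<b}"
      by (simp add: less_mult_imp_div_less)
  next
    fix p assume "p \<in> {..<a} \<times> {..<b}"
    then obtain i j where p: "p = (i, j)" "i < a" "j < b" by auto
    have "i * b + j < Suc i * b" using p by simp
    also have "\<dots> \<le> a * b" using p by (intro mult_right_mono) auto
    finally show "(case p of (i, j) \<Rightarrow> i * b + j) \<in> {..<a * b}" using p by simp
  qed auto
  then show ?thesis by (simp add: sum.cartesian_product)
qed

lemma pair_index_less: "i < a \<Longrightarrow> j < b \<Longrightarrow> i * b + j < a * (b::nat)"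
proof -
  assume "i < a" "j < b"
  then have "i * b + j < Suc i * b" by simp
  also have "\<dots> \<le> a * b" using \<open>i < a\<close> by (intro mult_right_mono) auto
  finally show ?thesis .
qed

lemma div_mod_less:
  fixes i a b :: nat
  assumes "i < a * b"
  shows "i div b < a" "i mod b < b"
proof -
  show "i mod b < b" using assms by (cases b) auto
  show "i div b < a" using assms by (simp add: less_mult_imp_div_less)
qed

section \<open>Algebra of the Kronecker product\<close>

lemma kron_dim [simp]:
  "dim_row (A \<otimes>\<^sub>k B) = dim_row A * dim_row B" "dim_col (A \<otimes>\<^sub>k B) = dim_col A * dim_col B"
  by (simp_all add: kron_def)

lemma kron_carrier [intro]:
  "A \<in> carrier_mat a a' \<Longrightarrow> B \<in> carrier_mat b b' \<Longrightarrow> A \<otimes>\<^sub>k B \<in> carrier_mat (a * b) (a' * b')"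
  by (rule carrier_matI) auto

lemma kron_index:
  "i < dim_row A * dim_row B \<Longrightarrow> j < dim_col A * dim_col B \<Longrightarrow>
    (A \<otimes>\<^sub>k B) $$ (i, j) = A $$ (i div dim_row B, j div dim_col B)
        * B $$ (i mod dim_row B, j mod dim_col B)"
  by (simp add: kron_def)

lemma kron_index_pair:
  "A \<in> carrier_mat a a' \<Longrightarrow> B \<in> carrier_mat b b' \<Longrightarrow> i < a \<Longrightarrow> k < b \<Longrightarrow> j < a' \<Longrightarrow> l < b' \<Longrightarrow>
    (A \<otimes>\<^sub>k B) $$ (i * b + k, j * b' + l) = A $$ (i, j) * B $$ (k, l)"
  by (subst kron_index) (auto simp: pair_index_less)

text \<open>Comparing entries at pairs \<open>i * b + k\<close> instead of at raw indices keeps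
  \<open>div\<close> and \<open>mod\<close> out of most identities on composite registers.\<close>

lemma eq_mat_pairI:
  assumes "A \<in> carrier_mat (a * b) (a' * b')" "B \<in> carrier_mat (a * b) (a' * b')"
    and "\<And>i j k l. i < a \<Longrightarrow> k < b \<Longrightarrow> j < a' \<Longrightarrow> l < b' \<Longrightarrow>
      A $$ (i * b + k, j * b' + l) = B $$ (i * b + k, j * b' + l)"
  shows "A = B"
proof (rule eq_matI)
  fix i j assume "i < dim_row B" "j < dim_col B"
  then have ij: "i < a * b" "j < a' * b'" using assms by auto
  show "A $$ (i, j) = B $$ (i, j)"
    using assms(3)[OF div_mod_less(1,2)[OF ij(1)] div_mod_less(1,2)[OF ij(2)]] by simp
qed (use assms in auto)

lemma kron_mult:
  assumes "A \<in> carrier_mat a a'" "C \<in> carrier_mat a' a''" "B \<in> carrier_mat b b'" "D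
      \<in> carrier_mat b' b''"
  shows "(A \<otimes>\<^sub>k B) * (C \<otimes>\<^sub>k D) = (A * C) \<otimes>\<^sub>k (B * D)" (is "?L = ?R")
proof (rule eq_mat_pairI[of _ a b a'' b''])
  fix i j k l assume ij: "i < a" "k < b" "j < a''" "l < b''"
  have "?L $$ (i * b + k, j * b'' + l)
      = (\<Sum>x<a' * b'. (A \<otimes>\<^sub>k B) $$ (i * b + k, x) * (C \<otimes>\<^sub>k D) $$ (x, j * b'' + l))"
    using ij assms by (intro mult_mat_index) (auto simp: pair_index_less)
  also have "\<dots> = (\<Sum>x<a'. \<Sum>y<b'. (A $$ (i, x) * C $$ (x, j)) * (B $$ (k, y) * D $$ (y, l)))"
    unfolding sum_lessThan_times
    using ij assms by (intro sum.cong refl) (auto simp: kron_index_pair)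
  also have "\<dots> = (A * C) $$ (i, j) * (B * D) $$ (k, l)"
    using ij assms by (simp add: mult_mat_index[of _ _ a'] mult_mat_index[of _ _ b'] sum_product)
  also have "\<dots> = ?R $$ (i * b + k, j * b'' + l)"
    using ij assms by (intro kron_index_pair[symmetric]) auto
  finally show "?L $$ (i * b + k, j * b'' + l) = ?R $$ (i * b + k, j * b'' + l)" .
qed (use assms in auto)

lemma kron_one: "1\<^sub>m a \<otimes>\<^sub>k 1\<^sub>m b = 1\<^sub>m (a * b)"
proof (rule eq_mat_pairI[of _ a b a b])
  fix i j k l assume ij: "i < a" "k < b" "j < a" "l < b"
  have "i * b + k = j * b + l \<longleftrightarrow> i = j \<and> k = l"
  proof
    assume "i * b + k = j * b + l"
    then have "(i * b + k) div b = (j * b + l) div b" "(i * b + k) mod b = (j * b + l) mod b"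
      by simp_all
    then show "i = j \<and> k = l" using ij by simp
  qed simp
  then show "(1\<^sub>m a \<otimes>\<^sub>k 1\<^sub>m b) $$ (i * b + k, j * b + l) = 1\<^sub>m (a * b) $$ (i * b + k, j * b + l)"
    using ij by (subst kron_index_pair) (auto simp: pair_index_less)
qed auto

lemma kron_adjoint: "mat_adjoint (A \<otimes>\<^sub>k B) = mat_adjoint A \<otimes>\<^sub>k mat_adjoint B"
  by (rule eq_matI) (auto simp: kron_index div_mod_less)

lemma kron_assoc: "(A \<otimes>\<^sub>k B) \<otimes>\<^sub>k C = A \<otimes>\<^sub>k (B \<otimes>\<^sub>k C)"
proof (rule eq_matI)
  fix i j assume ij: "i < dim_row (A \<otimes>\<^sub>k B \<otimes>\<^sub>k C)" "j < dim_col (A \<otimes>\<^sub>k B \<otimes>\<^sub>k C)"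
  define a b c a' b' c' where d: "a = dim_row A" "b = dim_row B" "c = dim_row C"
     "a' = dim_col A" "b' = dim_col B" "c' = dim_col C"
  have i: "i < (a * b) * c" "i < a * (b * c)" and j: "j < (a' * b') * c'" "j < a' * (b' * c')"
    using ij by (auto simp: d mult.assoc)
  \<comment> \<open>Both bracketings split an index into the same three mixed-radix digits; these
    equations identify the digits.\<close>
  have e: "x div z div y = x div (y * z)" "x div z mod y = x mod (y * z) div z"
       "x mod z = x mod (y * z) mod z" for x y z :: nat
  proof -
    show "x div z div y = x div (y * z)" by (metis div_mult2_eq mult.commute)
    show "x div z mod y = x mod (y * z) div z"
      by (cases "z = 0") (simp_all add: mod_mult2_eq[of x z y] mult.commute[of y z])
    show "x mod z = x mod (y * z) mod z" by (simp add: mod_mod_cancel)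
  qed
  show "((A \<otimes>\<^sub>k B) \<otimes>\<^sub>k C) $$ (i, j) = (A \<otimes>\<^sub>k B \<otimes>\<^sub>k C) $$ (i, j)"
    using i j by (simp add: kron_index div_mod_less flip: d)
       (simp add: e(1) e(2)[of i c b] e(2)[of j c' b'] e(3)[of i c b] e(3)[of j c' b'] mult.assoc)
qed (auto simp: mult.assoc)

lemma kron_smult_left: "(c \<cdot>\<^sub>m A) \<otimes>\<^sub>k B = c \<cdot>\<^sub>m (A \<otimes>\<^sub>k B)"
  by (rule eq_matI) (auto simp: kron_index div_mod_less)

lemma kron_smult_right: "A \<otimes>\<^sub>k (c \<cdot>\<^sub>m B) = c \<cdot>\<^sub>m (A \<otimes>\<^sub>k B)"
  by (rule eq_matI) (auto simp: kron_index div_mod_less)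

lemma kron_add_left:
  assumes "B \<in> carrier_mat b b'" "C \<in> carrier_mat b b'"
  shows "(B + C) \<otimes>\<^sub>k A = B \<otimes>\<^sub>k A + C \<otimes>\<^sub>k A"
  using assms by (intro eq_matI) (auto simp: kron_index div_mod_less algebra_simps)

section \<open>Sums of matrices and conjugation\<close>

lemma mat_sum_dim [simp]: "dim_row (mat_sum n I F) = n" "dim_col (mat_sum n I F) = n"
  by (simp_all add: mat_sum_def)

lemma mat_sum_carrier [simp, intro]: "mat_sum n I F \<in> carrier_mat n n"
  by (simp add: mat_sum_def)

lemma mat_sum_index [simp]:
  "i < n \<Longrightarrow> j < n \<Longrightarrow> mat_sum n I F $$ (i, j) = (\<Sum>x\<in>I. F x $$ (i, j))"
  by (simp add: mat_sum_def)

lemma mat_sum_cong [cong]: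
  "n = n' \<Longrightarrow> I = J \<Longrightarrow> (\<And>x. x \<in> J \<Longrightarrow> F x = G x) \<Longrightarrow> mat_sum n I F = mat_sum n' J G"
  by (auto simp: mat_sum_def intro!: cong_mat)

lemma mat_sum_reindex:
  "inj_on h A \<Longrightarrow> mat_sum n (h ` A) F = mat_sum n A (\<lambda>x. F (h x))"
  by (rule eq_matI) (auto simp: sum.reindex)

lemma mat_sum_product:
  "mat_sum n (I \<times> J) F = mat_sum n I (\<lambda>i. mat_sum n J (\<lambda>j. F (i, j)))"
  by (rule eq_matI) (auto simp: sum.cartesian_product)

lemma mat_sum_swap:
  "mat_sum n I (\<lambda>i. mat_sum n J (\<lambda>j. F i j)) = mat_sum n J (\<lambda>j. mat_sum n I (\<lambda>i. F i j))"
  by (rule eq_matI) (auto intro: sum.swap)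

lemma smult_mat_sum:
  assumes "\<And>x. x \<in> I \<Longrightarrow> F x \<in> carrier_mat n n"
  shows "c \<cdot>\<^sub>m mat_sum n I F = mat_sum n I (\<lambda>x. c \<cdot>\<^sub>m F x)" (is "?L = ?R")
proof (rule eq_matI)
  fix i j assume ij: "i < dim_row ?R" "j < dim_col ?R"
  have "(c \<cdot>\<^sub>m F x) $$ (i, j) = c * F x $$ (i, j)" if "x \<in> I" for x
    using assms[OF that] ij by simp
  then show "?L $$ (i, j) = ?R $$ (i, j)"
    using ij by (simp add: sum_distrib_left)
qed auto

lemma mat_sum_add:
  assumes "\<And>x. x \<in> I \<Longrightarrow> F x \<in> carrier_mat n n" "\<And>x. x \<in> I \<Longrightarrow> G x \<in> carrier_mat n n"
  shows "mat_sum n I (\<lambda>x. F x + G x) = mat_sum n I F + mat_sum n I G" (is "?L = ?R")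
proof (rule eq_matI)
  fix i j assume ij: "i < dim_row ?R" "j < dim_col ?R"
  have "(F x + G x) $$ (i, j) = F x $$ (i, j) + G x $$ (i, j)" if "x \<in> I" for x
    using assms(1)[OF that] assms(2)[OF that] ij by simp
  then show "?L $$ (i, j) = ?R $$ (i, j)"
    using ij by (simp add: sum.distrib)
qed auto

lemma mat_sum_minus:
  assumes "\<And>x. x \<in> I \<Longrightarrow> F x \<in> carrier_mat n n" "\<And>x. x \<in> I \<Longrightarrow> G x \<in> carrier_mat n n"
  shows "mat_sum n I (\<lambda>x. F x - G x) = mat_sum n I F - mat_sum n I G" (is "?L = ?R")
proof (rule eq_matI)
  fix i j assume ij: "i < dim_row ?R" "j < dim_col ?R"
  have "(F x - G x) $$ (i, j) = F x $$ (i, j) - G x $$ (i, j)" if "x \<in> I" for x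
    using assms(1)[OF that] assms(2)[OF that] ij by simp
  then show "?L $$ (i, j) = ?R $$ (i, j)"
    using ij by (simp add: sum_subtractf)
qed auto

lemma kron_mat_sum:
  assumes "A \<in> carrier_mat a a" "\<And>x. x \<in> I \<Longrightarrow> F x \<in> carrier_mat n n"
  shows "A \<otimes>\<^sub>k mat_sum n I F = mat_sum (a * n) I (\<lambda>x. A \<otimes>\<^sub>k F x)" (is "?L = ?R")
proof (rule eq_mat_pairI[of _ a n a n])
  fix i j k l assume ij: "i < a" "k < n" "j < a" "l < n"
  then have "?R $$ (i * n + k, j * n + l)
      = (\<Sum>x\<in>I. (A \<otimes>\<^sub>k F x) $$ (i * n + k, j * n + l))"
    by (simp add: pair_index_less)
  also have "\<dots> = (\<Sum>x\<in>I. A $$ (i, j) * F x $$ (k, l))"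
    using ij assms by (intro sum.cong refl kron_index_pair) auto
  finally show "?L $$ (i * n + k, j * n + l) = ?R $$ (i * n + k, j * n + l)"
    using ij assms by (simp add: kron_index_pair[OF assms(1)] sum_distrib_left)
qed (use assms in auto)

section \<open>Conjugation by an operator\<close>

lemma conj_by_carrier [intro]:
  "B \<in> carrier_mat b a \<Longrightarrow> X \<in> carrier_mat a a \<Longrightarrow> conj_by B X \<in> carrier_mat b b"
  by (auto simp: conj_by_def)

lemma conj_by_dim [simp]: "dim_row (conj_by B X) = dim_row B" "dim_col (conj_by B X) = dim_row B"
  by (simp_all add: conj_by_def)

lemma conj_by_index:
  assumes "B \<in> carrier_mat b a" "X \<in> carrier_mat a a" "i < b" "j < b"
  shows "conj_by B X $$ (i, j) = (\<Sum>k<a. \<Sum>l<a. B $$ (i, k) * X $$ (k, l) * cnj (B $$ (j, l)))"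
      (is "_ = ?R")
proof -
  have "conj_by B X $$ (i, j) = (\<Sum>l<a. (B * X) $$ (i, l) * mat_adjoint B $$ (l, j))"
    unfolding conj_by_def using assms by (intro mult_mat_index) auto
  also have "\<dots> = (\<Sum>l<a. \<Sum>k<a. B $$ (i, k) * X $$ (k, l) * cnj (B $$ (j, l)))"
    using assms by (intro sum.cong refl) (auto simp: mult_mat_index[of B b a X a] sum_distrib_right)
  also have "\<dots> = ?R"
    by (rule sum.swap)
  finally show ?thesis .
qed

lemma conj_by_conj_by:
  assumes "B \<in> carrier_mat c b" "A \<in> carrier_mat b a" "X \<in> carrier_mat a a"
  shows "conj_by B (conj_by A X) = conj_by (B * A) X"
proof -
  have "conj_by (B * A) X = B * A * X * (mat_adjoint A * mat_adjoint B)"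
    using assms by (simp add: conj_by_def mat_adjoint_mult[of B c b A a])
  also have "\<dots> = B * (A * X * mat_adjoint A) * mat_adjoint B"
  proof -
    have c: "mat_adjoint A \<in> carrier_mat a b" "mat_adjoint B \<in> carrier_mat b c" using assms by auto
    have 1: "B * A * X = B * (A * X)" using assms by (intro assoc_mult_mat) auto
    have 2: "B * (A * X) * (mat_adjoint A * mat_adjoint B) = B * (A * X) * mat_adjoint A
        * mat_adjoint B"
      using assms c by (intro assoc_mult_mat[symmetric, where ?n\<^sub>4.0 = c and ?n\<^sub>3.0 = b and ?n\<^sub>2.0
          = a and ?n\<^sub>1.0 = c]) auto
    have 3: "B * (A * X) * mat_adjoint A = B * (A * X * mat_adjoint A)"
      using assms c by (intro assoc_mult_mat) auto
    show ?thesis by (simp only: 1 2 3)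
  qed
  finally show ?thesis by (simp add: conj_by_def)
qed

lemma conj_by_kron:
  assumes "A \<in> carrier_mat a' a" "B \<in> carrier_mat b' b" "X \<in> carrier_mat a a" "Y \<in> carrier_mat b b"
  shows "conj_by (A \<otimes>\<^sub>k B) (X \<otimes>\<^sub>k Y) = conj_by A X \<otimes>\<^sub>k conj_by B Y" (is "?L = _")
proof -
  have "?L = ((A * X) \<otimes>\<^sub>k (B * Y)) * (mat_adjoint A \<otimes>\<^sub>k mat_adjoint B)"
    using assms by (simp add: conj_by_def kron_adjoint kron_mult[of A a' a X a B b' b Y b])
  then show ?thesis
    using assms by (simp add: conj_by_def kron_mult[of "A * X" a' a "mat_adjoint A" a' "B
        * Y" b' b "mat_adjoint B" b'])
qed

lemma conj_by_add:
  assumes "B \<in> carrier_mat b a" "X \<in> carrier_mat a a" "Y \<in> carrier_mat a a"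
  shows "conj_by B (X + Y) = conj_by B X + conj_by B Y"
  unfolding conj_by_def using assms
  by (simp add: mult_add_distrib_mat[OF assms]
      add_mult_distrib_mat[of "B * X" b a "B * Y" "mat_adjoint B" b])

lemma conj_by_smult:
  assumes "B \<in> carrier_mat b a" "X \<in> carrier_mat a a"
  shows "conj_by B (c \<cdot>\<^sub>m X) = c \<cdot>\<^sub>m conj_by B X"
  unfolding conj_by_def using assms
  by (simp add: mult_smult_distrib[OF assms] mult_smult_assoc_mat[of "B * X" b a "mat_adjoint B" b])

lemma conj_by_smult_left:
  assumes "B \<in> carrier_mat b a" "X \<in> carrier_mat a a"
  shows "conj_by (c \<cdot>\<^sub>m B) X = (c * cnj c) \<cdot>\<^sub>m conj_by B X" (is "?L = _")
proof -
  have "?L = c \<cdot>\<^sub>m (cnj c \<cdot>\<^sub>m conj_by B X)"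
    unfolding conj_by_def mat_adjoint_smult using assms
    by (simp add: mult_smult_assoc_mat[OF assms]
        mult_smult_distrib[of "B * X" b a "mat_adjoint B" b]
        mult_smult_assoc_mat[of "B * X" b a "cnj c \<cdot>\<^sub>m mat_adjoint B" b])
  then show ?thesis by (auto intro!: eq_matI)
qed

lemma conj_by_one: "X \<in> carrier_mat a a \<Longrightarrow> conj_by (1\<^sub>m a) X = X"
  by (simp add: conj_by_def)

lemma conj_by_mat_sum:
  assumes "B \<in> carrier_mat b a" "\<And>x. x \<in> I \<Longrightarrow> F x \<in> carrier_mat a a"
  shows "conj_by B (mat_sum a I F) = mat_sum b I (\<lambda>x. conj_by B (F x))" (is "?L = ?R")
proof (rule eq_mat_carrierI[of _ b b])
  fix i j assume ij: "i < b" "j < b"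
  have "?L $$ (i, j)
      = (\<Sum>k<a. \<Sum>l<a. \<Sum>x\<in>I. B $$ (i, k) * F x $$ (k, l) * cnj (B $$ (j, l)))"
    using ij assms by (subst conj_by_index[of _ b a])
      (auto simp: sum_distrib_left sum_distrib_right intro!: sum.cong)
  also have "\<dots> = (\<Sum>x\<in>I. \<Sum>k<a. \<Sum>l<a. B $$ (i, k) * F x $$ (k, l) * cnj (B $$ (j, l)))"
    by (simp add: sum.swap[of _ I])
  also have "\<dots> = (\<Sum>x\<in>I. conj_by B (F x) $$ (i, j))"
    using ij assms by (intro sum.cong refl conj_by_index[symmetric]) auto
  finally show "?L $$ (i, j) = ?R $$ (i, j)"
    using ij by simp
qed (use assms in auto)

text \<open>Cyclicity of the trace: only the Gram matrix of \<open>B\<close> matters. The weights of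
  the attack Paulis are computed through this.\<close>

lemma mtrace_conj_by:
  assumes "B \<in> carrier_mat b a" "X \<in> carrier_mat a a"
  shows "mtrace (conj_by B X) = (\<Sum>k<a. \<Sum>l<a. (mat_adjoint B * B) $$ (l, k) * X $$ (k, l))"
      (is "_ = ?R")
proof -
  have "mtrace (conj_by B X) = (\<Sum>i<b. \<Sum>k<a. \<Sum>l<a. cnj (B $$ (i, l)) * B $$ (i, k) * X $$ (k, l))"
    using assms by (simp add: mtrace_def conj_by_index[OF assms] mult.commute mult.left_commute)
  also have "\<dots> = (\<Sum>k<a. \<Sum>l<a. \<Sum>i<b. cnj (B $$ (i, l)) * B $$ (i, k) * X $$ (k, l))"
    by (subst sum.swap, intro sum.cong refl sum.swap)
  also have "\<dots> = ?R"
    using assms by (intro sum.cong refl) (auto simp: mult_mat_index[of _ a b B a] sum_distrib_right)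
  finally show ?thesis .
qed

lemma mtrace_mat_sum: "mtrace (mat_sum n I F) = (\<Sum>x\<in>I. \<Sum>i<n. F x $$ (i, i))"
  by (simp add: mtrace_def sum.swap[of _ I])

lemma mtrace_add: "A \<in> carrier_mat n n \<Longrightarrow> B \<in> carrier_mat n n \<Longrightarrow> mtrace (A + B) = mtrace A + mtrace B"
  by (auto simp: mtrace_def sum.distrib)

lemma mtrace_smult: "A \<in> carrier_mat n n \<Longrightarrow> mtrace (c \<cdot>\<^sub>m A) = c * mtrace A"
  by (auto simp: mtrace_def sum_distrib_left)

lemma mtrace_kron:
  assumes "A \<in> carrier_mat a a" "B \<in> carrier_mat b b"
  shows "mtrace (A \<otimes>\<^sub>k B) = mtrace A * mtrace B"
  using assms by (simp add: mtrace_def sum_lessThan_times kron_index_pair[OF assms] sum_product)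

section \<open>Positive semidefinite matrices\<close>

text \<open>The argument is a function rather than a vector, so that test vectors can be given by
  cases or by updating one coordinate without carrier conditions.\<close>

definition quad_form :: "nat \<Rightarrow> complex mat \<Rightarrow> (nat \<Rightarrow> complex) \<Rightarrow> complex" where
  "quad_form n A f = (\<Sum>i<n. \<Sum>j<n. cnj (f i) * A $$ (i, j) * f j)"

lemma quad_form_vec:
  assumes "A \<in> carrier_mat n n" "v \<in> carrier_vec n"
  shows "(A *\<^sub>v v) \<bullet>c v = quad_form n A (\<lambda>i. v $ i)" (is "?L = _")
proof -
  have "?L = (\<Sum>i<n. (\<Sum>j<n. A $$ (i, j) * v $ j) * cnj (v $ i))"
    using assms by (auto simp: scalar_prod_def atLeast0LessThan intro!: sum.cong)
  then show ?thesis by (simp add: quad_form_def sum_distrib_left sum_distrib_right mult_ac)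
qed

lemma psd_iff: "psd n A \<longleftrightarrow> A \<in> carrier_mat n n \<and> (\<forall>f. 0 \<le> quad_form n A f)"
proof -
  have "0 \<le> quad_form n A f" if "psd n A" for f
  proof -
    have "0 \<le> (A *\<^sub>v vec n f) \<bullet>c vec n f" using that by (auto simp: psd_def)
    moreover have "(A *\<^sub>v vec n f) \<bullet>c vec n f = quad_form n A (\<lambda>i. vec n f $ i)"
      using that by (intro quad_form_vec) (auto simp: psd_def)
    ultimately show ?thesis by (simp add: quad_form_def)
  qed
  moreover have "psd n A" if "A \<in> carrier_mat n n" "\<forall>f. 0 \<le> quad_form n A f"
    using that by (simp add: psd_def quad_form_vec)
  ultimately show ?thesis by (auto simp: psd_def)
qed

lemma psd_carrier: "psd n A \<Longrightarrow> A \<in> carrier_mat n n"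
  by (simp add: psd_def)

lemma psd_quad_form: "psd n A \<Longrightarrow> 0 \<le> quad_form n A f"
  by (simp add: psd_iff)

lemma quad_form_conj_by:
  assumes "B \<in> carrier_mat b a" "X \<in> carrier_mat a a"
  shows "quad_form b (conj_by B X) f = quad_form a X (\<lambda>l. \<Sum>j<b. cnj (B $$ (j, l)) * f j)"
      (is "?L = ?R")
proof -
  let ?t = "\<lambda>i j k l. cnj (f i) * B $$ (i, k) * X $$ (k, l) * (cnj (B $$ (j, l)) * f j)"
  have "?L =
     (\<Sum>i<b. \<Sum>j<b. \<Sum>k<a. \<Sum>l<a. ?t i j k l)"
    by (simp add: quad_form_def conj_by_index[OF assms] sum_distrib_left sum_distrib_right mult_ac)
  also have "\<dots> = (\<Sum>i<b. \<Sum>k<a. \<Sum>j<b. \<Sum>l<a. ?t i j k l)"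
    by (intro sum.cong refl sum.swap)
  also have "\<dots> = (\<Sum>k<a. \<Sum>i<b. \<Sum>j<b. \<Sum>l<a. ?t i j k l)"
    by (rule sum.swap)
  also have "\<dots> = (\<Sum>k<a. \<Sum>i<b. \<Sum>l<a. \<Sum>j<b. ?t i j k l)"
    by (intro sum.cong refl sum.swap)
  also have "\<dots> = (\<Sum>k<a. \<Sum>l<a. \<Sum>i<b. \<Sum>j<b. ?t i j k l)"
    by (intro sum.cong refl sum.swap)
  also have "\<dots> = ?R"
    by (simp add: quad_form_def sum_distrib_left sum_distrib_right mult_ac)
  finally show ?thesis .
qed

lemma psd_conj_by: "psd a X \<Longrightarrow> B \<in> carrier_mat b a \<Longrightarrow> psd b (conj_by B X)"
  using quad_form_conj_by[of B b a X] by (auto simp: psd_iff)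

lemma psd_add: "psd n A \<Longrightarrow> psd n B \<Longrightarrow> psd n (A + B)"
proof -
  assume A: "psd n A" and B: "psd n B"
  have "quad_form n (A + B) f = quad_form n A f + quad_form n B f" for f
    using psd_carrier[OF A] psd_carrier[OF B] by (simp add: quad_form_def algebra_simps sum.distrib)
  then show ?thesis using A B by (auto simp: psd_iff)
qed

lemma psd_smult: "psd n A \<Longrightarrow> 0 \<le> c \<Longrightarrow> psd n (c \<cdot>\<^sub>m A)"
proof -
  assume A: "psd n A" and c: "0 \<le> c"
  have "quad_form n (c \<cdot>\<^sub>m A) f = c * quad_form n A f" for f
    using psd_carrier[OF A] by (simp add: quad_form_def sum_distrib_left mult_ac)
  then show ?thesis using A c by (auto simp: psd_iff)
qed

lemma psd_mat_sum:
  assumes "\<And>x. x \<in> I \<Longrightarrow> psd n (F x)"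
  shows "psd n (mat_sum n I F)"
proof -
  have "quad_form n (mat_sum n I F) f = (\<Sum>x\<in>I. quad_form n (F x) f)" for f
    by (simp add: quad_form_def sum_distrib_left sum_distrib_right sum.swap[of _ I])
  then show ?thesis using assms by (auto simp: psd_iff intro: sum_nonneg)
qed

text \<open>Test vectors supported on two coordinates reduce statements about an off-diagonal entry
  to a 2 x 2 block.\<close>

lemma quad_form_two:
  assumes "i < n" "j < n" "i \<noteq> j"
  shows "quad_form n A (\<lambda>k. if k = i then x else if k = j then y else 0) =
    cnj x * A $$ (i, i) * x + cnj x * A $$ (i, j) * y + cnj y * A $$ (j, i) * x + cnj y
        * A $$ (j, j) * y"
proof -
  have sum2: "(\<Sum>k<n. g k) = g i + g j" if "\<And>k. k \<noteq> i \<Longrightarrow> k \<noteq> j \<Longrightarrow> g k = 0" for g :: "nat \<Rightarrow> complex"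
  proof -
    have "(\<Sum>k<n. g k) = (\<Sum>k\<in>{i, j}. g k)"
      using assms that by (intro sum.mono_neutral_right) auto
    then show ?thesis using assms by simp
  qed
  show ?thesis unfolding quad_form_def
    using assms by (subst sum2, simp) (subst (1 2) sum2, simp_all add: algebra_simps)
qed

lemma psd_diag:
  assumes "psd n A" "i < n"
  shows "0 \<le> A $$ (i, i)"
proof -
  have "quad_form n A (\<lambda>k. if k = i then 1 else 0) = A $$ (i, i)"
  proof -
    have "quad_form n A (\<lambda>k. if k = i then 1 else 0)
        = (\<Sum>k<n. \<Sum>l<n. if l = i then if k = i then A $$ (i, i) else 0 else 0)"
      unfolding quad_form_def by (intro sum.cong refl) auto
    then show ?thesis using assms(2) by simp
  qed
  then show ?thesis using psd_quad_form[OF assms(1)] by metis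
qed

text \<open>\<open>psd\<close> does not ask for a Hermitian matrix; over the complex numbers this
  follows because the form takes real values. The test vector (1, 1) shows that the imaginary parts
  of the two entries are opposite, (1, i) that the real parts agree.\<close>

lemma psd_index_cnj:
  assumes "psd n A" "i < n" "j < n"
  shows "A $$ (j, i) = cnj (A $$ (i, j))"
proof (cases "i = j")
  case True
  then show ?thesis using psd_diag[OF assms(1,2)] by (auto simp: complex_eq_iff less_eq_complex_def)
next
  case False
  have *: "0 \<le> cnj x * A $$ (i, i) * x + cnj x * A $$ (i, j) * y + cnj y * A $$ (j, i) * x + cnj y
      * A $$ (j, j) * y" for x y
    using psd_quad_form[OF assms(1), of "\<lambda>k. if k = i then x else if k = j then y else 0"]
    by (simp add: quad_form_two[OF assms(2,3) False])
  have "Im (A $$ (i, i)) = 0" "Im (A $$ (j, j)) = 0"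
    using psd_diag[OF assms(1)] assms(2,3) by (auto simp: less_eq_complex_def)
  then show ?thesis using *[of 1 1] *[of 1 \<i>]
    by (auto simp: less_eq_complex_def complex_eq_iff)
qed

lemma psd_adjoint: "psd n A \<Longrightarrow> mat_adjoint A = A"
proof (rule eq_matI)
  assume A: "psd n A"
  fix i j assume "i < dim_row A" "j < dim_col A"
  then show "mat_adjoint A $$ (i, j) = A $$ (i, j)"
    using psd_carrier[OF A] psd_index_cnj[OF A, of j i] by (subst mat_adjoint_index) auto
qed (use psd_carrier[of n A] in auto)

text \<open>Without diagonal terms the form on two coordinates changes sign with \<open>y\<close>,
  so nonnegativity forces it to vanish. The four directions 1, -1, i, -i cover real and imaginary
  part.\<close>

lemma psd_zero_diag:
  assumes "psd n A" "\<And>i. i < n \<Longrightarrow> A $$ (i, i) = 0"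
  shows "A = 0\<^sub>m n n"
proof (rule eq_mat_carrierI[of _ n n])
  fix i j assume ij: "i < n" "j < n"
  have "A $$ (i, j) = 0"
  proof (cases "i = j")
    case False
    have "0 \<le> cnj x * A $$ (i, j) * y + cnj y * A $$ (j, i) * x" for x y
      using psd_quad_form[OF assms(1), of "\<lambda>k. if k = i then x else if k = j then y else 0"]
          assms(2) ij
      by (simp add: quad_form_two[OF ij False])
    from this[of 1 1] this[of 1 "-1"] this[of 1 \<i>] this[of 1 "-\<i>"] psd_index_cnj[OF assms(1) ij]
    show ?thesis by (auto simp: less_eq_complex_def complex_eq_iff)
  qed (use assms ij in simp)
  then show "A $$ (i, j) = 0\<^sub>m n n $$ (i, j)" using ij by simp
qed (use psd_carrier[OF assms(1)] in auto)

lemma psd_mtrace_nonneg: "psd n A \<Longrightarrow> 0 \<le> mtrace A"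
  using psd_carrier[of n A] psd_diag[of n A] by (auto simp: mtrace_def intro!: sum_nonneg)

lemma psd_mtrace_zero:
  assumes "psd n A" "mtrace A = 0"
  shows "A = 0\<^sub>m n n"
proof (rule psd_zero_diag[OF assms(1)])
  fix i assume "i < n"
  have "(\<Sum>i<n. Re (A $$ (i, i))) = Re (mtrace A)"
    using psd_carrier[OF assms(1)] by (auto simp: mtrace_def)
  then have "(\<Sum>i<n. Re (A $$ (i, i))) = 0" using assms(2) by simp
  moreover have "0 \<le> Re (A $$ (i, i))" "Im (A $$ (i, i)) = 0" if "i < n" for i
    using psd_diag[OF assms(1) that] by (auto simp: less_eq_complex_def)
  ultimately show "A $$ (i, i) = 0"
    using \<open>i < n\<close> by (subst (asm) sum_nonneg_eq_0_iff) (auto simp: complex_eq_iff)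
qed

section \<open>Sums of rank-one matrices\<close>

lemma quad_form_outer:
  "quad_form n (mat n n (\<lambda>(i, j). w i * cnj (w j))) f = of_real ((cmod (\<Sum>j<n. cnj (w j) * f j))\<^sup>2)"
proof -
  have "quad_form n (mat n n (\<lambda>(i, j). w i * cnj (w j))) f
      = (\<Sum>i<n. cnj (f i) * w i) * (\<Sum>j<n. cnj (w j) * f j)"
    by (simp add: quad_form_def sum_product mult.assoc)
  also have "(\<Sum>i<n. cnj (f i) * w i) = cnj (\<Sum>i<n. cnj (w i) * f i)"
    by (simp add: mult.commute)
  finally have "quad_form n (mat n n (\<lambda>(i, j). w i * cnj (w j))) f
      = cnj (\<Sum>i<n. cnj (w i) * f i) * (\<Sum>j<n. cnj (w j) * f j)" .
  then show ?thesis unfolding complex_norm_square by (simp only: mult.commute)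
qed

lemma psd_outer: "psd n (mat n n (\<lambda>(i, j). w i * cnj (w j)))"
  by (auto simp: psd_iff quad_form_outer less_eq_complex_def)

text \<open>One step of the Cholesky factorisation: subtracting \<open>w w\<^sup>*\<close> clears row and column \<open>k\<close>.\<close>

lemma psd_eliminate:
  assumes "psd n A" "k < n" "A $$ (k, k) \<noteq> 0"
  shows "\<exists>w B. psd n B \<and> (\<forall>i<n. \<forall>j<n. A $$ (i, j) = B $$ (i, j) + w i * cnj (w j)) \<and> B $$ (k, k)
      = 0"
proof -
  define r where "r = Re (A $$ (k, k))"
  have r: "A $$ (k, k) = of_real r" "r > 0"
    using psd_diag[OF assms(1,2)] assms(3) by (auto simp: r_def less_eq_complex_def complex_eq_iff)
  \<comment> \<open>With this scaling \<open>w i * cnj (w j)\<close> is the correction A_ik A_kj /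
    A_kk of the Schur complement.\<close>
  define w where "w i = A $$ (i, k) / of_real (sqrt r)" for i
  define B where "B = mat n n (\<lambda>(i, j). A $$ (i, j) - w i * cnj (w j))"
  have sq: "complex_of_real (sqrt r) * complex_of_real (sqrt r) = of_real r"
    using r(2) by (metis of_real_mult real_sqrt_mult_self abs_of_pos)
  have ww: "w i * cnj (w j) = A $$ (i, k) * A $$ (k, j) / of_real r" if "i < n" "j < n" for i j
    using psd_index_cnj[OF assms(1) that(2) assms(2)] by (simp add: w_def sq)
  \<comment> \<open>Completing the square: the Schur complement evaluates \<open>A\<close> with
    coordinate \<open>k\<close> shifted to the minimiser of the form, so positivity is
    inherited.\<close>
  have "quad_form n B f = quad_form n A (f(k := f k - (\<Sum>j<n. A $$ (k, j) * f j) / of_real r))" for f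
  proof -
    define s where "s = (\<Sum>j<n. A $$ (k, j) * f j)"
    define c where "c = s / of_real r"
    have s': "(\<Sum>i<n. cnj (f i) * A $$ (i, k)) = cnj s"
      using psd_index_cnj[OF assms(1,2)] by (simp add: s_def mult.commute)
    define e where "e i = (if i = k then c else 0)" for i
    have fe: "f(k := f k - c) = (\<lambda>i. f i - e i)" by (auto simp: e_def)
    have "quad_form n A (f(k := f k - c)) =
        quad_form n A f - (\<Sum>i<n. \<Sum>j<n. cnj (f i) * A $$ (i, j) * e j)
        - (\<Sum>i<n. \<Sum>j<n. cnj (e i) * A $$ (i, j) * f j) + (\<Sum>i<n. \<Sum>j<n. cnj (e i) * A $$ (i, j) * e j)"
      unfolding fe quad_form_def by (simp add: algebra_simps sum.distrib sum_subtractf)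
    also have "(\<Sum>i<n. \<Sum>j<n. cnj (f i) * A $$ (i, j) * e j) = c * cnj s"
    proof -
      have "(\<Sum>j<n. cnj (f i) * A $$ (i, j) * e j)
          = (\<Sum>j<n. if j = k then c * (cnj (f i) * A $$ (i, k)) else 0)" for i
        by (intro sum.cong refl) (simp add: e_def)
      then show ?thesis using assms(2) by (simp flip: sum_distrib_left add: s')
    qed
    also have "(\<Sum>i<n. \<Sum>j<n. cnj (e i) * A $$ (i, j) * f j) = cnj c * s"
    proof -
      have "(\<Sum>i<n. \<Sum>j<n. cnj (e i) * A $$ (i, j) * f j)
          = (\<Sum>i<n. cnj (e i) * (\<Sum>j<n. A $$ (i, j) * f j))"
        by (simp add: sum_distrib_left mult_ac)
      also have "\<dots> = (\<Sum>i<n. if i = k then cnj c * s else 0)"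
        by (intro sum.cong) (auto simp: e_def s_def)
      finally show ?thesis using assms(2) by simp
    qed
    also have "(\<Sum>i<n. \<Sum>j<n. cnj (e i) * A $$ (i, j) * e j) = cnj c * c * of_real r"
    proof -
      have "(\<Sum>j<n. cnj (e i) * A $$ (i, j) * e j)
          = (\<Sum>j<n. if j = k then if i = k then cnj c * c * of_real r else 0 else 0)" for i
        by (intro sum.cong refl) (simp add: e_def r(1))
      then show ?thesis using assms(2) by simp
    qed
    also have "quad_form n A f - c * cnj s - cnj c * s + cnj c * c * of_real r = quad_form n A f - s
        * cnj s / of_real r"
      using r(2) by (simp add: c_def)
    also have "\<dots> = quad_form n B f"
    proof -
      have "quad_form n B f = (\<Sum>i<n. \<Sum>j<n. cnj (f i) * A $$ (i, j) * f j
          - (cnj (f i) * A $$ (i, k)) * (A $$ (k, j) * f j) / of_real r)"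
        unfolding quad_form_def by (intro sum.cong refl) (simp add: B_def ww algebra_simps)
      also have "\<dots> = quad_form n A f - (\<Sum>i<n. \<Sum>j<n. (cnj (f i) * A $$ (i, k)) * (A $$ (k, j) * f j))
          / of_real r"
        by (simp add: sum_subtractf quad_form_def sum_divide_distrib)
      also have "(\<Sum>i<n. \<Sum>j<n. (cnj (f i) * A $$ (i, k)) * (A $$ (k, j) * f j)) = cnj s * s"
        unfolding s'[symmetric] by (simp add: s_def sum_product)
      finally show ?thesis by (simp add: mult.commute)
    qed
    finally show ?thesis unfolding c_def s_def by (rule sym)
  qed
  then have "psd n B" using assms(1) by (auto simp: psd_iff B_def)
  moreover have "B $$ (k, k) = 0"
    using assms(2) ww[of k k] r by (simp add: B_def)
  ultimately show ?thesis by (intro exI[of _ w] exI[of _ B]) (auto simp: B_def)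
qed

text \<open>Elimination is iterated at fixed size; what decreases is the number of nonzero diagonal
  entries. Once none is left the matrix is zero by \<open>psd_zero_diag\<close>.\<close>

lemma psd_outer_decomposition:
  assumes "psd n A"
  shows "\<exists>(p::nat) w. \<forall>i<n. \<forall>j<n. A $$ (i, j) = (\<Sum>s<p. w s i * cnj (w s j))"
  using assms
proof (induction "card {i. i < n \<and> A $$ (i, i) \<noteq> 0}" arbitrary: A rule: less_induct)
  case less
  show ?case
  proof (cases "\<exists>k<n. A $$ (k, k) \<noteq> 0")
    case False
    then have "A = 0\<^sub>m n n" using psd_zero_diag less.prems by blast
    show ?thesis by (rule exI[of _ "0::nat"]) (simp add: \<open>A = 0\<^sub>m n n\<close>)
  next
    case True
    then obtain k where k: "k < n" "A $$ (k, k) \<noteq> 0" by auto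
    obtain w B where wB: "psd n B" "\<And>i j. i < n \<Longrightarrow> j < n \<Longrightarrow> A $$ (i, j) = B $$ (i, j) + w i
        * cnj (w j)"
      "B $$ (k, k) = 0" using psd_eliminate[OF less.prems k] by blast
    \<comment> \<open>A cleared diagonal position is never refilled: there B_ii and |w_i|^2 are both
      nonnegative and sum to 0.\<close>
    have "B $$ (i, i) = 0" if "i < n" "A $$ (i, i) = 0" for i
      using wB(2)[OF that(1,1)] psd_diag[OF wB(1) that(1)] that(2)
      by (simp add: complex_eq_iff less_eq_complex_def) (smt (verit) zero_le_square)
    then have "{i. i < n \<and> B $$ (i, i) \<noteq> 0} \<subset> {i. i < n \<and> A $$ (i, i) \<noteq> 0}"
      using k wB(3) by blast
    then have "card {i. i < n \<and> B $$ (i, i) \<noteq> 0} < card {i. i < n \<and> A $$ (i, i) \<noteq> 0}"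
      by (intro psubset_card_mono) auto
    from less.hyps[OF this wB(1)] obtain p :: nat where
      "\<exists>v. \<forall>i<n. \<forall>j<n. B $$ (i, j) = (\<Sum>s<p. v s i * cnj (v s j))" ..
    then obtain v where "\<forall>i<n. \<forall>j<n. B $$ (i, j) = (\<Sum>s<p. v s i * cnj (v s j))" ..
    then have "\<forall>i<n. \<forall>j<n. A $$ (i, j) = (\<Sum>s<Suc p. (v(p := w)) s i * cnj ((v(p := w)) s j))"
      using wB(2) by simp
    then show ?thesis by (intro exI)
  qed
qed

section \<open>Square roots, trace norm and support projectors\<close>

lemma mtrace_mult_commute:
  assumes "A \<in> carrier_mat n m" "B \<in> carrier_mat m n"
  shows "mtrace (A * B) = mtrace (B * A)"
proof -
  have "mtrace (A * B) = (\<Sum>i<n. \<Sum>k<m. A $$ (i, k) * B $$ (k, i))"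
    using assms by (simp add: mtrace_def mult_mat_index[OF assms])
  also have "\<dots> = (\<Sum>k<m. \<Sum>i<n. A $$ (i, k) * B $$ (k, i))" by (rule sum.swap)
  also have "\<dots> = mtrace (B * A)"
    using assms by (simp add: mtrace_def mult_mat_index[OF assms(2,1)] mult.commute)
  finally show ?thesis .
qed

text \<open>Diagonal entry \<open>i\<close> of the square is the squared norm of row
  \<open>i\<close>.\<close>

lemma hermitian_square_zero:
  fixes H :: "complex mat"
  assumes "H \<in> carrier_mat n n" "mat_adjoint H = H" "H * H = 0\<^sub>m n n"
  shows "H = 0\<^sub>m n n"
proof (rule eq_mat_carrierI[of _ n n])
  fix i j assume ij: "i < n" "j < n"
  have herm: "H $$ (k, i) = cnj (H $$ (i, k))" if "k < n" for k
    using assms(1,2) that ij mat_adjoint_index[of k H i] by auto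
  have "(\<Sum>k<n. H $$ (i, k) * H $$ (k, i)) = 0"
    using assms(3) ij mult_mat_index[OF assms(1) assms(1) ij(1) ij(1)] by simp
  also have "(\<Sum>k<n. H $$ (i, k) * H $$ (k, i)) = of_real (\<Sum>k<n. (cmod (H $$ (i, k)))\<^sup>2)"
    by (simp only: of_real_sum complex_norm_square) (simp add: herm)
  finally have "(\<Sum>k<n. (cmod (H $$ (i, k)))\<^sup>2) = 0" by (metis of_real_eq_0_iff)
  then show "H $$ (i, j) = 0\<^sub>m n n $$ (i, j)"
    using ij by (subst (asm) sum_nonneg_eq_0_iff) auto
qed (use assms in auto)

text \<open>For \<open>D = B - C\<close> the hypothesis says \<open>B D + D C = 0\<close>, so \<open>D B D\<close>
    and \<open>D C D\<close> have opposite traces;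
  as both are positive, they vanish, and so does \<open>D\<^sup>3 = D B D - D C D\<close>.\<close>

lemma psd_sqrt_unique:
  assumes "psd n B" "psd n C" "B * B = C * C"
  shows "B = C"
proof -
  have B: "B \<in> carrier_mat n n" and C: "C \<in> carrier_mat n n" using assms psd_carrier by auto
  define D where "D = B - C"
  have D: "D \<in> carrier_mat n n" using B C by (auto simp: D_def)
  have D_adj: "mat_adjoint D = D"
    using mat_adjoint_minus[OF B C] psd_adjoint assms by (simp add: D_def)
  have cB: "conj_by D B = D * B * D" and cC: "conj_by D C = D * C * D"
    by (simp_all add: conj_by_def D_adj)
  have "B * D + D * C = 0\<^sub>m n n"
  proof -
    have "B * D = B * B - B * C" "D * C = B * C - C * C"
      using B C by (auto simp: D_def mult_minus_distrib_mat minus_mult_distrib_mat)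
    then show ?thesis using assms(3) B C by (auto intro!: eq_matI)
  qed
  then have "D * (B * D + D * C) = 0\<^sub>m n n" using D by simp
  then have "D * (B * D) + D * (D * C) = 0\<^sub>m n n"
    using B C D by (simp add: mult_add_distrib_mat[of D n n "B * D" n "D * C"])
  then have "mtrace (D * (B * D)) + mtrace (D * (D * C)) = 0"
    using B C D mtrace_add[of "D * (B * D)" n "D * (D * C)"] by (simp add: mtrace_def)
  moreover have "mtrace (D * (D * C)) = mtrace (D * C * D)"
    using C D by (intro mtrace_mult_commute) auto
  moreover have "D * (B * D) = D * B * D" using B D by (simp add: assoc_mult_mat[of D n n B n D n])
  ultimately have "mtrace (conj_by D B) + mtrace (conj_by D C) = 0"
    by (simp add: cB cC)
  moreover have pB: "psd n (conj_by D B)" and pC: "psd n (conj_by D C)" using assms D psd_conj_by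
    by auto
  moreover have "0 \<le> mtrace (conj_by D B)" "0 \<le> mtrace (conj_by D C)"
    using pB pC psd_mtrace_nonneg by auto
  ultimately have "mtrace (conj_by D B) = 0" "mtrace (conj_by D C) = 0"
    by (simp_all add: less_eq_complex_def complex_eq_iff)
  then have "conj_by D B = 0\<^sub>m n n" "conj_by D C = 0\<^sub>m n n"
    using psd_mtrace_zero[OF pB] psd_mtrace_zero[OF pC] by blast+
  then have "D * B * D - D * C * D = 0\<^sub>m n n" by (simp add: cB cC)
  moreover have "D * D * D = D * B * D - D * C * D"
  proof -
    have "D * D = D * B - D * C" using B C D mult_minus_distrib_mat[OF D B C] by (simp add: D_def)
    then show ?thesis using B C D minus_mult_distrib_mat[of "D * B" n n "D * C" D n] by simp
  qed
  ultimately have D3: "D * D * D = 0\<^sub>m n n" by simp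
  \<comment> \<open>A vanishing cube says nothing directly, but the fourth power is the square of
    the Hermitian \<open>D * D\<close>. So \<open>hermitian_square_zero\<close> applies twice, first
    to \<open>D * D\<close> and then to \<open>D\<close>.\<close>
  have "(D * D) * (D * D) = D * D * D * D" 
    using D by (intro assoc_mult_mat[symmetric, of _ n n _ n _ n]) auto
  then have "(D * D) * (D * D) = 0\<^sub>m n n" using D3 D by simp
  moreover have "mat_adjoint (D * D) = D * D" using mat_adjoint_mult[OF D D] D_adj by simp
  moreover have "D * D \<in> carrier_mat n n" using D by simp
  ultimately have "D * D = 0\<^sub>m n n" using hermitian_square_zero by blast
  then have "D = 0\<^sub>m n n" using D D_adj hermitian_square_zero by blast
  show ?thesis
  proof (rule eq_matI)
    fix i j assume ij: "i < dim_row C" "j < dim_col C"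
    then have "D $$ (i, j) = 0" using \<open>D = 0\<^sub>m n n\<close> C by auto
    then show "B $$ (i, j) = C $$ (i, j)" using ij by (simp add: D_def)
  qed (use B C in auto)
qed

text \<open>Orthogonality removes the cross terms, so \<open>X - Y\<close> and \<open>X + Y\<close>
  have the same square. As \<open>X + Y\<close> is positive, it is the absolute value of
  \<open>X - Y\<close>.\<close>

lemma trace_norm_orthogonal_diff:
  assumes "psd n X" "psd n Y" "X * Y = 0\<^sub>m n n" "Y * X = 0\<^sub>m n n"
  shows "trace_norm n (X - Y) = Re (mtrace X) + Re (mtrace Y)"
proof -
  have X: "X \<in> carrier_mat n n" and Y: "Y \<in> carrier_mat n n" using assms psd_carrier by auto
  have adj: "mat_adjoint (X - Y) = X - Y" using mat_adjoint_minus[OF X Y] psd_adjoint assms by simp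
  have XY: "X - Y \<in> carrier_mat n n" "X + Y \<in> carrier_mat n n" using X Y
    by (auto simp: minus_carrier_mat)
  have 1: "(X - Y) * (X - Y) = X * X + Y * Y"
  proof -
    have "X * (X - Y) = X * X - X * Y" "Y * (X - Y) = Y * X - Y * Y"
      using X Y by (auto intro: mult_minus_distrib_mat)
    then show ?thesis
      using X Y assms(3,4) minus_mult_distrib_mat[OF X Y, of "X - Y" n] XY by (auto intro!: eq_matI)
  qed
  have 2: "(X + Y) * (X + Y) = X * X + Y * Y"
  proof -
    have "X * (X + Y) = X * X + X * Y" "Y * (X + Y) = Y * X + Y * Y"
      using X Y by (auto intro: mult_add_distrib_mat)
    then show ?thesis
      using X Y assms(3,4) add_mult_distrib_mat[OF X Y, of "X + Y" n] by (auto intro!: eq_matI)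
  qed
  have "psd_sqrt n (mat_adjoint (X - Y) * (X - Y)) = X + Y"
    unfolding psd_sqrt_def adj
  proof (rule the_equality)
    show "psd n (X + Y) \<and> (X + Y) * (X + Y) = (X - Y) * (X - Y)" using assms psd_add 1 2 by simp
  next
    fix B assume "psd n B \<and> B * B = (X - Y) * (X - Y)"
    then show "B = X + Y" using psd_sqrt_unique[of n B "X + Y"] psd_add assms 1 2 by simp
  qed
  then show ?thesis by (simp add: trace_norm_def mtrace_add[OF X Y])
qed

text \<open>The content is uniqueness. Idempotents \<open>P\<close> and \<open>Q\<close> with the
  same kernel satisfy \<open>P * Q = P\<close> and \<open>Q * P = Q\<close>; when both are
  Hermitian, the adjoint of the first equation reads \<open>Q * P = P\<close>.\<close>

lemma support_proj_projector:
  assumes P: "P \<in> carrier_mat n n" "mat_adjoint P = P" "P * P = P"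
  shows "support_proj n P = P"
  unfolding support_proj_def
proof (rule the_equality)
  have *: "A * B = A" if A: "A \<in> carrier_mat n n" and B: "B \<in> carrier_mat n n" "B * B = B"
    and ker: "\<And>v. v \<in> carrier_vec n \<Longrightarrow> B *\<^sub>v v = 0\<^sub>v n \<Longrightarrow> A *\<^sub>v v = 0\<^sub>v n" for A B :: "complex mat"
  proof (rule eq_matI)
    fix i j assume "i < dim_row A" "j < dim_col A"
    then have ij: "i < n" "j < n" using A by auto
    \<comment> \<open>Column \<open>j\<close> of \<open>1 - B\<close>: idempotency puts it in the
      kernel of \<open>B\<close>, hence in that of \<open>A\<close>.\<close>
    define e where "e = unit_vec n j - B *\<^sub>v unit_vec n j"
    have Be: "B *\<^sub>v (B *\<^sub>v unit_vec n j) = B *\<^sub>v unit_vec n j"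
      using B by (metis assoc_mult_mat_vec unit_vec_carrier)
    have "B *\<^sub>v e = B *\<^sub>v unit_vec n j - B *\<^sub>v (B *\<^sub>v unit_vec n j)"
      unfolding e_def using B by (intro mult_minus_distrib_mat_vec[where nc = n and nr = n]) auto
    then have "B *\<^sub>v e = 0\<^sub>v n" using Be B by auto
    then have "A *\<^sub>v e = 0\<^sub>v n" using B ker by (simp add: e_def)
    moreover have "A *\<^sub>v e = A *\<^sub>v unit_vec n j - A *\<^sub>v (B *\<^sub>v unit_vec n j)"
      unfolding e_def using A B by (intro mult_minus_distrib_mat_vec[where nc = n and nr = n]) auto
    moreover have "A *\<^sub>v (B *\<^sub>v unit_vec n j) = (A * B) *\<^sub>v unit_vec n j"
      using A B by (metis assoc_mult_mat_vec unit_vec_carrier)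
    ultimately have "(A *\<^sub>v unit_vec n j - (A * B) *\<^sub>v unit_vec n j) $ i = 0\<^sub>v n $ i" by simp
    then have "(A *\<^sub>v unit_vec n j) $ i = ((A * B) *\<^sub>v unit_vec n j) $ i" using ij A B by auto
    moreover have "(M *\<^sub>v unit_vec n j) $ i = M $$ (i, j)" if "M \<in> carrier_mat n n"
        for M :: "complex mat"
      using that ij by simp
    ultimately show "(A * B) $$ (i, j) = A $$ (i, j)" using A B by (metis mult_carrier_mat)
  qed (use that in auto)
  fix Q assume Q: "Q \<in> carrier_mat n n \<and> mat_adjoint Q = Q \<and> Q * Q = Q \<and>
    (\<forall>v\<in>carrier_vec n. Q *\<^sub>v v = 0\<^sub>v n \<longleftrightarrow> P *\<^sub>v v = 0\<^sub>v n)"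
  have "P * Q = P" "Q * P = Q" using Q P by (auto intro!: *)
  then show "Q = P" using mat_adjoint_mult[of P n n Q n] Q P by auto
qed (use P in auto)

section \<open>Superoperators\<close>

lemma linear_superopI:
  assumes "\<And>X. X \<in> carrier_mat a a \<Longrightarrow> \<Phi> X \<in> carrier_mat b b"
    and "\<And>X Y. X \<in> carrier_mat a a \<Longrightarrow> Y \<in> carrier_mat a a \<Longrightarrow> \<Phi> (X + Y) = \<Phi> X + \<Phi> Y"
    and "\<And>c X. X \<in> carrier_mat a a \<Longrightarrow> \<Phi> (c \<cdot>\<^sub>m X) = c \<cdot>\<^sub>m \<Phi> X"
  shows "linear_superop a b \<Phi>"
  using assms by (simp add: linear_superop_def)

lemma linear_superop_carrier: "linear_superop a b \<Phi> \<Longrightarrow> X \<in> carrier_mat a a \<Longrightarrow> \<Phi> X \<in> carrier_mat b b"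
  by (simp add: linear_superop_def)

lemma linear_superop_add:
  "linear_superop a b \<Phi> \<Longrightarrow> X \<in> carrier_mat a a \<Longrightarrow> Y \<in> carrier_mat a a \<Longrightarrow> \<Phi> (X + Y) = \<Phi> X + \<Phi> Y"
  by (simp add: linear_superop_def)

lemma linear_superop_smult:
  "linear_superop a b \<Phi> \<Longrightarrow> X \<in> carrier_mat a a \<Longrightarrow> \<Phi> (c \<cdot>\<^sub>m X) = c \<cdot>\<^sub>m \<Phi> X"
  by (simp add: linear_superop_def)

lemma mat_unit_carrier [simp, intro]: "mat_unit n i j \<in> carrier_mat n n"
  by (simp add: mat_unit_def)

lemma mat_unit_dim [simp]: "dim_row (mat_unit n i j) = n" "dim_col (mat_unit n i j) = n"
  by (simp_all add: mat_unit_def)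

lemma mat_unit_index [simp]:
  "k < n \<Longrightarrow> l < n \<Longrightarrow> mat_unit n i j $$ (k, l) = (if k = i \<and> l = j then 1 else 0)"
  by (simp add: mat_unit_def)

lemma mat_sum_insert:
  assumes "finite I" "x \<notin> I" "F x \<in> carrier_mat n n"
  shows "mat_sum n (insert x I) F = F x + mat_sum n I F"
  using assms by (intro eq_matI) auto

lemma linear_superop_mat_sum:
  assumes \<Phi>: "linear_superop a b \<Phi>" and "finite I" "\<And>x. x \<in> I \<Longrightarrow> F x \<in> carrier_mat a a"
  shows "\<Phi> (mat_sum a I F) = mat_sum b I (\<lambda>x. \<Phi> (F x))"
  using assms(2,3)
proof (induction I rule: finite_induct)
  case empty
  \<comment> \<open>\<open>linear_superop\<close> has no clause for zero, so the empty sum is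
    written as a multiple by 0.\<close>
  have z: "mat_sum a {} F = 0 \<cdot>\<^sub>m 0\<^sub>m a a" by (rule eq_matI) auto
  have "\<Phi> (mat_sum a {} F) = 0 \<cdot>\<^sub>m \<Phi> (0\<^sub>m a a)"
    unfolding z by (rule linear_superop_smult[OF \<Phi>]) simp
  also have "\<dots> = mat_sum b {} (\<lambda>x. \<Phi> (F x))"
    using linear_superop_carrier[OF \<Phi>, of "0\<^sub>m a a"] by (intro eq_matI) auto
  finally show ?case .
next
  case (insert x I)
  have "\<Phi> (mat_sum a (insert x I) F) = \<Phi> (F x + mat_sum a I F)"
    using insert by (simp add: mat_sum_insert)
  also have "\<dots> = \<Phi> (F x) + \<Phi> (mat_sum a I F)"
    using insert by (intro linear_superop_add[OF \<Phi>]) auto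
  also have "\<dots> = mat_sum b (insert x I) (\<lambda>x. \<Phi> (F x))"
    using insert linear_superop_carrier[OF \<Phi>] by (simp add: mat_sum_insert)
  finally show ?case .
qed

lemma mat_unit_expansion:
  assumes "X \<in> carrier_mat a a"
  shows "X = mat_sum a ({..<a} \<times> {..<a}) (\<lambda>(i, j). X $$ (i, j) \<cdot>\<^sub>m mat_unit a i j)" (is "_ = ?R")
proof (rule eq_mat_carrierI[of _ a a])
  fix k l assume kl: "k < a" "l < a"
  then have "?R $$ (k, l)
      = (\<Sum>p\<in>{..<a} \<times> {..<a}. if p = (k, l) then X $$ (k, l) else 0)"
    by (simp only: mat_sum_index) (intro sum.cong refl, auto split: if_splits)
  also have "\<dots> = X $$ (k, l)" using kl by simp
  finally show "X $$ (k, l) = ?R $$ (k, l)" by simp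
qed (use assms in auto)

lemma linear_superop_expansion:
  assumes "linear_superop a b \<Phi>" "X \<in> carrier_mat a a"
  shows "\<Phi> X = mat_sum b ({..<a} \<times> {..<a}) (\<lambda>(i, j). X $$ (i, j) \<cdot>\<^sub>m \<Phi> (mat_unit a i j))"
      (is "_ = ?R")
proof -
  have "\<Phi> X = \<Phi> (mat_sum a ({..<a} \<times> {..<a}) (\<lambda>(i, j). X $$ (i, j) \<cdot>\<^sub>m mat_unit a i j))"
    using mat_unit_expansion[OF assms(2)] by simp
  also have "\<dots> = mat_sum b ({..<a} \<times> {..<a}) (\<lambda>p. \<Phi> ((\<lambda>(i, j). X $$ (i, j) \<cdot>\<^sub>m mat_unit a i j) p))"
    by (rule linear_superop_mat_sum[OF assms(1)]) auto
  also have "\<dots> = ?R"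
    by (rule mat_sum_cong) (auto simp: linear_superop_smult[OF assms(1)])
  finally show ?thesis .
qed

lemma linear_superop_index:
  assumes "linear_superop a b \<Phi>" "X \<in> carrier_mat a a" "k < b" "l < b"
  shows "\<Phi> X $$ (k, l) = (\<Sum>i<a. \<Sum>j<a. X $$ (i, j) * \<Phi> (mat_unit a i j) $$ (k, l))"
proof -
  have "\<Phi> X $$ (k, l) = (\<Sum>(i, j)\<in>{..<a} \<times> {..<a}. (X $$ (i, j) \<cdot>\<^sub>m \<Phi> (mat_unit a i j)) $$ (k, l))"
    using assms(3,4) by (subst linear_superop_expansion[OF assms(1,2)]) (simp add: case_prod_beta)
  also have "\<dots> = (\<Sum>(i, j)\<in>{..<a} \<times> {..<a}. X $$ (i, j) * \<Phi> (mat_unit a i j) $$ (k, l))"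
    using assms(3,4) carrier_matD[OF linear_superop_carrier[OF assms(1) mat_unit_carrier]]
    by (intro sum.cong refl) auto
  finally show ?thesis by (simp add: sum.cartesian_product)
qed

lemma linear_superop_id: "linear_superop a a id"
  by (rule linear_superopI) auto

lemma linear_superop_comp:
  "linear_superop b c \<Psi> \<Longrightarrow> linear_superop a b \<Phi> \<Longrightarrow> linear_superop a c (\<lambda>X. \<Psi> (\<Phi> X))"
  by (simp add: linear_superop_def)

lemma linear_superop_conj_by: "B \<in> carrier_mat b a \<Longrightarrow> linear_superop a b (conj_by B)"
  by (rule linear_superopI) (auto simp: conj_by_add conj_by_smult)

lemma linear_superop_sum:
  assumes "\<And>x. x \<in> I \<Longrightarrow> linear_superop a b (F x)"
  shows "linear_superop a b (\<lambda>X. mat_sum b I (\<lambda>x. F x X))"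
proof (rule linear_superopI)
  fix X Y :: "complex mat" assume "X \<in> carrier_mat a a" "Y \<in> carrier_mat a a"
  then show "mat_sum b I (\<lambda>x. F x (X + Y)) = mat_sum b I (\<lambda>x. F x X) + mat_sum b I (\<lambda>x. F x Y)"
    using assms linear_superop_add[OF assms] linear_superop_carrier[OF assms]
    by (simp add: mat_sum_add[symmetric])
next
  fix c and X :: "complex mat" assume "X \<in> carrier_mat a a"
  then show "mat_sum b I (\<lambda>x. F x (c \<cdot>\<^sub>m X)) = c \<cdot>\<^sub>m mat_sum b I (\<lambda>x. F x X)"
    using assms linear_superop_smult[OF assms] linear_superop_carrier[OF assms]
    by (simp add: smult_mat_sum)
qed auto

lemma linear_superop_scale:
  assumes "linear_superop a b \<Phi>"
  shows "linear_superop a b (\<lambda>X. c \<cdot>\<^sub>m \<Phi> X)"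
proof (rule linear_superopI)
  fix X Y :: "complex mat" assume X: "X \<in> carrier_mat a a" "Y \<in> carrier_mat a a"
  show "c \<cdot>\<^sub>m \<Phi> (X + Y) = c \<cdot>\<^sub>m \<Phi> X + c \<cdot>\<^sub>m \<Phi> Y"
    using X linear_superop_carrier[OF assms] linear_superop_add[OF assms]
    by (simp add: add_smult_distrib_left_mat[of _ b b])
next
  fix d and X :: "complex mat" assume X: "X \<in> carrier_mat a a"
  show "c \<cdot>\<^sub>m \<Phi> (d \<cdot>\<^sub>m X) = d \<cdot>\<^sub>m (c \<cdot>\<^sub>m \<Phi> X)"
    using X by (auto simp: linear_superop_smult[OF assms] intro!: eq_matI)
qed (use linear_superop_carrier[OF assms] in auto)

lemma linear_superop_plus:
  assumes "linear_superop a b \<Phi>" "linear_superop a b \<Psi>"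
  shows "linear_superop a b (\<lambda>X. \<Phi> X + \<Psi> X)"
proof (rule linear_superopI)
  fix X Y :: "complex mat" assume X: "X \<in> carrier_mat a a" "Y \<in> carrier_mat a a"
  note c = X[THEN linear_superop_carrier[OF assms(1)]] X[THEN linear_superop_carrier[OF assms(2)]]
  show "\<Phi> (X + Y) + \<Psi> (X + Y) = \<Phi> X + \<Psi> X + (\<Phi> Y + \<Psi> Y)"
    using c by (simp add: linear_superop_add[OF assms(1) X] linear_superop_add[OF assms(2) X])
      (auto intro!: eq_matI)
next
  fix d and X :: "complex mat" assume X: "X \<in> carrier_mat a a"
  show "\<Phi> (d \<cdot>\<^sub>m X) + \<Psi> (d \<cdot>\<^sub>m X) = d \<cdot>\<^sub>m (\<Phi> X + \<Psi> X)"
    using X linear_superop_carrier[OF assms(1) X] linear_superop_carrier[OF assms(2) X]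
    by (simp add: linear_superop_smult[OF assms(1) X] linear_superop_smult[OF assms(2) X]
      add_smult_distrib_left_mat[of _ b b])
qed (use linear_superop_carrier[OF assms(1)] linear_superop_carrier[OF assms(2)] in auto)

lemma linear_superop_cong:
  assumes "\<And>X. X \<in> carrier_mat a a \<Longrightarrow> \<Phi> X = \<Psi> X" "linear_superop a b \<Psi>"
  shows "linear_superop a b \<Phi>"
  using assms by (simp add: linear_superop_def)

section \<open>Tensor products of superoperators\<close>

lemma tensor_superop_carrier [simp, intro]:
  "tensor_superop a a' b b' \<Phi> \<Psi> X \<in> carrier_mat (a' * b') (a' * b')"
  by (simp add: tensor_superop_def)

lemma tensor_superop_index:
  assumes "linear_superop a a' \<Phi>" "linear_superop b b' \<Psi>" "u < a'" "v < a'" "x < b'" "y < b'"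
  shows "tensor_superop a a' b b' \<Phi> \<Psi> X $$ (u * b' + x, v * b' + y) =
    (\<Sum>i<a. \<Sum>j<a. \<Sum>k<b. \<Sum>l<b. X $$ (i * b + k, j * b + l) *
      (\<Phi> (mat_unit a i j) $$ (u, v) * \<Psi> (mat_unit b k l) $$ (x, y)))" (is "?L = ?R")
proof -
  have c: "\<Phi> (mat_unit a i j) \<in> carrier_mat a' a'" "\<Psi> (mat_unit b k l) \<in> carrier_mat b' b'"
      for i j k l
    using assms linear_superop_carrier by auto
  have "?L =
    (\<Sum>p\<in>({..<a} \<times> {..<a}) \<times> ({..<b} \<times> {..<b}). case p of ((i, j), (k, l)) \<Rightarrow>
      X $$ (i * b + k, j * b + l) * (\<Phi> (mat_unit a i j) $$ (u, v) * \<Psi> (mat_unit b k l) $$ (x, y)))"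
    unfolding tensor_superop_def
  proof (subst mat_sum_index, goal_cases)
    case 3
    show ?case
    proof (intro sum.cong refl, goal_cases)
      case (1 p)
      obtain i j k l where p: "p = ((i, j), (k, l))" by (metis prod.exhaust)
      have "(\<Phi> (mat_unit a i j) \<otimes>\<^sub>k \<Psi> (mat_unit b k l)) $$ (u * b' + x, v * b' + y)
          = \<Phi> (mat_unit a i j) $$ (u, v) * \<Psi> (mat_unit b k l) $$ (x, y)"
        using c assms by (intro kron_index_pair) auto
      moreover have "dim_row (\<Phi> (mat_unit a i j)) * dim_row (\<Psi> (mat_unit b k l)) = a' * b'"
        "dim_col (\<Phi> (mat_unit a i j)) * dim_col (\<Psi> (mat_unit b k l)) = a' * b'"
        using carrier_matD[OF c(1)] carrier_matD[OF c(2)] by auto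
      ultimately show ?case using assms by (simp add: p pair_index_less)
    qed
  qed (use assms in \<open>simp_all add: pair_index_less\<close>)
  also have "\<dots> = ?R"
    by (simp add: sum.cartesian_product')
  finally show ?thesis .
qed

lemma linear_superop_tensor:
  assumes "linear_superop a a' \<Phi>" "linear_superop b b' \<Psi>"
  shows "linear_superop (a * b) (a' * b') (tensor_superop a a' b b' \<Phi> \<Psi>)"
proof (rule linear_superopI)
  fix X Y :: "complex mat" assume XY: "X \<in> carrier_mat (a * b) (a * b)" "Y
      \<in> carrier_mat (a * b) (a * b)"
  show "tensor_superop a a' b b' \<Phi> \<Psi> (X + Y) = tensor_superop a a' b b' \<Phi> \<Psi> X
      + tensor_superop a a' b b' \<Phi> \<Psi> Y"
  proof (rule eq_mat_pairI[of _ a' b' a' b'])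
    fix u x v y assume i: "u < a'" "x < b'" "v < a'" "y < b'"
    show "tensor_superop a a' b b' \<Phi> \<Psi> (X + Y) $$ (u * b' + x, v * b' + y)
      = (tensor_superop a a' b b' \<Phi> \<Psi> X + tensor_superop a a' b b' \<Phi> \<Psi> Y) $$ (u * b' + x, v * b'
          + y)"
      using XY i carrier_matD[OF tensor_superop_carrier, of a a' b b' \<Phi> \<Psi>]
      by (simp add: tensor_superop_index[OF assms] pair_index_less ring_distribs sum.distrib)
  qed auto
next
  fix c and X :: "complex mat" assume X: "X \<in> carrier_mat (a * b) (a * b)"
  show "tensor_superop a a' b b' \<Phi> \<Psi> (c \<cdot>\<^sub>m X) = c \<cdot>\<^sub>m tensor_superop a a' b b' \<Phi> \<Psi> X"
  proof (rule eq_mat_pairI[of _ a' b' a' b'])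
    fix u x v y assume i: "u < a'" "x < b'" "v < a'" "y < b'"
    show "tensor_superop a a' b b' \<Phi> \<Psi> (c \<cdot>\<^sub>m X) $$ (u * b' + x, v * b' + y)
      = (c \<cdot>\<^sub>m tensor_superop a a' b b' \<Phi> \<Psi> X) $$ (u * b' + x, v * b' + y)"
      using X i carrier_matD[OF tensor_superop_carrier, of a a' b b' \<Phi> \<Psi>]
      by (simp add: tensor_superop_index[OF assms] pair_index_less sum_distrib_left mult.assoc)
  qed auto
qed auto

text \<open>The characteristic property of the tensor product, recovered from its definition by
  matrix units: on a product operator the fourfold sum factors into the expansions of \<Phi> and
  \<Psi>.\<close>

lemma tensor_superop_kron:
  assumes "linear_superop a a' \<Phi>" "linear_superop b b' \<Psi>" "A \<in> carrier_mat a a" "B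
      \<in> carrier_mat b b"
  shows "tensor_superop a a' b b' \<Phi> \<Psi> (A \<otimes>\<^sub>k B) = \<Phi> A \<otimes>\<^sub>k \<Psi> B" (is "?L = ?R")
proof (rule eq_mat_pairI[of _ a' b' a' b'])
  show "?R \<in> carrier_mat (a' * b') (a' * b')"
    using assms linear_superop_carrier by (intro kron_carrier) auto
  fix u x v y assume i: "u < a'" "x < b'" "v < a'" "y < b'"
  have "?L $$ (u * b' + x, v * b' + y) =
    (\<Sum>i<a. \<Sum>j<a. \<Sum>k<b. \<Sum>l<b. (A $$ (i, j) * \<Phi> (mat_unit a i j) $$ (u, v)) *
      (B $$ (k, l) * \<Psi> (mat_unit b k l) $$ (x, y)))"
    unfolding tensor_superop_index[OF assms(1,2) i(1,3,2,4)]
    using assms(3,4) by (intro sum.cong refl) (simp add: kron_index_pair)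
  also have "\<dots> = (\<Sum>i<a. \<Sum>j<a. A $$ (i, j) * \<Phi> (mat_unit a i j) $$ (u, v)) *
     (\<Sum>k<b. \<Sum>l<b. B $$ (k, l) * \<Psi> (mat_unit b k l) $$ (x, y))"
    unfolding sum_distrib_right unfolding sum_distrib_left ..
  also have "\<dots> = \<Phi> A $$ (u, v) * \<Psi> B $$ (x, y)"
    by (simp only: linear_superop_index[OF assms(1,3) i(1,3)]
        linear_superop_index[OF assms(2,4) i(2,4)])
  also have "\<dots> = ?R $$ (u * b' + x, v * b' + y)"
    using assms linear_superop_carrier i by (intro kron_index_pair[symmetric]) auto
  finally show "?L $$ (u * b' + x, v * b' + y)
     = ?R $$ (u * b' + x, v * b' + y)" .
qed auto

lemma mat_unit_kron:
  assumes "p < a * b" "q < a * b"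
  shows "mat_unit (a * b) p q = mat_unit a (p div b) (q div b) \<otimes>\<^sub>k mat_unit b (p mod b) (q mod b)"
      (is "_ = ?R")
proof (rule eq_mat_carrierI[of _ "a * b" "a * b"])
  fix i j assume ij: "i < a * b" "j < a * b"
  have *: "i = p \<longleftrightarrow> i div b = p div b \<and> i mod b = p mod b" for i p
    by (metis div_mult_mod_eq)
  show "mat_unit (a * b) p q $$ (i, j) =
    ?R $$ (i, j)"
    using ij by (simp add: kron_index div_mod_less *[of i p] *[of j q])
qed auto

text \<open>Matrix units of a composite register are products of matrix units, so linear maps that
  agree on those agree also on entangled operators.\<close>

lemma linear_superop_eq_kronI:
  assumes "linear_superop (a * b) c \<Phi>" "linear_superop (a * b) c \<Psi>"
    and "\<And>i j k l. \<Phi> (mat_unit a i j \<otimes>\<^sub>k mat_unit b k l) = \<Psi> (mat_unit a i j \<otimes>\<^sub>k mat_unit b k l)"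
    and "X \<in> carrier_mat (a * b) (a * b)"
  shows "\<Phi> X = \<Psi> X"
  unfolding linear_superop_expansion[OF assms(1,4)] linear_superop_expansion[OF assms(2,4)]
  using assms(3) by (intro mat_sum_cong) (auto simp: mat_unit_kron)

text \<open>No linearity is required of the two maps. This lets the difference of the real and the
  ideal map be exchanged for a Kraus expression that was verified on product operators only.\<close>

lemma tensor_superop_cong_right:
  assumes "\<And>k l. k < b \<Longrightarrow> l < b \<Longrightarrow> \<Psi> (mat_unit b k l) = \<Psi>' (mat_unit b k l)"
  shows "tensor_superop a a' b b' \<Phi> \<Psi> X = tensor_superop a a' b b' \<Phi> \<Psi>' X"
  unfolding tensor_superop_def by (intro mat_sum_cong) (auto simp: assms)

text \<open>The weights keep probabilities out of the Kraus operators.\<close>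

definition kraus :: "nat \<Rightarrow> 'i set \<Rightarrow> ('i \<Rightarrow> complex) \<Rightarrow> ('i \<Rightarrow> complex mat) \<Rightarrow> complex mat \<Rightarrow> complex mat"
    where
  "kraus b I w G X = mat_sum b I (\<lambda>x. w x \<cdot>\<^sub>m conj_by (G x) X)"

lemma linear_superop_kraus:
  assumes "\<And>x. x \<in> I \<Longrightarrow> G x \<in> carrier_mat b a"
  shows "linear_superop a b (kraus b I w G)"
  unfolding kraus_def
  using assms by (intro linear_superop_sum linear_superop_scale linear_superop_conj_by)

text \<open>Both sides are linear, and on products of matrix units this is multiplicativity of
  conjugation, \<open>conj_by_kron\<close>.\<close>

lemma tensor_superop_kraus:
  assumes "\<And>x. x \<in> I \<Longrightarrow> G x \<in> carrier_mat b' b" "finite I" "H \<in> carrier_mat c' c"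
    "X \<in> carrier_mat (c * b) (c * b)"
  shows "tensor_superop c c' b b' (conj_by H) (kraus b' I w G) X
      = kraus (c' * b') I w (\<lambda>x. H \<otimes>\<^sub>k G x) X"
proof (rule linear_superop_eq_kronI[OF linear_superop_tensor linear_superop_kraus])
  note lin = linear_superop_kraus[OF assms(1)] linear_superop_conj_by[OF assms(3)]
  fix i j k l
  have "tensor_superop c c' b b' (conj_by H) (kraus b' I w G) (mat_unit c i j \<otimes>\<^sub>k mat_unit b k l)
     = conj_by H (mat_unit c i j) \<otimes>\<^sub>k kraus b' I w G (mat_unit b k l)"
    using lin by (intro tensor_superop_kron) auto
  also have "\<dots> = kraus (c' * b') I w (\<lambda>x. H \<otimes>\<^sub>k G x) (mat_unit c i j \<otimes>\<^sub>k mat_unit b k l)"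
    unfolding kraus_def
  proof (subst kron_mat_sum[of _ c'])
    show "mat_sum (c' * b') I (\<lambda>x. conj_by H (mat_unit c i j)
        \<otimes>\<^sub>k (w x \<cdot>\<^sub>m conj_by (G x) (mat_unit b k l)))
      = mat_sum (c' * b') I (\<lambda>x. w x \<cdot>\<^sub>m conj_by (H \<otimes>\<^sub>k G x) (mat_unit c i j \<otimes>\<^sub>k mat_unit b k l))"
      using assms by (intro mat_sum_cong refl)
          (simp add: kron_smult_right conj_by_kron[of _ c' c _ b' b])
    show "w x \<cdot>\<^sub>m conj_by (G x) (mat_unit b k l) \<in> carrier_mat b' b'" if "x \<in> I" for x
      using conj_by_carrier[OF assms(1)[OF that] mat_unit_carrier] by simp
  qed (use assms in auto)
  finally show "tensor_superop c c' b b' (conj_by H) (kraus b' I w G)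
      (mat_unit c i j \<otimes>\<^sub>k mat_unit b k l)
     = kraus (c' * b') I w (\<lambda>x. H \<otimes>\<^sub>k G x) (mat_unit c i j \<otimes>\<^sub>k mat_unit b k l)" .
qed (use assms linear_superop_kraus[OF assms(1)] linear_superop_conj_by[OF assms(3)] in auto)

text \<open>\<open>id\<close> and \<open>conj_by (1\<^sub>m c)\<close> differ as functions, but they
  agree on the matrix units that \<open>tensor_superop\<close> evaluates.\<close>

lemma tensor_superop_id_eq:
  "tensor_superop c c b b' id \<Psi> X = tensor_superop c c b b' (conj_by (1\<^sub>m c)) \<Psi> X"
  unfolding tensor_superop_def by (intro mat_sum_cong) (auto simp: conj_by_one)

lemma tensor_superop_id_kraus:
  assumes "\<And>x. x \<in> I \<Longrightarrow> G x \<in> carrier_mat b' b" "finite I" "X \<in> carrier_mat (c * b) (c * b)"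
  shows "tensor_superop c c b b' id (kraus b' I w G) X = kraus (c * b') I w (\<lambda>x. 1\<^sub>m c \<otimes>\<^sub>k G x) X"
  using assms by (simp add: tensor_superop_id_eq tensor_superop_kraus)

section \<open>Complete positivity and Choi's theorem\<close>

lemma psd_kraus:
  assumes "psd a X" "\<And>x. x \<in> I \<Longrightarrow> G x \<in> carrier_mat b a" "\<And>x. x \<in> I \<Longrightarrow> 0 \<le> w x"
  shows "psd b (kraus b I w G X)"
  unfolding kraus_def using assms by (intro psd_mat_sum psd_smult psd_conj_by)

lemma cp_map_kraus:
  assumes "\<And>x. x \<in> I \<Longrightarrow> G x \<in> carrier_mat b a" "finite I" "\<And>x. x \<in> I \<Longrightarrow> 0 \<le> w x"
  shows "cp_map a b (kraus b I w G)"
  unfolding cp_map_def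
proof (intro conjI allI impI)
  fix c X assume X: "psd (c * a) X"
  show "psd (c * b) (tensor_superop c c a b id (kraus b I w G) X)"
  proof -
    have "tensor_superop c c a b id (kraus b I w G) X = kraus (c * b) I w (\<lambda>x. 1\<^sub>m c \<otimes>\<^sub>k G x) X"
      using assms psd_carrier[OF X] by (intro tensor_superop_id_kraus)
    then show ?thesis using assms by (auto intro!: psd_kraus[OF X])
  qed
qed (rule linear_superop_kraus[OF assms(1)])

lemma tensor_superop_id_index:
  assumes "linear_superop a b \<Psi>" "u < c" "v < c" "x < b" "y < b"
  shows "tensor_superop c c a b id \<Psi> X $$ (u * b + x, v * b + y) =
    (\<Sum>k<a. \<Sum>l<a. X $$ (u * a + k, v * a + l) * \<Psi> (mat_unit a k l) $$ (x, y))" (is "?L = ?R")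
proof -
  have "?L =
    (\<Sum>i<c. \<Sum>j<c. if j = v then if i = u then
       ?R else 0 else 0)"
    unfolding tensor_superop_index[OF linear_superop_id assms]
    using assms by (intro sum.cong refl) (auto intro!: sum.neutral)
  then show ?thesis using assms by simp
qed

text \<open>Choi's argument: the map applied to half of a maximally entangled state gives a positive
  matrix whose blocks are the images of the matrix units. Each rank-one term of that matrix,
  reshaped, is a Kraus operator.\<close>

theorem cp_map_has_kraus:
  assumes "cp_map a b \<Phi>"
  shows "\<exists>(p::nat) G. (\<forall>s<p. G s \<in> carrier_mat b a) \<and>
    (\<forall>X\<in>carrier_mat a a. \<Phi> X = kraus b {..<p} (\<lambda>_. 1) G X)"
proof -
  have lin: "linear_superop a b \<Phi>" using assms by (simp add: cp_map_def)
  \<comment> \<open>The unnormalised maximally entangled vector; block (k, l) of its projector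
    \<Omega> is \<open>mat_unit a k l\<close>.\<close>
  define w where "w p = (if p div a = p mod a then 1 else 0 :: complex)" for p
  define \<Omega> where "\<Omega> = mat (a * a) (a * a) (\<lambda>(i, j). w i * cnj (w j))"
  have "psd (a * b) (tensor_superop a a a b id \<Phi> \<Omega>)"
    using assms psd_outer by (auto simp: cp_map_def \<Omega>_def)
  then obtain p :: nat and v where v: "\<forall>i<a*b. \<forall>j<a*b. tensor_superop a a a b id \<Phi> \<Omega> $$ (i, j)
      = (\<Sum>s<p. v s i * cnj (v s j))"
    using psd_outer_decomposition[of "a * b"] by (metis (no_types))
  \<comment> \<open>Reshaping: the input index \<open>k\<close> is the leading digit of the Choi
    index and becomes the column, the output index \<open>i\<close> becomes the row.\<close>
  define G where "G s = mat b a (\<lambda>(i, k). v s (k * b + i))" for s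
  have G: "G s \<in> carrier_mat b a" for s by (simp add: G_def)
  have unit: "\<Phi> (mat_unit a k l) $$ (x, y) = (\<Sum>s<p. G s $$ (x, k) * cnj (G s $$ (y, l)))"
    if i: "k < a" "l < a" "x < b" "y < b" for k l x y
  proof -
    have "(\<Sum>s<p. v s (k * b + x) * cnj (v s (l * b + y)))
        = tensor_superop a a a b id \<Phi> \<Omega> $$ (k * b + x, l * b + y)"
      using v i by (simp add: pair_index_less)
    also have "\<dots> = (\<Sum>i<a. \<Sum>j<a. \<Omega> $$ (k * a + i, l * a + j) * \<Phi> (mat_unit a i j) $$ (x, y))"
      by (rule tensor_superop_id_index[OF lin i])
    also have "\<dots> = (\<Sum>i<a. \<Sum>j<a. if j = l then if i
        = k then \<Phi> (mat_unit a k l) $$ (x, y) else 0 else 0)"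
      using i by (intro sum.cong refl) (auto simp: \<Omega>_def w_def pair_index_less)
    also have "\<dots> = \<Phi> (mat_unit a k l) $$ (x, y)" using i by simp
    finally show ?thesis using i by (simp add: G_def)
  qed
  have "\<Phi> X = kraus b {..<p} (\<lambda>_. 1) G X" if X: "X \<in> carrier_mat a a" for X
  proof (rule eq_matI)
    fix x y assume "x < dim_row (kraus b {..<p} (\<lambda>_. 1) G X)" "y < dim_col
        (kraus b {..<p} (\<lambda>_. 1) G X)"
    then have xy: "x < b" "y < b" by (auto simp: kraus_def)
    have "\<Phi> X $$ (x, y) = (\<Sum>k<a. \<Sum>l<a. \<Sum>s<p. G s $$ (x, k) * X $$ (k, l) * cnj (G s $$ (y, l)))"
      using xy unit by (simp add: linear_superop_index[OF lin X] sum_distrib_left mult_ac)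
    also have "\<dots> = (\<Sum>s<p. conj_by (G s) X $$ (x, y))"
      using xy by (simp add: conj_by_index[OF G X] sum.swap[of _ "{..<p}"])
    also have "\<dots> = kraus b {..<p} (\<lambda>_. 1) G X $$ (x, y)"
      using xy carrier_matD[OF G] by (simp add: kraus_def)
    finally show "\<Phi> X $$ (x, y) = kraus b {..<p} (\<lambda>_. 1) G X $$ (x, y)" .
  qed (use linear_superop_carrier[OF lin X] in \<open>auto simp: kraus_def\<close>)
  then show ?thesis using G by blast
qed

text \<open>Testing trace preservation on \<open>mat_unit a k l\<close> reads off one entry of the
  summed Gram matrices, which therefore form the identity.\<close>

lemma trace_preserving_kraus:
  assumes "\<And>x. x \<in> I \<Longrightarrow> G x \<in> carrier_mat b a" "finite I"
    and "\<And>X. X \<in> carrier_mat a a \<Longrightarrow> mtrace (kraus b I (\<lambda>_. 1) G X) = mtrace X"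
    and "k < a" "l < a"
  shows "(\<Sum>x\<in>I. \<Sum>i<b. cnj (G x $$ (i, l)) * G x $$ (i, k)) = (if k = l then 1 else 0)" (is "?L = _")
proof -
  have "mtrace (kraus b I (\<lambda>_. 1) G (mat_unit a k l)) = ?L"
    unfolding kraus_def mtrace_mat_sum
  proof (intro sum.cong refl)
    fix x i assume "x \<in> I" "i \<in> {..<b}"
    then have x: "G x \<in> carrier_mat b a" "i < b" using assms by auto
    have "conj_by (G x) (mat_unit a k l) $$ (i, i)
      = (\<Sum>k'<a. \<Sum>l'<a. if l' = l then if k' = k then cnj (G x $$ (i, l))
          * G x $$ (i, k) else 0 else 0)"
      unfolding conj_by_index[OF x(1) mat_unit_carrier x(2) x(2)]
      by (intro sum.cong refl) auto
    then show "(1 \<cdot>\<^sub>m conj_by (G x) (mat_unit a k l)) $$ (i, i) = cnj (G x $$ (i, l))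
        * G x $$ (i, k)"
      using x assms(4,5) by simp
  qed
  then show ?thesis
  proof -
    have "mtrace (mat_unit a k l) = (\<Sum>i<a. if i = k then if k = l then 1 else 0 else 0)"
      unfolding mtrace_def by (intro sum.cong) auto
    then show ?thesis using assms(3)[OF mat_unit_carrier, of k l] assms(4) \<open>mtrace (kraus _ _ _ _ _)
        = _\<close> by simp
  qed
qed

section \<open>Paulis\<close>

lemma kron_one_left: "1\<^sub>m 1 \<otimes>\<^sub>k A = A"
  by (rule eq_matI) (auto simp: kron_index)

lemma sum_lessThan_2: "(\<Sum>k<2. f k) = f 0 + f (Suc 0)"
  by (simp add: numeral_2_eq_2)

lemma eq_mat_2I:
  assumes "A \<in> carrier_mat 2 2" "B \<in> carrier_mat 2 2"
    and "A $$ (0, 0) = B $$ (0, 0)" "A $$ (0, 1) = B $$ (0, 1)"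
    and "A $$ (1, 0) = B $$ (1, 0)" "A $$ (1, 1) = B $$ (1, 1)"
  shows "A = B"
  using assms by (intro eq_matI) (auto simp: less_2_cases_iff)

lemma pauli1_carrier [simp, intro]: "pauli1 x z \<in> carrier_mat 2 2"
  by (auto simp: pauli1_def pauli_X_def pauli_Z_def mat_of_rows_list_def)

lemma pauli1_dim [simp]: "dim_row (pauli1 x z) = 2" "dim_col (pauli1 x z) = 2"
  using pauli1_carrier[of x z] by blast+

text \<open>In \<open>X * Z\<close> the phase flip acts first, so its sign is attached to the column
  index.\<close>

lemma pauli1_index:
  assumes "i < 2" "j < 2"
  shows "pauli1 x z $$ (i, j) = (if (i = j) \<noteq> x then if z \<and> j = 1 then -1 else 1 else 0)"
proof -
  have "i = 0 \<or> i = 1" "j = 0 \<or> j = 1" using assms by auto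
  moreover have XZ: "pauli_X \<in> carrier_mat 2 2" "pauli_Z \<in> carrier_mat 2 2"
    and ent: "pauli_X $$ (0, 0) = 0" "pauli_X $$ (0, Suc 0) = 1" "pauli_X $$ (Suc 0, 0)
        = 1" "pauli_X $$ (Suc 0, Suc 0) = 0"
      "pauli_Z $$ (0, 0) = 1" "pauli_Z $$ (0, Suc 0) = 0" "pauli_Z $$ (Suc 0, 0)
          = 0" "pauli_Z $$ (Suc 0, Suc 0) = -1"
    by (simp_all add: pauli_X_def pauli_Z_def mat_of_rows_list_def numeral_2_eq_2)
  moreover have "dim_row pauli_X = 2" "dim_row pauli_Z = 2" "dim_col pauli_X = 2" "dim_col pauli_Z
      = 2"
    using XZ by auto
  ultimately show ?thesis
    by (elim disjE; cases x; cases z; simp add: pauli1_def mult_mat_index[OF XZ] sum_lessThan_2)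
qed

text \<open>A Pauli index lists all bit flips before all phase flips and so does not split along
  qubits. One pair per qubit does, which makes induction on the list available.\<close>

type_synonym pauli_string = "(bool \<times> bool) list"

definition pauli_words :: "nat \<Rightarrow> pauli_string set" where
  "pauli_words n = {ps. length ps = n}"

fun pauli_word :: "pauli_string \<Rightarrow> complex mat" where
  "pauli_word [] = 1\<^sub>m 1"
| "pauli_word ((x, z) # ps) = pauli1 x z \<otimes>\<^sub>k pauli_word ps"

lemma pauli_eq_word: "pauli n l = pauli_word (zip (take n l) (drop n l))"
proof -
  have "pauli_word ps = foldr (\<lambda>(x, z) B. pauli1 x z \<otimes>\<^sub>k B) ps (1\<^sub>m 1)" for ps
    by (induction ps rule: pauli_word.induct) auto
  then show ?thesis by (simp add: pauli_def)
qed

lemma bij_betw_pauli_words: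
  "bij_betw (\<lambda>l. zip (take n l) (drop n l)) (pauli_index n) (pauli_words n)"
  by (rule bij_betw_byWitness[where f' = "\<lambda>ps. map fst ps @ map snd ps"])
    (auto simp: pauli_index_def pauli_words_def zip_map_fst_snd)

lemma paulis_eq: "paulis n = pauli_word ` pauli_words n"
proof -
  have "paulis n = pauli_word ` (\<lambda>l. zip (take n l) (drop n l)) ` pauli_index n"
    by (simp add: paulis_def image_image pauli_eq_word)
  then show ?thesis using bij_betw_pauli_words[of n] by (simp add: bij_betw_def)
qed

lemma pauli_word_IZ:
  assumes "ps \<in> pauli_words t" "\<forall>(x, z)\<in>set ps. \<not> x"
  shows "pauli_word ps \<in> IZ_paulis t"
proof -
  let ?l = "map fst ps @ map snd ps"
  have "pauli t ?l = pauli_word ps"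
    using assms(1) by (simp add: pauli_eq_word pauli_words_def zip_map_fst_snd)
  moreover have "?l \<in> {l \<in> pauli_index t. \<forall>i<t. \<not> l ! i}"
  proof -
    have "\<not> fst (ps ! i)" if "i < t" for i
    proof -
      have "ps ! i \<in> set ps" using assms(1) that by (simp add: pauli_words_def)
      then show ?thesis using bspec[OF assms(2), of "ps ! i"] by (simp add: case_prod_beta)
    qed
    then show ?thesis using assms(1) by (simp add: pauli_index_def pauli_words_def nth_append)
  qed
  ultimately show ?thesis unfolding IZ_paulis_def by (intro image_eqI[of _ _ ?l]) simp_all
qed

lemma pauli_words_0 [simp]: "pauli_words 0 = {[]}"
  by (auto simp: pauli_words_def)

lemma pauli_words_Suc: "pauli_words (Suc n) = (\<lambda>(p, ps). p # ps) ` (UNIV \<times> pauli_words n)"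
  by (auto simp: pauli_words_def length_Suc_conv)

lemma finite_pauli_words [simp]: "finite (pauli_words n)"
  by (induction n) (auto simp: pauli_words_Suc)

lemma sum_pauli_words_Suc:
  "(\<Sum>ps\<in>pauli_words (Suc n). f ps) = (\<Sum>p\<in>UNIV. \<Sum>ps\<in>pauli_words n. f (p # ps))"
  unfolding pauli_words_Suc
  by (subst sum.reindex) (auto simp: inj_on_def sum.cartesian_product case_prod_beta)

lemma pauli_words_nonempty: "pauli_words n \<noteq> {}"
  unfolding pauli_words_def using Ex_list_of_length[of n] by auto

lemma pauli_word_append: "pauli_word (ps @ qs) = pauli_word ps \<otimes>\<^sub>k pauli_word qs"
  by (induction ps rule: pauli_word.induct) (auto simp: kron_one_left[simplified] kron_assoc)

lemma pauli_word_carrier': "pauli_word ps \<in> carrier_mat (2 ^ length ps) (2 ^ length ps)"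
  by (induction ps rule: pauli_word.induct) auto

lemma pauli_word_carrier [intro]: "ps \<in> pauli_words n \<Longrightarrow> pauli_word ps \<in> carrier_mat (2 ^ n) (2 ^ n)"
  using pauli_word_carrier'[of ps] by (simp add: pauli_words_def)

section \<open>Unitarity, traces and completeness of Pauli words\<close>

lemma unitary_pauli1: "mat_adjoint (pauli1 x z) * pauli1 x z = 1\<^sub>m 2" "pauli1 x z
    * mat_adjoint (pauli1 x z) = 1\<^sub>m 2"
proof -
  have c: "pauli1 x z \<in> carrier_mat 2 2" "mat_adjoint (pauli1 x z) \<in> carrier_mat 2 2" by auto
  show "mat_adjoint (pauli1 x z) * pauli1 x z = 1\<^sub>m 2" "pauli1 x z * mat_adjoint (pauli1 x z)
      = 1\<^sub>m 2"
    by (rule eq_mat_2I; auto simp: mult_mat_index[OF c(1,2)] mult_mat_index[OF c(2,1)] pauli1_index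
        sum_lessThan_2 intro!: mult_carrier_mat)+
qed

lemma unitary_pauli_word:
  assumes "ps \<in> pauli_words n"
  shows "mat_adjoint (pauli_word ps) * pauli_word ps = 1\<^sub>m (2 ^ n)"
    "pauli_word ps * mat_adjoint (pauli_word ps) = 1\<^sub>m (2 ^ n)"
proof -
  have "mat_adjoint (pauli_word ps) * pauli_word ps = 1\<^sub>m (2 ^ length ps) \<and>
    pauli_word ps * mat_adjoint (pauli_word ps) = 1\<^sub>m (2 ^ length ps)"
  proof (induction ps rule: pauli_word.induct)
    case (2 x z ps)
    have c: "pauli_word ps \<in> carrier_mat (2 ^ length ps) (2 ^ length ps)"
      by (rule pauli_word_carrier')
    show ?case
      using 2 c mat_adjoint_carrier[OF c]
      by (simp add: kron_adjoint kron_mult[of _ 2 2 _ 2 _ "2 ^ length ps" "2 ^ length ps" _ "2 ^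
          length ps"]
          unitary_pauli1 kron_one)
  qed simp
  then show "mat_adjoint (pauli_word ps) * pauli_word ps = 1\<^sub>m (2 ^ n)"
    "pauli_word ps * mat_adjoint (pauli_word ps) = 1\<^sub>m (2 ^ n)"
    using assms by (auto simp: pauli_words_def)
qed

lemma pauli_word_one: "\<forall>(x, z)\<in>set ps. \<not> x \<and> \<not> z \<Longrightarrow> pauli_word ps = 1\<^sub>m (2 ^ length ps)"
  by (induction ps rule: pauli_word.induct) (auto simp: pauli1_def kron_one)

lemma mtrace_pauli1: "mtrace (pauli1 x z) = (if x \<or> z then 0 else 2)"
proof -
  show ?thesis by (simp add: mtrace_def pauli1_index sum_lessThan_2)
qed

lemma mtrace_pauli_word: "\<exists>(x, z)\<in>set ps. x \<or> z \<Longrightarrow> mtrace (pauli_word ps) = 0"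
proof (induction ps rule: pauli_word.induct)
  case (2 x z ps)
  then show ?case by (auto simp: mtrace_kron[OF pauli1_carrier pauli_word_carrier'] mtrace_pauli1)
qed simp

text \<open>The amplitude with which |0...0> is left in place: any bit flip moves it to an
  orthogonal basis vector, while phase flips fix it.\<close>

lemma pauli_word_index_00: "pauli_word ps $$ (0, 0) = (if \<exists>(x, z)\<in>set ps. x then 0 else 1)"
proof (induction ps rule: pauli_word.induct)
  case (2 x z ps)
  have c: "pauli_word ps \<in> carrier_mat (2 ^ length ps) (2 ^ length ps)"
    by (rule pauli_word_carrier')
  show ?case
    using 2 kron_index_pair[OF pauli1_carrier c, of 0 0 0 0 x z] by (simp add: pauli1_index)
qed simp

lemma pauli1_completeness:
  assumes "i < 2" "j < 2" "k < 2" "l < 2"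
  shows "(\<Sum>p\<in>UNIV. case p of (x, z) \<Rightarrow> pauli1 x z $$ (i, j) * cnj (pauli1 x z $$ (k, l)))
    = (if i = k \<and> j = l then 2 else 0)"
  using assms unfolding UNIV_Times_UNIV[symmetric]
  by (auto simp: pauli1_index UNIV_bool sum.cartesian_product[symmetric] less_2_cases_iff)

text \<open>The completeness relation of the Paulis as an orthogonal operator basis of squared norm
  \<open>2 ^ n\<close>. It factors over the qubits, so the one-qubit case and induction suffice.
  Both the expansion and the Parseval identity below rest on it.\<close>

lemma pauli_word_completeness:
  assumes "i < 2 ^ n" "j < 2 ^ n" "k < 2 ^ n" "l < 2 ^ n"
  shows "(\<Sum>ps\<in>pauli_words n. pauli_word ps $$ (i, j) * cnj (pauli_word ps $$ (k, l)))
    = (if i = k \<and> j = l then 2 ^ n else 0)"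
  using assms
proof (induction n arbitrary: i j k l)
  case (Suc n)
  let ?N = "2 ^ n :: nat"
  have b: "a div ?N < 2" "a mod ?N < ?N" if "a < 2 ^ Suc n" for a
    using that div_mod_less[of a 2 ?N] by auto
  have idx: "pauli_word ((x, z) # ps) $$ (a, c) = pauli1 x z $$ (a div ?N, c div ?N)
      * pauli_word ps $$ (a mod ?N, c mod ?N)"
    if "a < 2 ^ Suc n" "c < 2 ^ Suc n" "ps \<in> pauli_words n" for a c x z ps
  proof -
    have "dim_row (pauli_word ps) = ?N" "dim_col (pauli_word ps) = ?N"
      using pauli_word_carrier[OF that(3)] by auto
    moreover have "dim_row (pauli1 x z) = 2" "dim_col (pauli1 x z) = 2"
      using pauli1_carrier[of x z] by auto
    ultimately show ?thesis using that by (simp add: kron_index)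
  qed
  have "(\<Sum>ps\<in>pauli_words (Suc n). pauli_word ps $$ (i, j) * cnj (pauli_word ps $$ (k, l)))
    = (\<Sum>p\<in>UNIV. \<Sum>ps\<in>pauli_words n. (case p of (x, z) \<Rightarrow> pauli1 x z $$ (i div ?N, j div ?N) *
       cnj (pauli1 x z $$ (k div ?N, l div ?N))) *
       (pauli_word ps $$ (i mod ?N, j mod ?N) * cnj (pauli_word ps $$ (k mod ?N, l mod ?N))))"
    unfolding sum_pauli_words_Suc
    using Suc.prems by (intro sum.cong refl) (auto simp: idx simp del: pauli_word.simps)
  also have "\<dots> = (\<Sum>p\<in>UNIV. case p of (x, z) \<Rightarrow> pauli1 x z $$ (i div ?N, j div ?N) *
       cnj (pauli1 x z $$ (k div ?N, l div ?N))) *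
       (\<Sum>ps\<in>pauli_words n. pauli_word ps $$ (i mod ?N, j mod ?N)
           * cnj (pauli_word ps $$ (k mod ?N, l mod ?N)))"
    unfolding sum_distrib_right unfolding sum_distrib_left ..
  also have "\<dots> = (if i div ?N = k div ?N \<and> j div ?N = l div ?N then 2 else 0) *
      (if i mod ?N = k mod ?N \<and> j mod ?N = l mod ?N then 2 ^ n else 0)"
    using Suc.prems b by (simp only: pauli1_completeness Suc.IH)
  also have "\<dots> = (if i = k \<and> j = l then 2 ^ Suc n else 0)"
  proof -
    have "a = c \<longleftrightarrow> a div ?N = c div ?N \<and> a mod ?N = c mod ?N" for a c by (metis div_mult_mod_eq)
    from this[of i k] this[of j l] show ?thesis by auto
  qed
  finally show ?case .
qed simp

text \<open>The sign (-1)^\<omega> of the symplectic form \<omega> on bit strings: -1 exactly when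
  the two Paulis anticommute.\<close>

fun pauli_sign :: "pauli_string \<Rightarrow> pauli_string \<Rightarrow> complex" where
  "pauli_sign ((x, z) # ps) ((x', z') # qs) = (if (x \<and> z') \<noteq> (z \<and> x') then -1 else 1)
      * pauli_sign ps qs"
| "pauli_sign _ _ = 1"

lemma pauli1_conj:
  "mat_adjoint (pauli1 x z) * pauli1 x' z' * pauli1 x z =
    (if (x \<and> z') \<noteq> (z \<and> x') then -1 else 1) \<cdot>\<^sub>m pauli1 x' z'"
proof -
  have c: "pauli1 x z \<in> carrier_mat 2 2" "mat_adjoint (pauli1 x z) \<in> carrier_mat 2 2"
    "pauli1 x' z' \<in> carrier_mat 2 2" "mat_adjoint (pauli1 x z) * pauli1 x' z' \<in> carrier_mat 2 2"
    by (auto intro!: mult_carrier_mat)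
  show ?thesis
    by (rule eq_mat_2I) (auto simp: mult_mat_index[OF c(4,1)] mult_mat_index[OF c(2,3)] pauli1_index
        sum_lessThan_2 intro!: mult_carrier_mat)
qed

lemma pauli_word_conj:
  assumes "ps \<in> pauli_words n" "qs \<in> pauli_words n"
  shows "mat_adjoint (pauli_word ps) * pauli_word qs * pauli_word ps = pauli_sign ps qs
      \<cdot>\<^sub>m pauli_word qs"
  using assms
proof (induction ps qs arbitrary: n rule: pauli_sign.induct)
  case (1 x z ps x' z' qs)
  then obtain m where m: "n = Suc m" "ps \<in> pauli_words m" "qs \<in> pauli_words m"
    by (auto simp: pauli_words_def)
  define N where "N = (2 ^ m :: nat)"
  have c: "pauli_word ps \<in> carrier_mat N N" "pauli_word qs
      \<in> carrier_mat N N" "mat_adjoint (pauli_word ps) \<in> carrier_mat N N"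
    using m unfolding N_def by auto
  have "mat_adjoint (pauli_word ((x, z) # ps)) * pauli_word ((x', z') # qs)
      * pauli_word ((x, z) # ps)
    = (mat_adjoint (pauli1 x z) * pauli1 x' z' * pauli1 x z) \<otimes>\<^sub>k
      (mat_adjoint (pauli_word ps) * pauli_word qs * pauli_word ps)"
  proof -
    have "(mat_adjoint (pauli1 x z) * pauli1 x' z')
        \<otimes>\<^sub>k (mat_adjoint (pauli_word ps) * pauli_word qs) *
        (pauli1 x z \<otimes>\<^sub>k pauli_word ps) = (mat_adjoint (pauli1 x z) * pauli1 x' z' * pauli1 x z) \<otimes>\<^sub>k
      (mat_adjoint (pauli_word ps) * pauli_word qs * pauli_word ps)"
      using c by (intro kron_mult[where a = 2 and a' = 2 and a'' = 2 and b = N and b' = N and b''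
          = N] mult_carrier_mat) auto
    then show ?thesis
      using c by (simp add: kron_adjoint kron_mult[of _ 2 2 _ 2 _ N N _ N] del: assoc_mult_mat)
  qed
  then show ?case
    unfolding pauli1_conj 1(1)[OF m(2,3)]
    by (simp add: kron_smult_left kron_smult_right) (auto intro!: eq_matI)
next
  case ("2_1" qs)
  then show ?case by (auto simp: pauli_words_def)
next
  case ("2_2" ps)
  then show ?case by (auto simp: pauli_words_def)
qed

text \<open>As a function of \<open>ps\<close> the sign is a character of the group of Paulis modulo
  phase. The symplectic form is nondegenerate, so different words give different characters, and
  these are orthogonal.\<close>

lemma pauli_sign_orthogonal:
  assumes "qs \<in> pauli_words n" "qs' \<in> pauli_words n"
  shows "(\<Sum>ps\<in>pauli_words n. pauli_sign ps qs * cnj (pauli_sign ps qs'))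
      = (if qs = qs' then 4 ^ n else 0)"
  using assms
proof (induction n arbitrary: qs qs')
  case (Suc n)
  obtain x z rs x' z' rs' where q: "qs = (x, z) # rs" "qs' = (x', z') # rs'" "rs
      \<in> pauli_words n" "rs' \<in> pauli_words n"
    using Suc.prems by (auto simp: pauli_words_Suc)
  let ?s = "\<lambda>p (x', z'). (case p of (x, z) \<Rightarrow> if (x \<and> z') \<noteq> (z \<and> x') then -1 else 1) :: complex"
  have "(\<Sum>ps\<in>pauli_words (Suc n). pauli_sign ps qs * cnj (pauli_sign ps qs'))
    = (\<Sum>p\<in>UNIV. \<Sum>ps\<in>pauli_words n. (?s p (x, z) * ?s p (x', z'))
        * (pauli_sign ps rs * cnj (pauli_sign ps rs')))"
    unfolding sum_pauli_words_Suc q(1,2) by (intro sum.cong refl) auto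
  also have "\<dots> = (\<Sum>p\<in>UNIV. ?s p (x, z) * ?s p (x', z'))
      * (\<Sum>ps\<in>pauli_words n. pauli_sign ps rs * cnj (pauli_sign ps rs'))"
    unfolding sum_distrib_right unfolding sum_distrib_left ..
  also have "(\<Sum>p\<in>UNIV. ?s p (x, z) * ?s p (x', z')) = (if x = x' \<and> z = z' then 4 else 0)"
    unfolding UNIV_Times_UNIV[symmetric]
    by (cases x; cases z; cases x'; cases z'; simp add: UNIV_bool sum.cartesian_product[symmetric])
  finally show ?case using Suc.IH[OF q(3,4)] q by auto
qed simp

section \<open>Pauli expansion and twirling\<close>

lemma card_pauli_words: "card (pauli_words n) = 4 ^ n"
proof (induction n)
  case (Suc n)
  have "card (pauli_words (Suc n)) = card ((UNIV :: (bool \<times> bool) set) \<times> pauli_words n)"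
    unfolding pauli_words_Suc by (rule card_image) (auto simp: inj_on_def)
  moreover have "card (UNIV :: (bool \<times> bool) set) = 4"
    unfolding UNIV_Times_UNIV[symmetric] card_cartesian_product by simp
  ultimately show ?case using Suc by (simp add: card_cartesian_product)
qed simp

text \<open>The partial trace over the qubits of (1 \<otimes> adjoint of P) G, divided by
  \<open>2 ^ n\<close>.\<close>

definition pauli_coeff :: "nat \<Rightarrow> nat \<Rightarrow> complex mat \<Rightarrow> pauli_string \<Rightarrow> complex mat" where
  "pauli_coeff r n G ps = mat r r (\<lambda>(u, v). (\<Sum>q<2 ^ n. \<Sum>q'<2 ^ n.
     cnj (pauli_word ps $$ (q, q')) * G $$ (u * 2 ^ n + q, v * 2 ^ n + q')) / 2 ^ n)"

lemma pauli_coeff_carrier [simp, intro]: "pauli_coeff r n G ps \<in> carrier_mat r r"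
  by (simp add: pauli_coeff_def)

lemma pauli_expansion:
  assumes "G \<in> carrier_mat (r * 2 ^ n) (r * 2 ^ n)"
  shows "G = mat_sum (r * 2 ^ n) (pauli_words n) (\<lambda>ps. pauli_coeff r n G ps \<otimes>\<^sub>k pauli_word ps)"
proof (rule eq_mat_pairI[of _ r "2 ^ n" r "2 ^ n"])
  let ?N = "2 ^ n :: nat"
  fix u q v q' assume i: "u < r" "q < ?N" "v < r" "q' < ?N"
  have "mat_sum (r * ?N) (pauli_words n) (\<lambda>ps. pauli_coeff r n G ps \<otimes>\<^sub>k pauli_word ps) $$ (u * ?N
      + q, v * ?N + q')
    = (\<Sum>ps\<in>pauli_words n. (pauli_coeff r n G ps \<otimes>\<^sub>k pauli_word ps) $$ (u * ?N + q, v * ?N + q'))"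
    using i by (simp add: pair_index_less)
  also have "\<dots> = (\<Sum>ps\<in>pauli_words n. pauli_coeff r n G ps $$ (u, v) * pauli_word ps $$ (q, q'))"
    using i pauli_word_carrier by (intro sum.cong refl kron_index_pair) auto
  also have "\<dots> = (\<Sum>ps\<in>pauli_words n. \<Sum>s<?N. \<Sum>s'<?N.
      (pauli_word ps $$ (q, q') * cnj (pauli_word ps $$ (s, s')))
          * G $$ (u * ?N + s, v * ?N + s') / 2 ^ n)"
    using i by (simp add: pauli_coeff_def sum_distrib_left sum_distrib_right sum_divide_distrib
        mult_ac)
  also have "\<dots> = (\<Sum>s<?N. \<Sum>s'<?N. (\<Sum>ps\<in>pauli_words n. pauli_word ps $$ (q, q')
      * cnj (pauli_word ps $$ (s, s')))
       * G $$ (u * ?N + s, v * ?N + s') / 2 ^ n)"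
    by (simp add: sum_distrib_right sum_divide_distrib sum.swap[of _ _ "pauli_words n"])
  also have "\<dots> = (\<Sum>s<?N. \<Sum>s'<?N. if s' = q' then if s
      = q then G $$ (u * ?N + q, v * ?N + q') else 0 else 0)"
    using i by (intro sum.cong refl) (auto simp: pauli_word_completeness)
  also have "\<dots> = G $$ (u * ?N + q, v * ?N + q')" using i by simp
  finally show "G $$ (u * ?N + q, v * ?N + q') = mat_sum (r * ?N) (pauli_words n)
    (\<lambda>ps. pauli_coeff r n G ps \<otimes>\<^sub>k pauli_word ps) $$ (u * ?N + q, v * ?N + q')" by simp
qed (use assms in auto)

text \<open>Parseval: the Gram matrices of the coefficients sum to the partial trace of the Gram
  matrix of \<open>G\<close> over \<open>2 ^ n\<close>. Completeness cancels one of the two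
  normalising factors.\<close>

lemma pauli_coeff_gram:
  assumes "v < r" "v' < r"
  shows "(\<Sum>ps\<in>pauli_words n. \<Sum>u<r. cnj (pauli_coeff r n G ps $$ (u, v))
      * pauli_coeff r n G ps $$ (u, v'))
    = (\<Sum>q'<2 ^ n. \<Sum>x<r * 2 ^ n. cnj (G $$ (x, v * 2 ^ n + q')) * G $$ (x, v' * 2 ^ n + q')) / 2 ^ n"
        (is "?L = _")
proof -
  let ?N = "2 ^ n :: nat"
  let ?g = "\<lambda>u v s s'. G $$ (u * ?N + s, v * ?N + s')"
  have one: "(\<Sum>ps\<in>pauli_words n. cnj (pauli_coeff r n G ps $$ (u, v))
      * pauli_coeff r n G ps $$ (u, v'))
     = (\<Sum>q'<?N. \<Sum>q<?N. cnj (?g u v q q') * ?g u v' q q') / 2 ^ n" if u: "u < r" for u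
  proof -
    let ?S = "{..<?N} \<times> {..<?N}"
    have c: "pauli_coeff r n G ps $$ (u, w) = (\<Sum>(q, q')\<in>?S. cnj (pauli_word ps $$ (q, q'))
        * ?g u w q q') / 2 ^ n"
      if "w < r" for w ps using u that by (simp add: pauli_coeff_def sum.cartesian_product)
    have "(\<Sum>ps\<in>pauli_words n. cnj (pauli_coeff r n G ps $$ (u, v))
        * pauli_coeff r n G ps $$ (u, v'))
      = (\<Sum>ps\<in>pauli_words n. \<Sum>(q, q')\<in>?S. \<Sum>(s, s')\<in>?S.
          (pauli_word ps $$ (q, q') * cnj (pauli_word ps $$ (s, s')))
          * (cnj (?g u v q q') * ?g u v' s s') / (2 ^ n * 2 ^ n))"
      by (simp add: c assms sum_product sum_divide_distrib case_prod_beta mult_ac)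
    also have "\<dots> = (\<Sum>p\<in>?S. \<Sum>p'\<in>?S. (\<Sum>ps\<in>pauli_words n. pauli_word ps $$ p
        * cnj (pauli_word ps $$ p'))
          * (cnj (?g u v (fst p) (snd p)) * ?g u v' (fst p') (snd p')) / (2 ^ n * 2 ^ n))"
      by (simp add: sum_distrib_right sum_divide_distrib case_prod_beta
          sum.swap[of _ _ "pauli_words n"])
    also have "\<dots> = (\<Sum>p\<in>?S. \<Sum>p'\<in>?S. if p' = p then cnj (?g u v (fst p) (snd p))
        * ?g u v' (fst p) (snd p) / 2 ^ n else 0)"
      by (intro sum.cong refl) (auto simp: pauli_word_completeness split: if_splits)
    also have "\<dots> = (\<Sum>p\<in>?S. cnj (?g u v (fst p) (snd p)) * ?g u v' (fst p) (snd p) / 2 ^ n)" by simp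
    also have "\<dots> = (\<Sum>q<?N. \<Sum>q'<?N. cnj (?g u v q q') * ?g u v' q q' / 2 ^ n)"
      by (simp add: sum.cartesian_product case_prod_beta)
    also have "\<dots> = (\<Sum>q'<?N. \<Sum>q<?N. cnj (?g u v q q') * ?g u v' q q') / 2 ^ n"
      by (subst sum.swap) (simp add: sum_divide_distrib)
    finally show ?thesis .
  qed
  have "?L
    = (\<Sum>u<r. \<Sum>q'<?N. \<Sum>q<?N. cnj (?g u v q q') * ?g u v' q q') / 2 ^ n"
    by (subst sum.swap) (simp add: one sum_divide_distrib)
  also have "(\<Sum>u<r. \<Sum>q'<?N. \<Sum>q<?N. cnj (?g u v q q') * ?g u v' q q') =
    (\<Sum>q'<?N. \<Sum>x<r * ?N. cnj (G $$ (x, v * ?N + q')) * G $$ (x, v' * ?N + q'))"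
    by (subst sum.swap) (simp add: sum_lessThan_times)
  finally show ?thesis .
qed

text \<open>The Pauli coefficients of the Kraus operators of a channel on \<open>R \<otimes> Q\<close> are the Kraus operators
  of a channel on \<open>R\<close>.\<close>

lemma pauli_coeff_complete:
  fixes p :: nat
  assumes "\<And>s. s < p \<Longrightarrow> G s \<in> carrier_mat (r * 2 ^ n) (r * 2 ^ n)"
    and "\<And>X. X \<in> carrier_mat (r * 2 ^ n) (r * 2 ^ n) \<Longrightarrow>
      mtrace (kraus (r * 2 ^ n) {..<p} (\<lambda>_. 1) G X) = mtrace X"
  shows "mat_sum r ({..<p} \<times> pauli_words n)
     (\<lambda>(s, ps). mat_adjoint (pauli_coeff r n (G s) ps) * pauli_coeff r n (G s) ps) = 1\<^sub>m r"
proof (rule eq_matI)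
  let ?A = "\<lambda>s ps. pauli_coeff r n (G s) ps"
  let ?N = "2 ^ n :: nat"
  fix v v' assume "v < dim_row (1\<^sub>m r :: complex mat)" "v' < dim_col (1\<^sub>m r :: complex mat)"
  then have v: "v < r" "v' < r" by auto
  have d: "dim_row (?A s ps) = r" "dim_col (?A s ps) = r" for s ps
    using pauli_coeff_carrier[of r n "G s" ps] by blast+
  have "(mat_adjoint (?A s ps) * ?A s ps) $$ (v, v')
      = (\<Sum>u<r. cnj (?A s ps $$ (u, v)) * ?A s ps $$ (u, v'))" for s ps
    using v by (subst mult_mat_index[of _ r r _ r]) (auto simp: d)
  then have "mat_sum r ({..<p} \<times> pauli_words n)
      (\<lambda>(s, ps). mat_adjoint (?A s ps) * ?A s ps) $$ (v, v')
    = (\<Sum>s<p. \<Sum>ps\<in>pauli_words n. \<Sum>u<r. cnj (?A s ps $$ (u, v)) * ?A s ps $$ (u, v'))"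
    using v by (simp add: case_prod_beta sum.cartesian_product')
  also have "\<dots> = (\<Sum>s<p. \<Sum>q'<?N. \<Sum>x<r * ?N. cnj (G s $$ (x, v * ?N + q')) * G s $$ (x, v' * ?N + q'))
      / 2 ^ n"
    using v by (simp add: pauli_coeff_gram sum_divide_distrib)
  also have "\<dots> = (\<Sum>q'<?N. \<Sum>s<p. \<Sum>x<r * ?N. cnj (G s $$ (x, v * ?N + q')) * G s $$ (x, v' * ?N + q'))
      / 2 ^ n"
    by (subst sum.swap) simp
  \<comment> \<open>By trace preservation the Gram matrices of the \<open>G s\<close> sum to the
    identity; its partial trace over the \<open>2 ^ n\<close> values of \<open>q'\<close> cancels
    the denominator.\<close>
  also have "\<dots> = (\<Sum>q'<?N. if v' * ?N + q' = v * ?N + q' then 1 else 0) / 2 ^ n"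
  proof (intro arg_cong[where f = "\<lambda>x. x / 2 ^ n"] sum.cong refl)
    fix q' assume "q' \<in> {..<?N}"
    then show "(\<Sum>s<p. \<Sum>x<r * ?N. cnj (G s $$ (x, v * ?N + q')) * G s $$ (x, v' * ?N + q'))
      = (if v' * ?N + q' = v * ?N + q' then 1 else 0)"
      using v assms by (intro trace_preserving_kraus) (auto simp: pair_index_less)
  qed
  also have "\<dots> = 1\<^sub>m r $$ (v, v')" using v by simp
  finally show "mat_sum r ({..<p} \<times> pauli_words n)
      (\<lambda>(s, ps). mat_adjoint (?A s ps) * ?A s ps) $$ (v, v') = 1\<^sub>m r $$ (v, v')" .
qed auto

text \<open>Expanding both copies of the inner sum gives one term for each pair \<open>qs\<close>,
  \<open>qs'\<close>. The key \<open>ps\<close> enters a term only through two signs, so character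
  orthogonality leaves the diagonal.\<close>

lemma pauli_twirl:
  assumes "\<And>qs. qs \<in> pauli_words n \<Longrightarrow> G qs \<in> carrier_mat b b" "X \<in> carrier_mat b b"
  shows "mat_sum b (pauli_words n) (\<lambda>ps. conj_by
      (mat_sum b (pauli_words n) (\<lambda>qs. pauli_sign ps qs \<cdot>\<^sub>m G qs)) X)
    = 4 ^ n \<cdot>\<^sub>m mat_sum b (pauli_words n) (\<lambda>qs. conj_by (G qs) X)"
proof (rule eq_mat_carrierI[of _ b b])
  let ?W = "pauli_words n"
  fix i j assume ij: "i < b" "j < b"
  let ?M = "\<lambda>ps. mat_sum b ?W (\<lambda>qs. pauli_sign ps qs \<cdot>\<^sub>m G qs)"
  let ?t = "\<lambda>ps qs qs' k l. (pauli_sign ps qs * cnj (pauli_sign ps qs')) *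
    (G qs $$ (i, k) * X $$ (k, l) * cnj (G qs' $$ (j, l)))"
  define T where "T qs qs' = (\<Sum>k<b. \<Sum>l<b. G qs $$ (i, k) * X $$ (k, l) * cnj (G qs' $$ (j, l)))"
      for qs qs'
  have idx: "?M ps $$ (x, y) = (\<Sum>qs\<in>?W. pauli_sign ps qs * G qs $$ (x, y))"
    if xy: "x < b" "y < b" for ps x y
  proof -
    have "(pauli_sign ps qs \<cdot>\<^sub>m G qs) $$ (x, y) = pauli_sign ps qs * G qs $$ (x, y)" if "qs \<in> ?W"
        for qs
      using assms(1)[OF that] xy by auto
    then show ?thesis using xy by simp
  qed
  have "conj_by (?M ps) X $$ (i, j)
    = (\<Sum>qs\<in>?W. \<Sum>qs'\<in>?W. (pauli_sign ps qs * cnj (pauli_sign ps qs')) * T qs qs')" for ps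
  proof -
    have "conj_by (?M ps) X $$ (i, j)
      = (\<Sum>k<b. \<Sum>l<b. \<Sum>qs\<in>?W. \<Sum>qs'\<in>?W. ?t ps qs qs' k l)"
    proof (subst conj_by_index[OF mat_sum_carrier assms(2) ij], intro sum.cong refl)
      fix k l assume "k \<in> {..<b}" "l \<in> {..<b}"
      then have kl: "k < b" "l < b" by auto
      show "?M ps $$ (i, k) * X $$ (k, l) *
          cnj (?M ps $$ (j, l))
        = (\<Sum>qs\<in>?W. \<Sum>qs'\<in>?W. ?t ps qs qs' k l)"
        unfolding idx[OF ij(1) kl(1)] idx[OF ij(2) kl(2)] cnj_sum sum_distrib_right
        unfolding sum_distrib_left by (intro sum.cong refl) simp
    qed
    also have "\<dots> = (\<Sum>k<b. \<Sum>qs\<in>?W. \<Sum>l<b. \<Sum>qs'\<in>?W. ?t ps qs qs' k l)"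
      by (intro sum.cong refl sum.swap)
    also have "\<dots> = (\<Sum>qs\<in>?W. \<Sum>k<b. \<Sum>qs'\<in>?W. \<Sum>l<b. ?t ps qs qs' k l)"
      by (subst sum.swap) (intro sum.cong refl sum.swap)
    also have "\<dots> = (\<Sum>qs\<in>?W. \<Sum>qs'\<in>?W. \<Sum>k<b. \<Sum>l<b. ?t ps qs qs' k l)"
      by (intro sum.cong refl sum.swap)
    finally show ?thesis by (simp add: T_def sum_distrib_left)
  qed
  then have "mat_sum b ?W (\<lambda>ps. conj_by (?M ps) X) $$ (i, j)
    = (\<Sum>ps\<in>?W. \<Sum>qs\<in>?W. \<Sum>qs'\<in>?W. (pauli_sign ps qs * cnj (pauli_sign ps qs')) * T qs qs')"
    using ij by simp
  also have "\<dots> = (\<Sum>qs\<in>?W. \<Sum>ps\<in>?W. \<Sum>qs'\<in>?W. (pauli_sign ps qs * cnj (pauli_sign ps qs')) * T qs qs')"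
    by (rule sum.swap)
  also have "\<dots> = (\<Sum>qs\<in>?W. \<Sum>qs'\<in>?W. \<Sum>ps\<in>?W. (pauli_sign ps qs * cnj (pauli_sign ps qs')) * T qs qs')"
    by (intro sum.cong refl sum.swap)
  also have "\<dots> = (\<Sum>qs\<in>?W. \<Sum>qs'\<in>?W. if qs' = qs then 4 ^ n * T qs qs else 0)"
    by (intro sum.cong refl) (auto simp: pauli_sign_orthogonal simp flip: sum_distrib_right)
  also have "\<dots> = 4 ^ n * (\<Sum>qs\<in>?W. T qs qs)" by (simp add: sum_distrib_left)
  also have "(\<Sum>qs\<in>?W. T qs qs) = (\<Sum>qs\<in>?W. conj_by (G qs) X $$ (i, j))"
    using ij assms by (intro sum.cong refl) (simp add: T_def conj_by_index[of _ b b])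
  finally show "mat_sum b ?W (\<lambda>ps. conj_by (?M ps) X) $$ (i, j)
    = (4 ^ n \<cdot>\<^sub>m mat_sum b ?W (\<lambda>qs. conj_by (G qs) X)) $$ (i, j)"
    using ij by simp
qed auto

text \<open>The \<open>4 ^ n\<close> of the twirl cancels the number of Pauli keys, so that only the
  average over the codes remains as a weight.\<close>

lemma mat_avg_pauli_twirl:
  assumes "\<And>k i qs. k \<in> K \<Longrightarrow> i \<in> I \<Longrightarrow> qs \<in> pauli_words n \<Longrightarrow> G k i qs \<in> carrier_mat b b"
    and "X \<in> carrier_mat b b"
  shows "mat_avg b (K \<times> pauli_words n) (\<lambda>(k, ps). mat_sum b I (\<lambda>i.
      conj_by (mat_sum b (pauli_words n) (\<lambda>qs. pauli_sign ps qs \<cdot>\<^sub>m G k i qs)) X))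
    = kraus b (K \<times> I \<times> pauli_words n) (\<lambda>_. 1 / of_nat (card K)) (\<lambda>(k, i, qs). G k i qs) X"
proof -
  let ?W = "pauli_words n"
  let ?c = "1 / of_nat (card (K \<times> ?W)) :: complex"
  have cc: "?c * 4 ^ n = 1 / of_nat (card K)" by (simp add: card_cartesian_product card_pauli_words)
  have c: "conj_by (G k i qs) X \<in> carrier_mat b b" if "k \<in> K" "i \<in> I" "qs \<in> ?W" for k i qs
    using assms that by auto
  have "mat_sum b (K \<times> ?W) (\<lambda>(k, ps). mat_sum b I
      (\<lambda>i. conj_by (mat_sum b ?W (\<lambda>qs. pauli_sign ps qs \<cdot>\<^sub>m G k i qs)) X))
    = mat_sum b K (\<lambda>k. mat_sum b ?W (\<lambda>ps. mat_sum b I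
        (\<lambda>i. conj_by (mat_sum b ?W (\<lambda>qs. pauli_sign ps qs \<cdot>\<^sub>m G k i qs)) X)))"
    by (simp add: mat_sum_product)
  also have "\<dots> = mat_sum b K (\<lambda>k. mat_sum b I
      (\<lambda>i. mat_sum b ?W (\<lambda>ps. conj_by (mat_sum b ?W (\<lambda>qs. pauli_sign ps qs \<cdot>\<^sub>m G k i qs)) X)))"
    by (intro mat_sum_cong refl mat_sum_swap)
  also have "\<dots> = mat_sum b K (\<lambda>k. mat_sum b I
      (\<lambda>i. 4 ^ n \<cdot>\<^sub>m mat_sum b ?W (\<lambda>qs. conj_by (G k i qs) X)))"
    using assms by (intro mat_sum_cong refl pauli_twirl) auto
  finally have "mat_avg b (K \<times> ?W) (\<lambda>(k, ps). mat_sum b I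
      (\<lambda>i. conj_by (mat_sum b ?W (\<lambda>qs. pauli_sign ps qs \<cdot>\<^sub>m G k i qs)) X))
    = ?c \<cdot>\<^sub>m mat_sum b K (\<lambda>k. mat_sum b I (\<lambda>i. 4 ^ n \<cdot>\<^sub>m mat_sum b ?W (\<lambda>qs. conj_by (G k i qs) X)))"
    by (simp add: mat_avg_def)
  also have "\<dots> = mat_sum b K (\<lambda>k. mat_sum b I
      (\<lambda>i. mat_sum b ?W (\<lambda>qs. ?c \<cdot>\<^sub>m (4 ^ n \<cdot>\<^sub>m conj_by (G k i qs) X))))"
    using c by (simp add: smult_mat_sum)
  also have "\<dots> = mat_sum b K (\<lambda>k. mat_sum b I
      (\<lambda>i. mat_sum b ?W (\<lambda>qs. (1 / of_nat (card K)) \<cdot>\<^sub>m conj_by (G k i qs) X)))"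
  proof (intro mat_sum_cong refl)
    fix k i qs
    show "?c \<cdot>\<^sub>m (4 ^ n \<cdot>\<^sub>m conj_by (G k i qs) X) = (1 / of_nat (card K)) \<cdot>\<^sub>m conj_by (G k i qs) X"
      unfolding cc[symmetric] by (rule eq_matI) auto
  qed
  also have "\<dots> = kraus b (K \<times> I \<times> ?W) (\<lambda>_. 1 / of_nat (card K)) (\<lambda>(k, i, qs). G k i qs) X"
    by (simp add: kraus_def mat_sum_product)
  finally show ?thesis .
qed

section \<open>Further facts on conjugation and traces\<close>

text \<open>\<open>Y\<close> may be any rectangular matrix, so the same rule absorbs key unitaries,
  the register exchange and the test vectors of the simulator into the Kraus operator between
  them.\<close>

lemma conj_by_sandwich:
  assumes "Y \<in> carrier_mat n a" "G \<in> carrier_mat n n" "X \<in> carrier_mat a a"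
  shows "conj_by (mat_adjoint Y) (conj_by G (conj_by Y X)) = conj_by (conj_by (mat_adjoint Y) G) X"
      (is "?L = _")
proof -
  have "?L = conj_by (mat_adjoint Y) (conj_by (G * Y) X)"
    using assms by (subst conj_by_conj_by[of _ n n _ a]) auto
  also have "\<dots> = conj_by (mat_adjoint Y * (G * Y)) X"
    using assms by (intro conj_by_conj_by[of _ a n _ a]) auto
  also have "mat_adjoint Y * (G * Y) = conj_by (mat_adjoint Y) G"
    using assms by (simp add: conj_by_def assoc_mult_mat[of _ a n G n Y a])
  finally show ?thesis .
qed

lemma sum_mtrace_conj_by:
  assumes "\<And>x. x \<in> I \<Longrightarrow> G x \<in> carrier_mat b a" "X \<in> carrier_mat a a"
  shows "(\<Sum>x\<in>I. mtrace (conj_by (G x) X)) =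
    (\<Sum>k<a. \<Sum>l<a. mat_sum a I (\<lambda>x. mat_adjoint (G x) * G x) $$ (l, k) * X $$ (k, l))" (is "?L = _")
proof -
  have "?L =
      (\<Sum>x\<in>I. \<Sum>k<a. \<Sum>l<a. (mat_adjoint (G x) * G x) $$ (l, k) * X $$ (k, l))"
    using assms by (intro sum.cong refl mtrace_conj_by)
  also have "\<dots> = (\<Sum>k<a. \<Sum>l<a. \<Sum>x\<in>I. (mat_adjoint (G x) * G x) $$ (l, k) * X $$ (k, l))"
    by (subst sum.swap) (intro sum.cong refl sum.swap)
  finally show ?thesis by (simp add: sum_distrib_right)
qed

lemma sum_mtrace_conj_by_one:
  assumes "\<And>x. x \<in> I \<Longrightarrow> G x \<in> carrier_mat b a" "X \<in> carrier_mat a a"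
    and "mat_sum a I (\<lambda>x. mat_adjoint (G x) * G x) = 1\<^sub>m a"
  shows "(\<Sum>x\<in>I. mtrace (conj_by (G x) X)) = mtrace X" (is "?L = _")
proof -
  have "?L =
      (\<Sum>k<a. \<Sum>l<a. mat_sum a I (\<lambda>x. mat_adjoint (G x) * G x) $$ (l, k) * X $$ (k, l))"
    by (rule sum_mtrace_conj_by) (use assms in auto)
  also have "\<dots> = (\<Sum>k<a. \<Sum>l<a. if l = k then X $$ (k, k) else 0)"
    unfolding assms(3) by (intro sum.cong refl) auto
  finally show ?thesis using assms(2) by (simp add: mtrace_def)
qed

lemma mtrace_conj_by_isometry:
  assumes "G \<in> carrier_mat b a" "H \<in> carrier_mat c a" "X \<in> carrier_mat a a"
    and "mat_adjoint G * G = mat_adjoint H * H"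
  shows "mtrace (conj_by G X) = mtrace (conj_by H X)"
  using assms by (simp add: mtrace_conj_by[of _ _ a])

lemma mtrace_kraus:
  assumes "\<And>x. x \<in> I \<Longrightarrow> G x \<in> carrier_mat b a" "X \<in> carrier_mat a a"
  shows "mtrace (kraus b I w G X) = (\<Sum>x\<in>I. w x * mtrace (conj_by (G x) X))"
  unfolding kraus_def mtrace_mat_sum
proof (intro sum.cong refl)
  fix x assume "x \<in> I"
  then have "conj_by (G x) X \<in> carrier_mat b b" using assms by auto
  then show "(\<Sum>i<b. (w x \<cdot>\<^sub>m conj_by (G x) X) $$ (i, i)) = w x * mtrace (conj_by (G x) X)"
    by (auto simp: mtrace_def sum_distrib_left)
qed

section \<open>Kets, partial traces and decoding\<close>

lemma kron_one_right: "A \<otimes>\<^sub>k 1\<^sub>m 1 = A"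
  by (rule eq_matI) (auto simp: kron_index)

lemma ket_carrier [intro]: "v \<in> carrier_vec n \<Longrightarrow> ket v \<in> carrier_mat n 1"
  by (auto simp: ket_def)

lemma ket_index: "i < dim_vec v \<Longrightarrow> ket v $$ (i, 0) = v $ i"
  by (simp add: ket_def mat_of_cols_index)

lemma ketbra_eq:
  assumes "v \<in> carrier_vec n"
  shows "ketbra v = mat n n (\<lambda>(i, j). v $ i * cnj (v $ j))" (is "_ = ?R")
proof -
  have c: "ket v \<in> carrier_mat n 1" "mat_adjoint (ket v) \<in> carrier_mat 1 n"
    using ket_carrier[OF assms] by auto
  show ?thesis
  proof (rule eq_mat_carrierI[of _ n n])
    fix i j assume ij: "i < n" "j < n"
    then show "ketbra v $$ (i, j) = ?R $$ (i, j)"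
      using assms c unfolding ketbra_def by (subst mult_mat_index[OF c]) (auto simp: ket_index)
  qed (use c in \<open>auto simp: ketbra_def\<close>)
qed

lemma ketbra_unit_vec: "k < n \<Longrightarrow> ketbra (unit_vec n k) = mat_unit n k k"
  by (subst ketbra_eq[of _ n]) (auto intro!: eq_matI)

section \<open>Test vectors and the exchange of registers\<close>

lemma conj_by_ket_adjoint:
  assumes "v \<in> carrier_vec n" "Y \<in> carrier_mat n n"
  shows "conj_by (mat_adjoint (ket v)) Y = quad_form n Y (\<lambda>i. v $ i) \<cdot>\<^sub>m 1\<^sub>m 1" (is "?L = ?R")
proof (rule eq_matI)
  have c: "ket v \<in> carrier_mat n 1" using ket_carrier[OF assms(1)] .
  then have c': "mat_adjoint (ket v) \<in> carrier_mat 1 n" by auto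
  fix i j assume "i < dim_row ?R" "j < dim_col ?R"
  then have ij: "i = 0" "j = 0" by auto
  show "?L $$ (i, j) = ?R $$ (i, j)"
    unfolding ij using c assms(1)
    by (subst conj_by_index[OF c' assms(2)]) (auto simp: quad_form_def ket_index intro!: sum.cong)
qed (use ket_carrier[OF assms(1)] in auto)

lemma quad_form_unit_vec:
  assumes "k < n"
  shows "quad_form n Y (\<lambda>i. unit_vec n k $ i) = Y $$ (k, k)" (is "?L = _")
proof -
  have "?L = (\<Sum>i<n. \<Sum>j<n. if j = k then if i = k then Y $$ (k, k) else 0 else 0)"
    unfolding quad_form_def using assms by (intro sum.cong refl) auto
  then show ?thesis using assms by simp
qed

lemma epr_carrier [simp]: "epr d \<in> carrier_vec (d * d)"
  by (simp add: epr_def)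

text \<open>The identity on the first half ties the two EPR indices together, so only diagonal
  entries of \<open>Q\<close> survive. Hence the identity passes the EPR test with amplitude 1 and a
  traceless Pauli with amplitude 0.\<close>

lemma quad_form_epr:
  assumes "0 < d" "Q \<in> carrier_mat d d"
  shows "quad_form (d * d) (1\<^sub>m d \<otimes>\<^sub>k Q) (\<lambda>i. epr d $ i) = mtrace Q / of_nat d" (is "?L = _")
proof -
  have ep: "epr d $ (i * d + k) = (if i = k then 1 / of_real (sqrt (real d)) else 0)"
      if "i < d" "k < d" for i k
    using that by (simp add: epr_def pair_index_less)
  have sq: "complex_of_real (sqrt (real d)) * complex_of_real (sqrt (real d)) = of_nat d"
    using assms(1) by (metis abs_of_nat of_real_mult of_real_of_nat_eq real_sqrt_mult_self)
  have "?L
    = (\<Sum>i<d. \<Sum>k<d. \<Sum>j<d. \<Sum>l<d. if l = j then if j = i then if k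
        = i then Q $$ (i, i) / of_nat d else 0 else 0 else 0)"
    unfolding quad_form_def sum_lessThan_times
  proof (intro sum.cong refl)
    fix i k j l assume "i \<in> {..<d}" "k \<in> {..<d}" "j \<in> {..<d}" "l \<in> {..<d}"
    then have i: "i < d" "k < d" "j < d" "l < d" by auto
    show "cnj (epr d $ (i * d + k)) * (1\<^sub>m d \<otimes>\<^sub>k Q) $$ (i * d + k, j * d + l) * epr d $ (j * d + l)
      = (if l = j then if j = i then if k = i then Q $$ (i, i) / of_nat d else 0 else 0 else 0)"
      using i by (simp add: ep kron_index_pair[OF one_carrier_mat assms(2)] sq)
  qed
  also have "\<dots> = (\<Sum>i<d. \<Sum>k<d. if k = i then Q $$ (i, i) / of_nat d else 0)" by simp
  also have "\<dots> = mtrace Q / of_nat d" using assms by (simp add: mtrace_def sum_divide_distrib)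
  finally show ?thesis .
qed

lemma swap_mat_carrier [simp, intro]: "swap_mat r d \<in> carrier_mat (d * r) (r * d)"
  by (simp add: swap_mat_def)

lemma swap_mat_index:
  assumes "i < d * r" "p < r" "q < d"
  shows "swap_mat r d $$ (i, p * d + q) = (if i = q * r + p then 1 else 0)"
proof -
  have "i div r = q \<and> i mod r = p \<longleftrightarrow> i = q * r + p"
  proof
    assume "i div r = q \<and> i mod r = p"
    then show "i = q * r + p" by (metis div_mult_mod_eq)
  qed (use assms in simp)
  then show ?thesis using assms by (simp add: swap_mat_def pair_index_less)
qed

text \<open>The copy \<open>M\<^sub>2\<close> is idle during the attack, so undoing the exchange
  only restores the order of the two factors.\<close>

lemma conj_by_swap_mat:
  assumes "A \<in> carrier_mat r r"
  shows "conj_by (mat_adjoint (swap_mat r d)) (1\<^sub>m d \<otimes>\<^sub>k A) = A \<otimes>\<^sub>k 1\<^sub>m d" (is "?L = ?R")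
proof (rule eq_mat_pairI[of _ r d r d])
  fix p q p' q' assume i: "p < r" "q < d" "p' < r" "q' < d"
  have c: "mat_adjoint (swap_mat r d) \<in> carrier_mat (r * d) (d * r)" by auto
  have dim: "dim_row (swap_mat r d) = d * r" "dim_col (swap_mat r d) = r * d"
    by (auto simp: swap_mat_def)
  have "?L $$ (p * d + q, p' * d + q')
    = (\<Sum>k<d * r. \<Sum>l<d * r. if l = q' * r + p' then if k = q * r + p then
        (1\<^sub>m d \<otimes>\<^sub>k A) $$ (q * r + p, q' * r + p') else 0 else 0)"
  proof (subst conj_by_index[OF c], goal_cases)
    case 4
    show ?case
    proof (intro sum.cong refl, goal_cases)
      case (1 k l)
      then show ?case using i by (simp add: dim pair_index_less swap_mat_index)
    qed
  qed (use i assms in \<open>auto simp: pair_index_less\<close>)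
  also have "\<dots> = (1\<^sub>m d \<otimes>\<^sub>k A) $$ (q * r + p, q' * r + p')" using i by (simp add: pair_index_less)
  also have "\<dots> = ?R $$ (p * d + q, p' * d + q')"
    using i by (simp add: kron_index_pair[OF one_carrier_mat assms]
        kron_index_pair[OF assms one_carrier_mat])
  finally show "?L $$ (p * d + q, p' * d + q')
    = ?R $$ (p * d + q, p' * d + q')" .
qed (use assms in \<open>auto intro!: conj_by_carrier\<close>)

section \<open>Partial traces, decoding and the reject state\<close>

lemma ptrace2_carrier [simp, intro]: "ptrace2 a b X \<in> carrier_mat a a"
  by (simp add: ptrace2_def)

lemma ptrace2_kron:
  assumes "A \<in> carrier_mat a a" "B \<in> carrier_mat b b"
  shows "ptrace2 a b (A \<otimes>\<^sub>k B) = mtrace B \<cdot>\<^sub>m A"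
  using assms by (intro eq_matI)
    (auto simp: ptrace2_def kron_index_pair[OF assms] mtrace_def sum_distrib_left sum_distrib_right
        mult.commute)

lemma linear_superop_ptrace2: "linear_superop (a * b) a (ptrace2 a b)"
  by (rule linear_superopI)
    (auto simp: ptrace2_def pair_index_less sum.distrib sum_distrib_left intro!: eq_matI)

lemma linear_superop_mtrace:
  assumes "B \<in> carrier_mat b b"
  shows "linear_superop a b (\<lambda>X. mtrace X \<cdot>\<^sub>m B)"
  using assms by (intro linear_superopI)
    (auto simp: mtrace_add[of _ a] mtrace_smult[of _ a] add_smult_distrib_right_mat intro!: eq_matI)

lemma linear_superop_kron_right:
  assumes "B \<in> carrier_mat b b"
  shows "linear_superop a (a * b) (\<lambda>X. X \<otimes>\<^sub>k B)"
  using assms by (intro linear_superopI) (auto simp: kron_add_left kron_smult_left)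

lemma linear_superop_mat_avg:
  assumes "linear_superop a b \<Phi>" "finite I" "\<And>x. x \<in> I \<Longrightarrow> F x \<in> carrier_mat a a"
  shows "\<Phi> (mat_avg a I F) = mat_avg b I (\<lambda>x. \<Phi> (F x))"
  unfolding mat_avg_def using assms
  by (simp add: linear_superop_smult[OF assms(1)] linear_superop_mat_sum[OF assms])

lemma mtrace_conj_by_diag:
  assumes "B \<in> carrier_mat b b"
  shows "mtrace (conj_by (mat b b (\<lambda>(i, j). if i = j \<and> P i then 1 else 0)) B)
      = (\<Sum>i<b. if P i then B $$ (i, i) else 0)"
proof -
  let ?D = "mat b b (\<lambda>(i, j). if i = j \<and> P i then 1 else 0) :: complex mat"
  have D: "?D \<in> carrier_mat b b" by simp
  have "conj_by ?D B $$ (i, i) = (if P i then B $$ (i, i) else 0)" if "i < b" for i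
  proof -
    have "conj_by ?D B $$ (i, i) = (\<Sum>k<b. \<Sum>l<b. if l = i then if k = i then
        if P i then B $$ (i, i) else 0 else 0 else 0)"
      unfolding conj_by_index[OF D assms that that] using that by (intro sum.cong refl) auto
    then show ?thesis using that by simp
  qed
  then show ?thesis by (simp add: mtrace_def)
qed

lemma mtrace_conj_by_unit:
  assumes "B \<in> carrier_mat b b" "0 < b"
  shows "mtrace (conj_by (mat_unit b 0 0) B) = B $$ (0, 0)"
    "mtrace (conj_by (1\<^sub>m b - mat_unit b 0 0) B) = mtrace B - B $$ (0, 0)"
proof -
  have 1: "mat_unit b 0 0 = mat b b (\<lambda>(i, j). if i = j \<and> i = 0 then 1 else 0)"
    "1\<^sub>m b - mat_unit b 0 0 = mat b b (\<lambda>(i, j). if i = j \<and> i \<noteq> 0 then 1 else 0)"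
    by (auto intro!: eq_matI)
  show "mtrace (conj_by (mat_unit b 0 0) B) = B $$ (0, 0)"
    unfolding 1(1) mtrace_conj_by_diag[OF assms(1)] using assms(2) by simp
  have "(\<Sum>i<b. if i \<noteq> 0 then B $$ (i, i) else 0)
      = (\<Sum>i<b. B $$ (i, i) - (if i = 0 then B $$ (0, 0) else 0))"
    by (intro sum.cong) auto
  also have "\<dots> = mtrace B - B $$ (0, 0)" using assms by (simp add: sum_subtractf mtrace_def)
  finally show "mtrace (conj_by (1\<^sub>m b - mat_unit b 0 0) B) = mtrace B - B $$ (0, 0)"
    unfolding 1(2) mtrace_conj_by_diag[OF assms(1)] .
qed

lemma msg_embed_carrier [simp, intro]: "msg_embed d \<in> carrier_mat (d + 1) d"
  by (simp add: msg_embed_def)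

lemma bot_state_eq: "bot_state d = mat_unit (d + 1) d d"
  by (simp add: bot_state_def ketbra_unit_vec)

text \<open>Decryption after the key unitary has been undone. For the canonical scheme this part is
  the same for every key, so it can be moved out of the key average.\<close>

definition decode :: "nat \<Rightarrow> nat \<Rightarrow> complex mat \<Rightarrow> complex mat" where
  "decode d e Y = conj_by (msg_embed d) (ptrace2 d e (conj_by (1\<^sub>m d \<otimes>\<^sub>k mat_unit e 0 0) Y))
     + mtrace (conj_by (1\<^sub>m d \<otimes>\<^sub>k (1\<^sub>m e - mat_unit e 0 0)) Y) \<cdot>\<^sub>m bot_state d"

lemma linear_superop_decode: "linear_superop (d * e) (d + 1) (decode d e)"
  unfolding decode_def
proof (rule linear_superop_plus)
  have 1: "1\<^sub>m d \<otimes>\<^sub>k mat_unit e 0 0 \<in> carrier_mat (d * e) (d * e)" by auto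
  show "linear_superop (d * e) (d + 1) (\<lambda>Y. conj_by (msg_embed d)
      (ptrace2 d e (conj_by (1\<^sub>m d \<otimes>\<^sub>k mat_unit e 0 0) Y)))"
    by (intro linear_superop_comp[OF linear_superop_conj_by[OF msg_embed_carrier]]
        linear_superop_comp[OF linear_superop_ptrace2] linear_superop_conj_by 1)
  have 2: "1\<^sub>m d \<otimes>\<^sub>k (1\<^sub>m e - mat_unit e 0 0) \<in> carrier_mat (d * e) (d * e)"
    by (intro kron_carrier) (auto simp: minus_carrier_mat)
  have 3: "bot_state d \<in> carrier_mat (d + 1) (d + 1)" by (simp add: bot_state_eq)
  show "linear_superop (d * e) (d + 1) (\<lambda>Y. mtrace (conj_by (1\<^sub>m d \<otimes>\<^sub>k (1\<^sub>m e - mat_unit e 0 0)) Y)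
      \<cdot>\<^sub>m bot_state d)"
    by (rule linear_superop_comp[OF linear_superop_mtrace[OF 3] linear_superop_conj_by[OF 2]])
qed

lemma decode_kron:
  assumes "A \<in> carrier_mat d d" "B \<in> carrier_mat e e" "0 < e"
  shows "decode d e (A \<otimes>\<^sub>k B) = B $$ (0, 0) \<cdot>\<^sub>m conj_by (msg_embed d) A
    + (mtrace A * (mtrace B - B $$ (0, 0))) \<cdot>\<^sub>m bot_state d"
proof -
  have M: "1\<^sub>m e - mat_unit e 0 0 \<in> carrier_mat e e" by (simp add: minus_carrier_mat)
  have cu: "conj_by (mat_unit e 0 0) B \<in> carrier_mat e e" "conj_by (1\<^sub>m e - mat_unit e 0 0) B
      \<in> carrier_mat e e"
    using assms M by auto
  have "conj_by (1\<^sub>m d \<otimes>\<^sub>k mat_unit e 0 0) (A \<otimes>\<^sub>k B) = A \<otimes>\<^sub>k conj_by (mat_unit e 0 0) B"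
    "conj_by (1\<^sub>m d \<otimes>\<^sub>k (1\<^sub>m e - mat_unit e 0 0)) (A \<otimes>\<^sub>k B) = A
        \<otimes>\<^sub>k conj_by (1\<^sub>m e - mat_unit e 0 0) B"
    using assms M by (simp_all add: conj_by_kron[of _ d d _ e e] conj_by_one)
  then show ?thesis
    unfolding decode_def using assms cu
    by (simp add: ptrace2_kron mtrace_kron mtrace_conj_by_unit conj_by_smult[OF msg_embed_carrier])
qed

lemma one_smult_mat: "1 \<cdot>\<^sub>m A = (A :: complex mat)"
  by (rule eq_matI) auto

lemma kraus_one: "kraus b I (\<lambda>_. 1) G X = mat_sum b I (\<lambda>x. conj_by (G x) X)"
  by (simp add: kraus_def one_smult_mat)

text \<open>The operator |bot><x|. Over all messages \<open>x\<close> these are Kraus operators of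
  the map that discards a message and outputs the reject state.\<close>

definition bot_op :: "nat \<Rightarrow> nat \<Rightarrow> complex mat" where
  "bot_op d x = mat (d + 1) d (\<lambda>(i, j). if i = d \<and> j = x then 1 else 0)"

lemma bot_op_carrier [simp, intro]: "bot_op d x \<in> carrier_mat (d + 1) d"
  by (simp add: bot_op_def)

lemma mtrace_bot_state:
  assumes "F \<in> carrier_mat d d"
  shows "mtrace F \<cdot>\<^sub>m bot_state d = mat_sum (d + 1) {..<d} (\<lambda>x. conj_by (bot_op d x) F)"
      (is "?L = ?R")
proof (rule eq_mat_carrierI[of _ "d + 1" "d + 1"])
  fix i j assume ij: "i < d + 1" "j < d + 1"
  have "conj_by (bot_op d x) F $$ (i, j) = (if i = d \<and> j = d then F $$ (x, x) else 0)" if "x < d"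
      for x
  proof -
    have "conj_by (bot_op d x) F $$ (i, j) = (\<Sum>k<d. \<Sum>l<d. if l = x then if k = x then
        if i = d \<and> j = d then F $$ (x, x) else 0 else 0 else 0)"
      unfolding conj_by_index[OF bot_op_carrier assms ij] using ij
      by (intro sum.cong refl) (auto simp: bot_op_def)
    then show ?thesis using that by simp
  qed
  then have "?R $$ (i, j) = (if i = d \<and> j = d then mtrace F else 0)"
    using ij assms by (cases "i = d \<and> j = d") (auto simp: mtrace_def)
  then show "?L $$ (i, j) = ?R $$ (i, j)"
    using ij by (simp add: bot_state_eq)
qed (simp_all add: bot_state_eq)

lemma bot_op_gram: "mat_adjoint (bot_op d x) * bot_op d x = mat_unit d x x"
proof (rule eq_mat_carrierI[of _ d d])
  fix i j assume ij: "i < d" "j < d"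
  have c: "mat_adjoint (bot_op d x) \<in> carrier_mat d (d + 1)"
    by (rule mat_adjoint_carrier[OF bot_op_carrier])
  have "(mat_adjoint (bot_op d x) * bot_op d x) $$ (i, j)
      = (\<Sum>k<d + 1. if k = d then if i = x \<and> j = x then 1 else 0 else 0)"
    unfolding mult_mat_index[OF c bot_op_carrier ij] using ij
    by (intro sum.cong refl) (auto simp: bot_op_def)
  then show "(mat_adjoint (bot_op d x) * bot_op d x) $$ (i, j) = mat_unit d x x $$ (i, j)" using ij
    by simp
qed (use mult_carrier_mat[OF mat_adjoint_carrier[OF bot_op_carrier] bot_op_carrier] in \<open>simp_all
    add: bot_op_def\<close>)

lemma sum_mat_unit: "mat_sum d {..<d} (\<lambda>x. mat_unit d x x) = 1\<^sub>m d"
proof (rule eq_matI)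
  fix i j assume ij: "i < dim_row (1\<^sub>m d :: complex mat)" "j < dim_col (1\<^sub>m d :: complex mat)"
  then have "mat_sum d {..<d} (\<lambda>x. mat_unit d x x) $$ (i, j)
      = (\<Sum>x<d. if x = i then if i = j then 1 else 0 else 0)"
    by simp
  then show "mat_sum d {..<d} (\<lambda>x. mat_unit d x x) $$ (i, j) = 1\<^sub>m d $$ (i, j)" using ij by simp
qed auto

lemma msg_embed_gram: "mat_adjoint (msg_embed d) * msg_embed d = 1\<^sub>m d"
proof (rule eq_mat_carrierI[of _ d d])
  fix i j assume ij: "i < d" "j < d"
  have c: "mat_adjoint (msg_embed d) \<in> carrier_mat d (d + 1)"
    by (rule mat_adjoint_carrier[OF msg_embed_carrier])
  have "(mat_adjoint (msg_embed d) * msg_embed d) $$ (i, j)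
      = (\<Sum>k<d + 1. if k = i then if i = j then 1 else 0 else 0)"
    unfolding mult_mat_index[OF c msg_embed_carrier ij] using ij
    by (intro sum.cong refl) (auto simp: msg_embed_def)
  then show "(mat_adjoint (msg_embed d) * msg_embed d) $$ (i, j) = 1\<^sub>m d $$ (i, j)" using ij by simp
qed (use mult_carrier_mat[OF mat_adjoint_carrier[OF msg_embed_carrier] msg_embed_carrier] in
    \<open>simp_all add: msg_embed_def\<close>)

text \<open>A vanishing row of \<open>M\<close> clears the matching rows and columns of the output
  for any input. This separates messages from the reject state.\<close>

lemma conj_by_kron_zero:
  assumes "A \<in> carrier_mat a a'" "M \<in> carrier_mat b b'" "X \<in> carrier_mat (a' * b') (a' * b')"
    and "p < a * b" "q < a * b"
    and "(\<forall>j<b'. M $$ (p mod b, j) = 0) \<or> (\<forall>j<b'. M $$ (q mod b, j) = 0)"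
  shows "conj_by (A \<otimes>\<^sub>k M) X $$ (p, q) = 0"
proof -
  have z: "(A \<otimes>\<^sub>k M) $$ (i, l) = 0" if "\<forall>j<b'. M $$ (i mod b, j) = 0" "i < a * b" "l < a' * b'"
      for i l
    using that assms(1,2) div_mod_less[OF that(3)] by (auto simp: kron_index)
  show ?thesis
    unfolding conj_by_index[OF kron_carrier[OF assms(1,2)] assms(3,4,5)]
    using assms(6) z[OF _ assms(4)] z[OF _ assms(5)] by (auto intro!: sum.neutral)
qed

text \<open>\<open>X\<close> lives on columns outside \<open>P\<close> and \<open>Y\<close> on rows
  inside \<open>P\<close>, so no intermediate index contributes.\<close>

lemma mult_mat_zero_blocks:
  assumes "X \<in> carrier_mat n n" "Y \<in> carrier_mat n n"
    and "\<And>p s. p < n \<Longrightarrow> s < n \<Longrightarrow> P s \<Longrightarrow> X $$ (p, s) = 0"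
    and "\<And>s q. s < n \<Longrightarrow> q < n \<Longrightarrow> \<not> P s \<Longrightarrow> Y $$ (s, q) = 0"
  shows "X * Y = (0\<^sub>m n n :: complex mat)"
proof (rule eq_mat_carrierI[of _ n n])
  fix i j assume ij: "i < n" "j < n"
  have "X $$ (i, k) * Y $$ (k, j) = 0" if "k < n" for k
    using assms(3)[OF ij(1) that] assms(4)[OF that ij(2)] by (cases "P k") auto
  then show "(X * Y) $$ (i, j) = 0\<^sub>m n n $$ (i, j)"
    using ij by (simp add: mult_mat_index[OF assms(1,2)] sum.neutral del: mult_eq_0_iff)
qed (use assms in auto)

lemma kron3_gram:
  assumes "B \<in> carrier_mat b' b" "M \<in> carrier_mat d' d"
  shows "mat_adjoint (1\<^sub>m c \<otimes>\<^sub>k B \<otimes>\<^sub>k M) * (1\<^sub>m c \<otimes>\<^sub>k B \<otimes>\<^sub>k M)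
    = 1\<^sub>m c \<otimes>\<^sub>k (mat_adjoint B * B) \<otimes>\<^sub>k (mat_adjoint M * M)" (is "?L = _")
proof -
  have "?L
    = (1\<^sub>m c * 1\<^sub>m c) \<otimes>\<^sub>k ((mat_adjoint B \<otimes>\<^sub>k mat_adjoint M) * (B \<otimes>\<^sub>k M))"
    unfolding kron_adjoint mat_adjoint_one using assms by (intro kron_mult) auto
  also have "(mat_adjoint B \<otimes>\<^sub>k mat_adjoint M) * (B \<otimes>\<^sub>k M) = (mat_adjoint B * B)
      \<otimes>\<^sub>k (mat_adjoint M * M)"
    using assms by (intro kron_mult) auto
  finally show ?thesis by simp
qed

lemma mat_sum_kron:
  assumes "B \<in> carrier_mat b b" "\<And>x. x \<in> I \<Longrightarrow> F x \<in> carrier_mat n n"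
  shows "mat_sum n I F \<otimes>\<^sub>k B = mat_sum (n * b) I (\<lambda>x. F x \<otimes>\<^sub>k B)" (is "?L = ?R")
proof (rule eq_mat_pairI[of _ n b n b])
  fix i j k l assume ij: "i < n" "k < b" "j < n" "l < b"
  then have "?R $$ (i * b + k, j * b + l)
      = (\<Sum>x\<in>I. (F x \<otimes>\<^sub>k B) $$ (i * b + k, j * b + l))"
    by (simp add: pair_index_less)
  also have "\<dots> = (\<Sum>x\<in>I. F x $$ (i, j) * B $$ (k, l))"
    using ij assms by (intro sum.cong refl kron_index_pair) auto
  finally show "?L $$ (i * b + k, j * b + l) = ?R $$ (i * b + k, j * b + l)"
    using ij assms by (simp add: kron_index_pair[OF mat_sum_carrier assms(1)] sum_distrib_right)
qed (use assms in auto)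

lemma conj_by_ket: "v \<in> carrier_vec n \<Longrightarrow> conj_by (ket v) (1\<^sub>m 1) = ketbra v"
  using ket_carrier[of v n] by (simp add: conj_by_def ketbra_def)

lemma kraus_index_zero:
  assumes "\<And>x. x \<in> I \<Longrightarrow> G x \<in> carrier_mat b a" "i < b" "j < b"
    and "\<And>x. x \<in> I \<Longrightarrow> conj_by (G x) X $$ (i, j) = 0"
  shows "kraus b I w G X $$ (i, j) = 0"
proof -
  have "(w x \<cdot>\<^sub>m conj_by (G x) X) $$ (i, j) = 0" if "x \<in> I" for x
    using assms(1)[OF that] assms(2,3) assms(4)[OF that] by auto
  then show ?thesis using assms(2,3) by (simp add: kraus_def)
qed

lemma linear_superop_diff:
  assumes "linear_superop a b \<Phi>" "linear_superop a b \<Psi>"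
  shows "linear_superop a b (\<lambda>X. \<Phi> X - \<Psi> X)"
proof (rule linear_superop_cong)
  fix X :: "complex mat" assume X: "X \<in> carrier_mat a a"
  show "\<Phi> X - \<Psi> X = \<Phi> X + (-1) \<cdot>\<^sub>m \<Psi> X"
    using linear_superop_carrier[OF assms(1) X] linear_superop_carrier[OF assms(2) X]
    by (auto intro!: eq_matI)
qed (intro linear_superop_plus linear_superop_scale assms)

lemma tensor_superop_id_diff:
  assumes "linear_superop a b \<Phi>" "linear_superop a b \<Psi>"
  shows "tensor_superop c c a b id (\<lambda>X. \<Phi> X - \<Psi> X) X =
    tensor_superop c c a b id \<Phi> X - tensor_superop c c a b id \<Psi> X" (is "?L = ?R")
proof (rule eq_mat_pairI[of _ c b c b])
  fix u x v y assume i: "u < c" "x < b" "v < c" "y < b"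
  have dims: "dim_row (\<Psi> (mat_unit a k l)) = b" "dim_col (\<Psi> (mat_unit a k l)) = b" for k l
    using linear_superop_carrier[OF assms(2) mat_unit_carrier] by blast+
  show "?L $$ (u * b + x, v * b + y) = ?R $$ (u * b + x, v * b + y)"
    using i carrier_matD[OF tensor_superop_carrier, of c c a b id]
    by (simp add: tensor_superop_id_index[OF linear_superop_diff[OF assms] i(1,3,2,4)]
        tensor_superop_id_index[OF assms(1) i(1,3,2,4)]
            tensor_superop_id_index[OF assms(2) i(1,3,2,4)]
        pair_index_less dims right_diff_distrib sum_subtractf del: id_apply)
qed (auto simp: minus_carrier_mat)

section \<open>The canonical scheme\<close>

text \<open>\<open>msg_word k qs\<close> and \<open>tag_word k qs\<close> describe the Pauli on message and tag to which the attack
  Pauli \<open>qs\<close> is pulled back by the code \<open>k\<close>.\<close>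

locale pauli_codes =
  fixes m t d e N :: nat and K :: "'k set" and V :: "'k \<Rightarrow> complex mat"
    and msg_word tag_word :: "'k \<Rightarrow> pauli_string \<Rightarrow> pauli_string"
    and phase :: "'k \<Rightarrow> pauli_string \<Rightarrow> real"
  assumes d: "d = 2 ^ m" and e: "e = 2 ^ t" and N: "N = d * e"
    and finite_K: "finite K" and K_nonempty: "K \<noteq> {}"
    and V_unitary: "k \<in> K \<Longrightarrow> unitary_mat N (V k)"
    and msg_word: "k \<in> K \<Longrightarrow> qs \<in> pauli_words (m + t) \<Longrightarrow> msg_word k qs \<in> pauli_words m"
    and tag_word: "k \<in> K \<Longrightarrow> qs \<in> pauli_words (m + t) \<Longrightarrow> tag_word k qs \<in> pauli_words t"
    and V_conj: "k \<in> K \<Longrightarrow> qs \<in> pauli_words (m + t) \<Longrightarrow> mat_adjoint (V k) * pauli_word qs * V k =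
      cis (phase k qs) \<cdot>\<^sub>m (pauli_word (msg_word k qs) \<otimes>\<^sub>k pauli_word (tag_word k qs))"
begin

abbreviation W where "W \<equiv> pauli_words (m + t)"
abbreviation S where "S \<equiv> canonical_scheme m t K V"

definition U :: "'k \<Rightarrow> pauli_string \<Rightarrow> complex mat" where
  "U k ps = pauli_word ps * V k"

text \<open>By \<open>V_conj\<close> this is the attack Pauli pulled back by the code. The phase is
  kept because the equality is used inside sums, before conjugation cancels it.\<close>

definition Q :: "'k \<Rightarrow> pauli_string \<Rightarrow> complex mat" where
  "Q k qs = cis (phase k qs) \<cdot>\<^sub>m (pauli_word (msg_word k qs) \<otimes>\<^sub>k pauli_word (tag_word k qs))"

definition tag_ok :: "'k \<Rightarrow> pauli_string \<Rightarrow> bool" where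
  "tag_ok k qs \<longleftrightarrow> (\<forall>(x, z)\<in>set (tag_word k qs). \<not> x)"

definition msg_ok :: "'k \<Rightarrow> pauli_string \<Rightarrow> bool" where
  "msg_ok k qs \<longleftrightarrow> (\<forall>(x, z)\<in>set (msg_word k qs). \<not> x \<and> \<not> z)"

lemma pos: "0 < d" "0 < e" "0 < N"
  by (simp_all add: d e N)

lemma N_power: "2 ^ (m + t) = N"
  by (simp add: d e N power_add)

lemma word_carrier: "qs \<in> W \<Longrightarrow> pauli_word qs \<in> carrier_mat N N"
  using pauli_word_carrier[of qs "m + t"] by (simp add: N_power)

lemma msg_carrier: "k \<in> K \<Longrightarrow> qs \<in> W \<Longrightarrow> pauli_word (msg_word k qs) \<in> carrier_mat d d"
  using pauli_word_carrier[OF msg_word] by (simp add: d)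

lemma tag_carrier: "k \<in> K \<Longrightarrow> qs \<in> W \<Longrightarrow> pauli_word (tag_word k qs) \<in> carrier_mat e e"
  using pauli_word_carrier[OF tag_word] by (simp add: e)

lemma V_carrier: "k \<in> K \<Longrightarrow> V k \<in> carrier_mat N N"
  using V_unitary by (simp add: unitary_mat_def)

lemma U_carrier: "k \<in> K \<Longrightarrow> ps \<in> W \<Longrightarrow> U k ps \<in> carrier_mat N N"
  unfolding U_def using word_carrier V_carrier by (rule mult_carrier_mat)

lemma Q_carrier: "k \<in> K \<Longrightarrow> qs \<in> W \<Longrightarrow> Q k qs \<in> carrier_mat N N"
  unfolding Q_def N by (intro smult_carrier_mat kron_carrier msg_carrier tag_carrier)

lemma msg_trace: "k \<in> K \<Longrightarrow> qs \<in> W \<Longrightarrow> mtrace (pauli_word (msg_word k qs))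
    = (if msg_ok k qs then of_nat d else 0)"
proof -
  assume k: "k \<in> K" "qs \<in> W"
  show ?thesis
  proof (cases "msg_ok k qs")
    case True
    then have "pauli_word (msg_word k qs) = 1\<^sub>m d"
      using pauli_word_one[of "msg_word k qs"] msg_word[OF k]
      by (simp add: msg_ok_def d pauli_words_def)
    then show ?thesis using True by (simp add: mtrace_def)
  next
    case False
    then have "\<exists>(x, z)\<in>set (msg_word k qs). x \<or> z" unfolding msg_ok_def by auto
    then show ?thesis using mtrace_pauli_word False by simp
  qed
qed

lemma msg_ok_one: "k \<in> K \<Longrightarrow> qs \<in> W \<Longrightarrow> msg_ok k qs \<Longrightarrow> pauli_word (msg_word k qs) = 1\<^sub>m d"
  using pauli_word_one[of "msg_word k qs"] msg_word[of k qs]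
  by (simp add: msg_ok_def d pauli_words_def)

lemma tag_index_00: "pauli_word (tag_word k qs) $$ (0, 0) = (if tag_ok k qs then 1 else 0)"
  unfolding pauli_word_index_00 tag_ok_def by (auto simp: case_prod_beta)

lemma U_unitary: "k \<in> K \<Longrightarrow> ps \<in> W \<Longrightarrow> unitary_mat N (U k ps)"
proof -
  assume k: "k \<in> K" "ps \<in> W"
  have c: "V k \<in> carrier_mat N N" "pauli_word ps \<in> carrier_mat N N"
    "mat_adjoint (V k) \<in> carrier_mat N N" "mat_adjoint (pauli_word ps) \<in> carrier_mat N N"
    using V_carrier word_carrier k by auto
  have V: "mat_adjoint (V k) * V k = 1\<^sub>m N" "V k * mat_adjoint (V k) = 1\<^sub>m N"
    using V_unitary[OF k(1)] by (auto simp: unitary_mat_def)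
  note P = unitary_pauli_word[OF k(2), unfolded N_power]
  have adj: "mat_adjoint (U k ps) = mat_adjoint (V k) * mat_adjoint (pauli_word ps)"
    unfolding U_def by (rule mat_adjoint_mult[OF c(2,1)])
  have "mat_adjoint (U k ps) * U k ps = mat_adjoint (V k)
      * (mat_adjoint (pauli_word ps) * pauli_word ps) * V k"
    unfolding adj unfolding U_def using c by (simp add: assoc_mult_mat[of _ N N _ N _ N]
        mult_carrier_mat[of _ N N _ N] del: assoc_mult_mat)
  also have "\<dots> = 1\<^sub>m N" using c V P by simp
  finally have 1: "mat_adjoint (U k ps) * U k ps = 1\<^sub>m N" .
  have "U k ps * mat_adjoint (U k ps) = pauli_word ps * (V k * mat_adjoint (V k))
      * mat_adjoint (pauli_word ps)"
    unfolding adj unfolding U_def using c by (simp add: assoc_mult_mat[of _ N N _ N _ N]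
        mult_carrier_mat[of _ N N _ N] del: assoc_mult_mat)
  also have "\<dots> = 1\<^sub>m N" using c V P by simp
  finally show ?thesis using 1 U_carrier[OF k] by (simp add: unitary_mat_def)
qed

text \<open>The Pauli key contributes only a sign and the code only \<open>Q k qs\<close>. This
  separation is what makes the sum over \<open>ps\<close> a twirl.\<close>

lemma U_conj:
  assumes "k \<in> K" "ps \<in> W" "qs \<in> W"
  shows "conj_by (mat_adjoint (U k ps)) (pauli_word qs) = pauli_sign ps qs \<cdot>\<^sub>m Q k qs" (is "?L = _")
proof -
  have c: "V k \<in> carrier_mat N N" "pauli_word ps \<in> carrier_mat N N" "pauli_word qs
      \<in> carrier_mat N N"
    "mat_adjoint (V k) \<in> carrier_mat N N" "mat_adjoint (pauli_word ps) \<in> carrier_mat N N"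
    using V_carrier word_carrier assms by auto
  have "mat_adjoint (U k ps) = mat_adjoint (V k) * mat_adjoint (pauli_word ps)"
    unfolding U_def by (rule mat_adjoint_mult[OF c(2,1)])
  then have "?L
    = mat_adjoint (V k) * (mat_adjoint (pauli_word ps) * pauli_word qs * pauli_word ps) * V k"
    unfolding conj_by_def mat_adjoint_adjoint U_def using c
    by (simp add: assoc_mult_mat[of _ N N _ N _ N] mult_carrier_mat[of _ N N _ N] del:
        assoc_mult_mat)
  also have "\<dots> = pauli_sign ps qs \<cdot>\<^sub>m (mat_adjoint (V k) * pauli_word qs * V k)"
    unfolding pauli_word_conj[OF assms(2,3)] using c
    by (simp add: mult_smult_distrib[of _ N N _ N] mult_smult_assoc_mat[of _ N N _ N]
        mult_carrier_mat[of _ N N _ N])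
  finally show ?thesis by (simp add: V_conj assms Q_def)
qed

section \<open>The canonical scheme in terms of Pauli words\<close>

lemma scheme_simps [simp]:
  "msg_dim S = d" "tag_dim S = e" "tag_num S k = 1" "tag_prob S k s = 1" "tag_vec S k s
      = unit_vec e 0"
  "keys S = K \<times> pauli_index (m + t)"
  by (simp_all add: canonical_scheme_def d e)

lemma enc_unitary_eq: "enc_unitary S (k, l) = U k (zip (take (m + t) l) (drop (m + t) l))"
  by (simp add: canonical_scheme_def U_def pauli_eq_word)

lemma tag_state_eq: "tag_state S k = mat_unit e 0 0"
  unfolding tag_state_def using pos(2) by (auto simp: ketbra_unit_vec intro!: eq_matI)

lemma proj_acc_eq: "proj_acc S k = mat_unit e 0 0"
proof -
  have "mat_unit e 0 0 * mat_unit e 0 0 = mat_unit e 0 0"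
  proof (rule eq_mat_carrierI[of _ e e])
    fix i j assume ij: "i < e" "j < e"
    have "(mat_unit e 0 0 * mat_unit e 0 0) $$ (i, j)
        = (\<Sum>k<e. if k = 0 then if i = 0 \<and> j = 0 then 1 else 0 else 0)"
      unfolding mult_mat_index[OF mat_unit_carrier mat_unit_carrier ij]
      using ij by (intro sum.cong refl) simp
    then show "(mat_unit e 0 0 * mat_unit e 0 0) $$ (i, j) = mat_unit e 0 0 $$ (i, j)" using ij pos
      by simp
  qed auto
  moreover have "mat_adjoint (mat_unit e 0 0) = mat_unit e 0 0" by (auto intro!: eq_matI)
  ultimately show ?thesis
    unfolding proj_acc_def tag_state_eq by (simp add: support_proj_projector)
qed

lemma key_word: "l \<in> pauli_index (m + t) \<Longrightarrow> zip (take (m + t) l) (drop (m + t) l) \<in> W"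
  using bij_betw_pauli_words[of "m + t"] by (auto simp: bij_betw_def)

lemma decrypt_eq: "decrypt S (k, l) X =
    decode d e (conj_by (mat_adjoint (U k (zip (take (m + t) l) (drop (m + t) l)))) X)"
  unfolding decrypt_def Let_def proj_rej_def proj_acc_eq enc_unitary_eq by (simp add: decode_def)

lemma encrypt_eq: "encrypt S (k, l) X = conj_by (U k (zip (take (m + t) l) (drop (m + t) l)))
    (X \<otimes>\<^sub>k mat_unit e 0 0)"
  by (simp add: encrypt_def enc_unitary_eq tag_state_eq)

text \<open>Recoding Pauli indices as words is a bijection, so neither the summands nor the count in
  the denominator change.\<close>

lemma mat_avg_keys:
  assumes "\<And>k l. k \<in> K \<Longrightarrow> l \<in> pauli_index (m + t) \<Longrightarrow> F (k, l)
      = F' (k, zip (take (m + t) l) (drop (m + t) l))"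
  shows "mat_avg b (keys S) F = mat_avg b (K \<times> W) F'"
proof -
  let ?h = "\<lambda>(k, l). (k, zip (take (m + t) l) (drop (m + t) l))"
  have b: "bij_betw ?h (K \<times> pauli_index (m + t)) (K \<times> W)"
  proof -
    note h = bij_betw_pauli_words[of "m + t"]
    have "inj_on ?h (K \<times> pauli_index (m + t))"
      using bij_betw_imp_inj_on[OF h] by (auto intro!: inj_onI dest: inj_onD)
    moreover have "?h ` (K \<times> pauli_index (m + t)) = K \<times> W"
      unfolding bij_betw_imp_surj_on[OF h, symmetric] by (auto simp: image_iff)
    ultimately show ?thesis by (simp add: bij_betw_def)
  qed
  have "mat_sum b (K \<times> W) F' = mat_sum b (K \<times> pauli_index (m + t)) (\<lambda>x. F' (?h x))"
    using b mat_sum_reindex[of ?h "K \<times> pauli_index (m + t)" b F'] by (simp add: bij_betw_def)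
  also have "\<dots> = mat_sum b (keys S) F"
    using assms by (intro mat_sum_cong) auto
  finally show ?thesis using bij_betw_same_card[OF b] by (simp add: mat_avg_def)
qed

lemma is_scheme_canonical: "is_scheme S"
proof -
  have "finite (pauli_index (m + t))"
    using bij_betw_finite[OF bij_betw_pauli_words[of "m + t"]] by simp
  moreover have "pauli_index (m + t) \<noteq> {}"
    using bij_betw_pauli_words[of "m + t"] pauli_words_nonempty[of "m + t"]
    by (auto simp: bij_betw_def)
  moreover have "unit_vec e 0 \<bullet>c unit_vec e 0 = (1 :: complex)"
    using pos(2) by (simp add: scalar_prod_left_unit[of _ e])
  ultimately show ?thesis
    using finite_K K_nonempty pos U_unitary key_word
    by (auto simp: is_scheme_def enc_unitary_eq simp flip: N)
qed

end

section \<open>Attacks on the canonical scheme\<close>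

text \<open>Complete positivity of the attack enters as a Kraus family, trace preservation as a
  condition on the map itself; \<open>pauli_coeff_complete\<close> transfers the latter to the
  coefficients on R.\<close>

locale attacked_codes = pauli_codes m t d e N K V msg_word tag_word phase
  for m t d e N :: nat and K :: "'k set" and V msg_word tag_word phase +
  fixes r p :: nat and A :: "complex mat \<Rightarrow> complex mat" and G :: "nat \<Rightarrow> complex mat"
  assumes G_carrier: "s < p \<Longrightarrow> G s \<in> carrier_mat (r * N) (r * N)"
    and A_kraus: "X \<in> carrier_mat (r * N) (r * N) \<Longrightarrow> A X = kraus (r * N) {..<p} (\<lambda>_. 1) G X"
    and A_trace: "X \<in> carrier_mat (r * N) (r * N) \<Longrightarrow> mtrace (A X) = mtrace X"
begin

section \<open>The attack in terms of its Pauli coefficients\<close>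

definition C :: "nat \<Rightarrow> pauli_string \<Rightarrow> complex mat" where
  "C s qs = pauli_coeff r (m + t) (G s) qs"

abbreviation J where "J \<equiv> K \<times> {..<p} \<times> W"
abbreviation cK :: complex where "cK \<equiv> 1 / of_nat (card K)"

lemma C_carrier [simp, intro]: "C s qs \<in> carrier_mat r r"
  by (simp add: C_def)

lemma C_dim [simp]: "dim_row (C s qs) = r" "dim_col (C s qs) = r"
  using C_carrier[of s qs] by blast+

lemma finite_J [simp]: "finite J"
  using finite_K by simp

lemma C_complete: "mat_sum r ({..<p} \<times> W) (\<lambda>(s, qs). mat_adjoint (C s qs) * C s qs) = 1\<^sub>m r"
  unfolding C_def using G_carrier A_kraus A_trace
  by (intro pauli_coeff_complete) (auto simp: N_power)

lemma G_expansion: "s < p \<Longrightarrow> G s = mat_sum (r * N) W (\<lambda>qs. C s qs \<otimes>\<^sub>k pauli_word qs)"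
  unfolding C_def using pauli_expansion[of "G s" r "m + t"] G_carrier by (simp add: N_power)

text \<open>A Kraus operator seen through the key unitary has the shape required by
  \<open>pauli_twirl\<close>: signs depending on \<open>ps\<close> times operators that do
  not.\<close>

lemma G_conj:
  assumes "k \<in> K" "ps \<in> W" "s < p"
  shows "conj_by (mat_adjoint (1\<^sub>m r \<otimes>\<^sub>k U k ps)) (G s)
    = mat_sum (r * N) W (\<lambda>qs. pauli_sign ps qs \<cdot>\<^sub>m (C s qs \<otimes>\<^sub>k Q k qs))" (is "_ = ?R")
proof -
  let ?T = "1\<^sub>m r \<otimes>\<^sub>k U k ps"
  have U: "?T \<in> carrier_mat (r * N) (r * N)" using U_carrier assms by auto
  have "conj_by (mat_adjoint ?T) (G s)
    = mat_sum (r * N) W (\<lambda>qs. conj_by (mat_adjoint ?T) (C s qs \<otimes>\<^sub>k pauli_word qs))"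
    unfolding G_expansion[OF assms(3)] using U word_carrier by (intro conj_by_mat_sum) auto
  also have "\<dots> = ?R"
  proof (intro mat_sum_cong refl)
    fix qs assume qs: "qs \<in> W"
    show "conj_by (mat_adjoint ?T) (C s qs \<otimes>\<^sub>k pauli_word qs) = pauli_sign ps qs
        \<cdot>\<^sub>m (C s qs \<otimes>\<^sub>k Q k qs)"
      unfolding kron_adjoint mat_adjoint_one
      using U_carrier[OF assms(1,2)] word_carrier[OF qs]
      by (simp add: conj_by_kron[of _ r r _ N N] conj_by_one U_conj[OF assms(1,2) qs]
          kron_smult_right)
  qed
  finally show ?thesis .
qed

abbreviation real_out where
  "real_out k qs F \<equiv> if tag_ok k qs then conj_by (msg_embed d * pauli_word (msg_word k qs)) F else
      mtrace F \<cdot>\<^sub>m bot_state d"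

abbreviation ideal_out where
  "ideal_out k qs F \<equiv> if tag_ok k qs \<and> msg_ok k qs then conj_by (msg_embed d) F else mtrace F
      \<cdot>\<^sub>m bot_state d"

text \<open>A Pauli sends |0^t> to a basis vector up to phase, so the tag is accepted with weight
  exactly 0 or 1. The phase of \<open>Q\<close> cancels, and the message Pauli preserves the trace
  passed on to the reject branch.\<close>

lemma decode_Q:
  assumes "k \<in> K" "qs \<in> W" "F \<in> carrier_mat d d"
  shows "decode d e (conj_by (Q k qs) (F \<otimes>\<^sub>k mat_unit e 0 0)) =
    real_out k qs F"
proof -
  let ?P = "pauli_word (msg_word k qs)" and ?T = "pauli_word (tag_word k qs)"
  have c: "?P \<in> carrier_mat d d" "?T \<in> carrier_mat e e" using msg_carrier tag_carrier assms by auto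
  have cF: "conj_by ?P F \<in> carrier_mat d d" "conj_by ?T (mat_unit e 0 0) \<in> carrier_mat e e"
    using c assms by auto
  have "cis (phase k qs) * cnj (cis (phase k qs)) = 1" by (simp add: cis_cnj cis_mult)
  then have "conj_by (Q k qs) (F \<otimes>\<^sub>k mat_unit e 0 0) = conj_by (?P \<otimes>\<^sub>k ?T) (F \<otimes>\<^sub>k mat_unit e 0 0)"
    unfolding Q_def using c assms(3)
    by (subst conj_by_smult_left[of _ "d * e" "d * e"]) (auto simp: one_smult_mat)
  also have "\<dots> = conj_by ?P F \<otimes>\<^sub>k conj_by ?T (mat_unit e 0 0)"
    using c assms by (intro conj_by_kron) auto
  finally have 1: "conj_by (Q k qs) (F \<otimes>\<^sub>k mat_unit e 0 0) = conj_by ?P F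
      \<otimes>\<^sub>k conj_by ?T (mat_unit e 0 0)" .
  have 2: "conj_by ?T (mat_unit e 0 0) $$ (0, 0) = (if tag_ok k qs then 1 else 0)"
  proof -
    have "conj_by ?T (mat_unit e 0 0) $$ (0, 0)
        = (\<Sum>k'<e. \<Sum>l<e. if l = 0 then if k' = 0 then ?T $$ (0, 0)
        * cnj (?T $$ (0, 0)) else 0 else 0)"
      unfolding conj_by_index[OF c(2) mat_unit_carrier pos(2) pos(2)] by (intro sum.cong refl) auto
    then show ?thesis using pos by (simp add: tag_index_00)
  qed
  have tr: "mtrace (conj_by B Y) = mtrace Y" if "mat_adjoint B * B = 1\<^sub>m n" "B \<in> carrier_mat n n" "Y
      \<in> carrier_mat n n" for B Y n
    using mtrace_conj_by_isometry[of B n n "1\<^sub>m n" n Y] that by (simp add: conj_by_one)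
  have 3: "mtrace (conj_by ?P F) = mtrace F" "mtrace (conj_by ?T (mat_unit e 0 0))
      = mtrace (mat_unit e 0 0)"
    using unitary_pauli_word(1)[OF msg_word[OF assms(1,2)]]
        unitary_pauli_word(1)[OF tag_word[OF assms(1,2)]] c assms
    by (auto intro!: tr simp flip: d e)
  have "mtrace (mat_unit e 0 0) = (\<Sum>i<e. if i = 0 then 1 else 0)"
    unfolding mtrace_def by (intro sum.cong) auto
  then have 4: "mtrace (mat_unit e 0 0) = 1" using pos by simp
  have "conj_by (msg_embed d) (conj_by ?P F) = conj_by (msg_embed d * ?P) F"
    using c assms by (intro conj_by_conj_by[OF msg_embed_carrier]) auto
  moreover have "conj_by (msg_embed d * ?P) F \<in> carrier_mat (d + 1) (d + 1)"
    by (rule conj_by_carrier[OF mult_carrier_mat[OF msg_embed_carrier c(1)] assms(3)])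
  ultimately show ?thesis
    unfolding 1 decode_kron[OF cF pos(2)] 2 3 4 
    by (auto simp: bot_state_eq intro!: eq_matI)
qed

text \<open>The key unitaries are first moved from encryption and decryption onto the Kraus
  operators. What surrounds these, the input \<open>X\<close> and the decoder \<open>D\<close>, is
  then key independent, so \<open>D\<close> leaves the average and the twirl applies inside.\<close>

lemma real_map_kron:
  assumes E: "E \<in> carrier_mat r r" and F: "F \<in> carrier_mat d d"
  shows "real_map S r A (E \<otimes>\<^sub>k F) = mat_sum (r * (d + 1)) J
      (\<lambda>(k, s, qs). cK \<cdot>\<^sub>m (conj_by (C s qs) E \<otimes>\<^sub>k
    real_out k qs F))" (is "?L = ?R")
proof -
  define X where "X = E \<otimes>\<^sub>k (F \<otimes>\<^sub>k mat_unit e 0 0)"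
  have X: "X \<in> carrier_mat (r * N) (r * N)" unfolding X_def N using E F by auto
  define D where "D = tensor_superop r r N (d + 1) id (decode d e)"
  have lin_dec: "linear_superop N (d + 1) (decode d e)" unfolding N by (rule linear_superop_decode)
  have lin_D: "linear_superop (r * N) (r * (d + 1)) D"
    unfolding D_def by (rule linear_superop_tensor[OF linear_superop_id lin_dec])
  let ?Y = "\<lambda>k ps. mat_sum (r * N) {..<p} (\<lambda>s. conj_by
      (mat_sum (r * N) W (\<lambda>qs. pauli_sign ps qs \<cdot>\<^sub>m (C s qs \<otimes>\<^sub>k Q k qs))) X)"
  have trm: "tensor_superop r r (d * e) (d + 1) id (decrypt S (k, l))
      (A (tensor_superop r r d (d * e) id (encrypt S (k, l)) (E \<otimes>\<^sub>k F))) = D (?Y k ps)"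
    if k: "k \<in> K" and l: "l \<in> pauli_index (m + t)" and ps: "ps
        = zip (take (m + t) l) (drop (m + t) l)" for k l ps
  proof -
    have psW: "ps \<in> W" using key_word[OF l] ps by simp
    let ?T = "1\<^sub>m r \<otimes>\<^sub>k U k ps"
    let ?dec = "decrypt S (k, l)"
    let ?enc = "encrypt S (k, l)"
    let ?E = "\<lambda>i j x y. mat_unit r i j \<otimes>\<^sub>k mat_unit N x y"
    have U: "U k ps \<in> carrier_mat N N" using U_carrier k psW by auto
    have U1: "?T \<in> carrier_mat (r * N) (r * N)" "mat_adjoint ?T \<in> carrier_mat (r * N) (r * N)"
      using U by auto
    have enc: "?enc = (\<lambda>X. conj_by (U k ps) (X \<otimes>\<^sub>k mat_unit e 0 0))"
      by (rule ext) (simp add: encrypt_eq ps)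
    have "linear_superop d N ?enc"
      unfolding enc using linear_superop_comp[OF linear_superop_conj_by[OF U]
          linear_superop_kron_right[OF mat_unit_carrier, of d e 0 0, folded N]] .
    then have "tensor_superop r r d N id ?enc (E \<otimes>\<^sub>k F) = E
        \<otimes>\<^sub>k conj_by (U k ps) (F \<otimes>\<^sub>k mat_unit e 0 0)"
      using tensor_superop_kron[OF linear_superop_id _ E F] by (simp add: enc)
    also have "\<dots> = conj_by ?T X"
    proof -
      have "F \<otimes>\<^sub>k mat_unit e 0 0 \<in> carrier_mat N N" unfolding N using F by auto
      then show ?thesis using E U by (simp add: X_def conj_by_kron[of _ r r _ N N] conj_by_one)
    qed
    finally have 1: "tensor_superop r r d N id ?enc (E \<otimes>\<^sub>k F) = conj_by ?T X" .
    have 2: "A (conj_by ?T X) = mat_sum (r * N) {..<p} (\<lambda>s. conj_by (G s) (conj_by ?T X))"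
        (is "_ = ?Z")
      using X U1 by (subst A_kraus) (auto simp: kraus_one)
    have Z: "?Z \<in> carrier_mat (r * N) (r * N)" by simp
    have dec: "?dec = (\<lambda>X. decode d e (conj_by (mat_adjoint (U k ps)) X))"
      by (rule ext) (simp add: decrypt_eq ps)
    have U': "mat_adjoint (U k ps) \<in> carrier_mat N N" using U by auto
    have lin_decr: "linear_superop N (d + 1) ?dec"
      unfolding dec by (rule linear_superop_comp[OF lin_dec linear_superop_conj_by[OF U']])
    \<comment> \<open>\<open>?Z\<close> is in general not a product operator, so the unitary is
      taken out of the decryption by linearity from products of matrix units.\<close>
    have "tensor_superop r r N (d + 1) id ?dec ?Z = D (conj_by (mat_adjoint ?T) ?Z)"
    proof (rule linear_superop_eq_kronI[OF linear_superop_tensor[OF linear_superop_id lin_decr]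
        linear_superop_comp[OF lin_D linear_superop_conj_by[OF U1(2)]] _ Z])
      fix i j x y
      have "tensor_superop r r N (d + 1) id ?dec (?E i j x y)
        = mat_unit r i j \<otimes>\<^sub>k decode d e (conj_by (mat_adjoint (U k ps)) (mat_unit N x y))"
        using tensor_superop_kron[OF linear_superop_id lin_decr mat_unit_carrier mat_unit_carrier]
        by (simp add: dec)
      also have "\<dots> = D (mat_unit r i j \<otimes>\<^sub>k conj_by (mat_adjoint (U k ps)) (mat_unit N x y))"
        unfolding D_def using U' by (subst tensor_superop_kron[OF linear_superop_id lin_dec]) auto
      also have "mat_unit r i j \<otimes>\<^sub>k conj_by (mat_adjoint (U k ps)) (mat_unit N x y)
        = conj_by (mat_adjoint ?T) (?E i j x y)"
        unfolding kron_adjoint mat_adjoint_one using U'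
        by (simp add: conj_by_kron[of _ r r _ N N] conj_by_one)
      finally show "tensor_superop r r N (d + 1) id ?dec (?E i j x y)
        = D (conj_by (mat_adjoint ?T) (?E i j x y))" .
    qed
    also have "conj_by (mat_adjoint ?T) ?Z
      = mat_sum (r * N) {..<p} (\<lambda>s. conj_by (mat_adjoint ?T) (conj_by (G s) (conj_by ?T X)))"
      using U1 X G_carrier by (intro conj_by_mat_sum) (auto intro!: conj_by_carrier)
    also have "\<dots> = ?Y k ps"
      using U1 X G_carrier k psW by (intro mat_sum_cong refl)
          (subst conj_by_sandwich, auto simp: G_conj)
    finally show ?thesis by (simp only: N[symmetric] 1 2)
  qed
  have "?L = mat_avg (r * (d + 1)) (keys S) (\<lambda>k. tensor_superop r r (d * e) (d + 1) id (decrypt S k)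
      (A (tensor_superop r r d (d * e) id (encrypt S k) (E \<otimes>\<^sub>k F))))"
    by (simp add: real_map_def Let_def)
  also have "\<dots> = mat_avg (r * (d + 1)) (K \<times> W) (\<lambda>(k, ps). D (?Y k ps))"
    by (rule mat_avg_keys) (simp only: trm[OF _ _ refl] prod.case)
  also have "\<dots> = mat_avg (r * (d + 1)) (K \<times> W) (\<lambda>q. D ((\<lambda>(k, ps). ?Y k ps) q))"
    by (rule arg_cong[where f = "mat_avg (r * (d + 1)) (K \<times> W)"], rule ext)
        (simp only: case_prod_beta)
  also have "\<dots> = D (mat_avg (r * N) (K \<times> W) (\<lambda>(k, ps). ?Y k ps))"
    using finite_K by (intro linear_superop_mat_avg[OF lin_D, symmetric]) auto
  also have "mat_avg (r * N) (K \<times> W) (\<lambda>(k, ps). ?Y k ps)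
    = kraus (r * N) J (\<lambda>_. cK) (\<lambda>(k, s, qs). C s qs \<otimes>\<^sub>k Q k qs) X"
    using X Q_carrier by (intro mat_avg_pauli_twirl) auto
  also have "D \<dots> = mat_sum (r * (d + 1)) J (\<lambda>x. D
      (cK \<cdot>\<^sub>m conj_by ((\<lambda>(k, s, qs). C s qs \<otimes>\<^sub>k Q k qs) x) X))"
  proof -
    have "conj_by (C s qs \<otimes>\<^sub>k Q k qs) X \<in> carrier_mat (r * N) (r * N)" if "k \<in> K" "qs \<in> W"
        for k s qs
      using conj_by_carrier[OF kron_carrier[OF C_carrier Q_carrier[OF that]] X] .
    then show ?thesis
      unfolding kraus_def by (intro linear_superop_mat_sum[OF lin_D]) (auto simp: finite_K)
  qed
  also have "\<dots> = ?R"
  proof (intro mat_sum_cong refl)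
    fix x assume "x \<in> J"
    then obtain k s qs where x: "x = (k, s, qs)" "k \<in> K" "s < p" "qs \<in> W" by auto
    have Q: "Q k qs \<in> carrier_mat N N" using Q_carrier x by auto
    have F0: "F \<otimes>\<^sub>k mat_unit e 0 0 \<in> carrier_mat N N" unfolding N using F by auto
    have "conj_by (C s qs \<otimes>\<^sub>k Q k qs) X = conj_by (C s qs) E
        \<otimes>\<^sub>k conj_by (Q k qs) (F \<otimes>\<^sub>k mat_unit e 0 0)"
      unfolding X_def using Q F0 E by (intro conj_by_kron) auto
    moreover have "D (conj_by (C s qs) E \<otimes>\<^sub>k conj_by (Q k qs) (F \<otimes>\<^sub>k mat_unit e 0 0))
       = conj_by (C s qs) E \<otimes>\<^sub>k decode d e (conj_by (Q k qs) (F \<otimes>\<^sub>k mat_unit e 0 0))"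
      unfolding D_def using Q F0 E by (subst tensor_superop_kron[OF linear_superop_id lin_dec]) auto
    moreover have "D (cK \<cdot>\<^sub>m conj_by (C s qs \<otimes>\<^sub>k Q k qs) X) = cK
        \<cdot>\<^sub>m D (conj_by (C s qs \<otimes>\<^sub>k Q k qs) X)"
      using conj_by_carrier[OF kron_carrier[OF C_carrier Q] X]
      by (rule linear_superop_smult[OF lin_D])
    ultimately show "D (cK \<cdot>\<^sub>m conj_by ((\<lambda>(k, s, qs). C s qs \<otimes>\<^sub>k Q k qs) x) X)
        = (case x of (k, s, qs) \<Rightarrow> cK \<cdot>\<^sub>m (conj_by (C s qs) E \<otimes>\<^sub>k
      real_out k qs F))"
      using decode_Q[OF x(2,4) F] by (simp add: x(1))
  qed
  finally show ?thesis .
qed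

section \<open>The accepting simulator\<close>

abbreviation probe :: "complex mat" where
  "probe \<equiv> ket (epr d) \<otimes>\<^sub>k ket (unit_vec e 0)"

text \<open>The amplitude with which a pulled back Pauli passes the EPR and tag tests of the simulator.\<close>

definition overlap :: "'k \<Rightarrow> pauli_string \<Rightarrow> complex" where
  "overlap k qs = cis (phase k qs) * (mtrace (pauli_word (msg_word k qs)) / of_nat d
      * pauli_word (tag_word k qs) $$ (0, 0))"

lemma probe_carrier: "probe \<in> carrier_mat (d * N) 1"
proof -
  have "probe \<in> carrier_mat ((d * d) * e) (1 * 1)"
    by (intro kron_carrier ket_carrier) auto
  then show ?thesis by (simp add: N mult.assoc)
qed

text \<open>The two tests act on separate factors: the EPR test yields the normalised trace of the
  message Pauli, the tag test the corner entry of the tag Pauli.\<close>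

lemma probe_conj:
  assumes "k \<in> K" "qs \<in> W"
  shows "conj_by (mat_adjoint probe) (1\<^sub>m d \<otimes>\<^sub>k Q k qs) = overlap k qs \<cdot>\<^sub>m 1\<^sub>m 1" (is "?L = _")
proof -
  let ?P = "pauli_word (msg_word k qs)" and ?T = "pauli_word (tag_word k qs)"
  have c: "?P \<in> carrier_mat d d" "?T \<in> carrier_mat e e" using msg_carrier tag_carrier assms by auto
  have ke: "mat_adjoint (ket (epr d)) \<in> carrier_mat 1 (d * d)" "mat_adjoint (ket (unit_vec e 0))
      \<in> carrier_mat 1 e"
    by (intro mat_adjoint_carrier ket_carrier; simp)+
  have P1: "1\<^sub>m d \<otimes>\<^sub>k ?P \<in> carrier_mat (d * d) (d * d)" using c by auto
  have PT: "(1\<^sub>m d \<otimes>\<^sub>k ?P) \<otimes>\<^sub>k ?T \<in> carrier_mat (d * d * e) (d * d * e)" using P1 c by auto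
  have pr: "mat_adjoint probe \<in> carrier_mat (1 * 1) (d * d * e)" unfolding kron_adjoint
    by (rule kron_carrier[OF ke])
  have "1\<^sub>m d \<otimes>\<^sub>k Q k qs = cis (phase k qs) \<cdot>\<^sub>m ((1\<^sub>m d \<otimes>\<^sub>k ?P) \<otimes>\<^sub>k ?T)"
    by (simp add: Q_def kron_smult_right kron_assoc)
  then have "?L
    = cis (phase k qs) \<cdot>\<^sub>m conj_by (mat_adjoint probe) ((1\<^sub>m d \<otimes>\<^sub>k ?P) \<otimes>\<^sub>k ?T)"
    using conj_by_smult[OF pr PT] by simp
  also have "conj_by (mat_adjoint probe) ((1\<^sub>m d \<otimes>\<^sub>k ?P) \<otimes>\<^sub>k ?T)
    = conj_by (mat_adjoint (ket (epr d))) (1\<^sub>m d \<otimes>\<^sub>k ?P)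
        \<otimes>\<^sub>k conj_by (mat_adjoint (ket (unit_vec e 0))) ?T"
    unfolding kron_adjoint by (rule conj_by_kron[OF ke P1 c(2)])
  also have "conj_by (mat_adjoint (ket (epr d))) (1\<^sub>m d \<otimes>\<^sub>k ?P) = (mtrace ?P / of_nat d) \<cdot>\<^sub>m 1\<^sub>m 1"
    using conj_by_ket_adjoint[OF epr_carrier P1] quad_form_epr[OF pos(1) c(1)] by simp
  also have "conj_by (mat_adjoint (ket (unit_vec e 0))) ?T = (?T $$ (0, 0)) \<cdot>\<^sub>m 1\<^sub>m 1"
    using conj_by_ket_adjoint[OF unit_vec_carrier c(2)] quad_form_unit_vec[OF pos(2)] by simp
  also have "((mtrace ?P / of_nat d) \<cdot>\<^sub>m 1\<^sub>m 1) \<otimes>\<^sub>k ((?T $$ (0, 0)) \<cdot>\<^sub>m 1\<^sub>m 1)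
    = (mtrace ?P / of_nat d * ?T $$ (0, 0)) \<cdot>\<^sub>m 1\<^sub>m 1"
    by (auto simp: kron_smult_left kron_smult_right kron_one intro!: eq_matI)
  finally show ?thesis by (auto simp: overlap_def intro!: eq_matI)
qed

lemma overlap_norm:
  assumes "k \<in> K" "qs \<in> W"
  shows "overlap k qs * cnj (overlap k qs) = (if tag_ok k qs \<and> msg_ok k qs then 1 else 0)"
proof -
  have "cis (phase k qs) * cnj (cis (phase k qs)) = 1" by (simp add: cis_cnj cis_mult)
  then show ?thesis
    using pos(1) assms by (auto simp: overlap_def msg_trace tag_index_00)
qed

text \<open>Testing against one vector turns \<open>Q k qs\<close> into the scalar
  \<open>overlap k qs\<close>, leaving \<open>C s qs\<close> alone on R. After the twirl only its
  squared modulus counts, which is 0 or 1.\<close>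

lemma sim_acc_eq:
  assumes \<rho>: "\<rho> \<in> carrier_mat r r"
  shows "sim_acc S r A \<rho> = kraus r J (\<lambda>(k, s, qs). if tag_ok k qs \<and> msg_ok k qs then cK else 0)
      (\<lambda>(k, s, qs). C s qs) \<rho>" (is "_ = ?R")
proof -
  define B where "B = 1\<^sub>m r \<otimes>\<^sub>k probe"
  define Sw where "Sw = swap_mat r d \<otimes>\<^sub>k 1\<^sub>m N"
  define n where "n = r * (d * N)"
  have B: "B \<in> carrier_mat n r" unfolding B_def n_def
    using kron_carrier[OF one_carrier_mat probe_carrier, of r] by simp
  have B': "mat_adjoint B \<in> carrier_mat r n" using B by auto
  have Sw: "Sw \<in> carrier_mat (d * (r * N)) n"
  proof -
    have "Sw \<in> carrier_mat ((d * r) * N) ((r * d) * N)" unfolding Sw_def by auto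
    then show ?thesis by (simp add: n_def mult.assoc)
  qed
  have Sw': "mat_adjoint Sw \<in> carrier_mat n (d * (r * N))" using Sw by auto
  have probe: "\<rho> \<otimes>\<^sub>k ketbra (epr d) \<otimes>\<^sub>k ketbra (unit_vec e 0) = conj_by B \<rho>"
  proof -
    have "conj_by B (\<rho> \<otimes>\<^sub>k 1\<^sub>m 1) = conj_by (1\<^sub>m r) \<rho> \<otimes>\<^sub>k conj_by probe (1\<^sub>m 1)"
      unfolding B_def using \<rho> probe_carrier by (intro conj_by_kron) auto
    moreover have "conj_by probe (1\<^sub>m 1 \<otimes>\<^sub>k 1\<^sub>m 1) = conj_by (ket (epr d)) (1\<^sub>m 1)
        \<otimes>\<^sub>k conj_by (ket (unit_vec e 0)) (1\<^sub>m 1)"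
      by (intro conj_by_kron[where a' = "d * d" and b' = e]) (auto intro!: ket_carrier)
    ultimately show ?thesis
      using conj_by_ket[OF epr_carrier] conj_by_ket[OF unit_vec_carrier] \<rho>
      by (simp only: kron_one_right conj_by_one)
  qed
  \<comment> \<open>What the Kraus operator \<open>s\<close> leaves on R for a fixed key, once key
    unitary, exchange and tests are absorbed.\<close>
  let ?Z = "\<lambda>k ps s. mat_sum r W (\<lambda>qs. pauli_sign ps qs \<cdot>\<^sub>m (overlap k qs \<cdot>\<^sub>m C s qs))"
  \<comment> \<open>The sum over the tag decomposition has a single term because the canonical tag
    is pure; it is kept to match \<open>sim_acc\<close>.\<close>
  have trm: "mat_sum r {..<1::nat} (\<lambda>s. of_real 1 \<cdot>\<^sub>m
        conj_by (mat_adjoint B) (conj_by (mat_adjoint (1\<^sub>m (r * d) \<otimes>\<^sub>k U k ps))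
          (attack_skip r d e A (conj_by (1\<^sub>m (r * d) \<otimes>\<^sub>k U k ps) (conj_by B \<rho>)))))
      = mat_sum r {..<p} (\<lambda>s. conj_by (?Z k ps s) \<rho>)"
    if k: "k \<in> K" and ps: "ps \<in> W" for k ps
  proof -
    define T where "T = 1\<^sub>m (r * d) \<otimes>\<^sub>k U k ps"
    let ?X0 = "conj_by B \<rho>"
    let ?X1 = "conj_by T ?X0"
    let ?X2 = "conj_by Sw ?X1"
    let ?G = "\<lambda>s. 1\<^sub>m d \<otimes>\<^sub>k G s"
    let ?CP = "\<lambda>s qs. C s qs \<otimes>\<^sub>k (1\<^sub>m d \<otimes>\<^sub>k pauli_word qs)"
    let ?CQ = "\<lambda>s qs. C s qs \<otimes>\<^sub>k (1\<^sub>m d \<otimes>\<^sub>k Q k qs)"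
    have U: "U k ps \<in> carrier_mat N N" "mat_adjoint (U k ps) \<in> carrier_mat N N" using U_carrier k ps
      by auto
    have T_eq: "T = 1\<^sub>m r \<otimes>\<^sub>k (1\<^sub>m d \<otimes>\<^sub>k U k ps)"
      by (simp add: T_def kron_one[symmetric] kron_assoc)
    have T: "T \<in> carrier_mat n n" unfolding T_eq n_def using U by auto
    have T': "mat_adjoint T \<in> carrier_mat n n" using T by auto
    have X0: "?X0 \<in> carrier_mat n n" using B \<rho> by auto
    have X1: "?X1 \<in> carrier_mat n n" using T X0 by auto
    have X2: "?X2 \<in> carrier_mat (d * (r * N)) (d * (r * N))" using Sw X1 by auto
    have G1: "?G s \<in> carrier_mat (d * (r * N)) (d * (r * N))" if "s < p" for s
      using G_carrier[OF that] by auto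
    have "tensor_superop d d (r * N) (r * N) id A ?X2
      = tensor_superop d d (r * N) (r * N) id (kraus (r * N) {..<p} (\<lambda>_. 1) G) ?X2"
      by (intro tensor_superop_cong_right A_kraus) auto
    also have "\<dots> = mat_sum (d * (r * N)) {..<p} (\<lambda>s. conj_by (?G s) ?X2)"
      using X2 G_carrier by (subst tensor_superop_id_kraus) (auto simp: kraus_one)
    finally have "attack_skip r d e A ?X1
      = conj_by (mat_adjoint Sw) (mat_sum (d * (r * N)) {..<p} (\<lambda>s. conj_by (?G s) ?X2))"
      by (simp add: attack_skip_def Let_def Sw_def flip: N)
    also have "\<dots> = mat_sum n {..<p} (\<lambda>s. conj_by (mat_adjoint Sw) (conj_by (?G s) ?X2))"
      using X2 G1 by (intro conj_by_mat_sum[OF Sw']) auto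
    also have "\<dots> = mat_sum n {..<p} (\<lambda>s. conj_by (conj_by (mat_adjoint Sw) (?G s)) ?X1)"
      using conj_by_sandwich[OF Sw G1 X1] by (intro mat_sum_cong refl) auto
    finally have 1: "attack_skip r d e A ?X1 = \<dots>" .
    define Y1 where "Y1 s = conj_by (mat_adjoint Sw) (?G s)" for s
    have Y1: "Y1 s \<in> carrier_mat n n" if "s < p" for s unfolding Y1_def using Sw' G1[OF that]
      by auto
    have "conj_by (mat_adjoint T) (attack_skip r d e A ?X1)
      = mat_sum n {..<p} (\<lambda>s. conj_by (mat_adjoint T) (conj_by (Y1 s) ?X1))"
      unfolding 1 Y1_def[symmetric] using X1 Y1 by (intro conj_by_mat_sum[OF T']) auto
    also have "\<dots> = mat_sum n {..<p} (\<lambda>s. conj_by (conj_by (mat_adjoint T) (Y1 s)) ?X0)"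
      using conj_by_sandwich[OF T Y1 X0] by (intro mat_sum_cong refl) auto
    finally have 2: "conj_by (mat_adjoint T) (attack_skip r d e A ?X1) = \<dots>" .
    define Y2 where "Y2 s = conj_by (mat_adjoint T) (Y1 s)" for s
    have Y2: "Y2 s \<in> carrier_mat n n" if "s < p" for s unfolding Y2_def using T' Y1[OF that] by auto
    have "conj_by (mat_adjoint B) (conj_by (mat_adjoint T) (attack_skip r d e A ?X1))
      = mat_sum r {..<p} (\<lambda>s. conj_by (mat_adjoint B) (conj_by (Y2 s) ?X0))"
      unfolding 2 Y2_def[symmetric] using X0 Y2 by (intro conj_by_mat_sum[OF B']) auto
    also have "\<dots> = mat_sum r {..<p} (\<lambda>s. conj_by (conj_by (mat_adjoint B) (Y2 s)) \<rho>)"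
      using conj_by_sandwich[OF B Y2 \<rho>] by (intro mat_sum_cong refl) auto
    also have "\<dots> = mat_sum r {..<p} (\<lambda>s. conj_by (?Z k ps s) \<rho>)"
    proof (intro mat_sum_cong refl arg_cong2[where f = conj_by])
      fix s assume "s \<in> {..<p}"
      then have s: "s < p" by simp
      have CP: "C s qs \<otimes>\<^sub>k pauli_word qs \<in> carrier_mat (r * N) (r * N)" if "qs \<in> W" for qs
        using word_carrier[OF that] by auto
      have CP1: "1\<^sub>m d \<otimes>\<^sub>k (C s qs \<otimes>\<^sub>k pauli_word qs) \<in> carrier_mat (d * (r * N)) (d * (r * N))"
          if "qs \<in> W" for qs
        using CP[OF that] by auto
      have "?G s = mat_sum (d * (r * N)) W (\<lambda>qs. 1\<^sub>m d \<otimes>\<^sub>k (C s qs \<otimes>\<^sub>k pauli_word qs))"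
        unfolding G_expansion[OF s] using CP by (intro kron_mat_sum) auto
      then have "Y1 s = mat_sum n W (\<lambda>qs. conj_by (mat_adjoint Sw)
          (1\<^sub>m d \<otimes>\<^sub>k (C s qs \<otimes>\<^sub>k pauli_word qs)))"
        unfolding Y1_def using CP1 by (simp add: conj_by_mat_sum[OF Sw'])
      \<comment> \<open>Undoing the exchange puts R back in front of the idle
        \<open>M\<^sub>2\<close>; the Pauli on \<open>M\<^sub>1\<close> and T is untouched.\<close>
      also have "\<dots> = mat_sum n W (\<lambda>qs. ?CP s qs)"
      proof (intro mat_sum_cong refl)
        fix qs assume qs: "qs \<in> W"
        have "conj_by (mat_adjoint Sw) ((1\<^sub>m d \<otimes>\<^sub>k C s qs) \<otimes>\<^sub>k pauli_word qs)
          = conj_by (mat_adjoint (swap_mat r d)) (1\<^sub>m d \<otimes>\<^sub>k C s qs)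
              \<otimes>\<^sub>k conj_by (1\<^sub>m N) (pauli_word qs)"
          unfolding Sw_def kron_adjoint mat_adjoint_one using word_carrier[OF qs]
          by (intro conj_by_kron[where a = "d * r" and a' = "r * d" and b = N and b' = N]) auto
        then show "conj_by (mat_adjoint Sw) (1\<^sub>m d \<otimes>\<^sub>k (C s qs \<otimes>\<^sub>k pauli_word qs)) = ?CP s qs"
          using word_carrier[OF qs] by (simp add: kron_assoc conj_by_swap_mat conj_by_one)
      qed
      finally have Y1_eq: "Y1 s = \<dots>" .
      have "?CP s qs \<in> carrier_mat n n" if "qs \<in> W" for qs
        unfolding n_def using word_carrier[OF that] by auto
      then have "Y2 s = mat_sum n W (\<lambda>qs. conj_by (mat_adjoint T) (?CP s qs))"
        unfolding Y2_def Y1_eq by (rule conj_by_mat_sum[OF T'])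
      also have "\<dots> = mat_sum n W (\<lambda>qs. pauli_sign ps qs \<cdot>\<^sub>m (?CQ s qs))"
      proof (intro mat_sum_cong refl)
        fix qs assume qs: "qs \<in> W"
        have "conj_by (mat_adjoint T) (?CP s qs)
          = conj_by (1\<^sub>m r) (C s qs) \<otimes>\<^sub>k conj_by (1\<^sub>m d \<otimes>\<^sub>k mat_adjoint (U k ps))
              (1\<^sub>m d \<otimes>\<^sub>k pauli_word qs)"
          unfolding T_eq kron_adjoint mat_adjoint_one using word_carrier[OF qs] U
          by (intro conj_by_kron[where a = r and a' = r and b = "d * N" and b' = "d * N"]) auto
        also have "conj_by (1\<^sub>m d \<otimes>\<^sub>k mat_adjoint (U k ps)) (1\<^sub>m d \<otimes>\<^sub>k pauli_word qs)
          = conj_by (1\<^sub>m d) (1\<^sub>m d) \<otimes>\<^sub>k conj_by (mat_adjoint (U k ps)) (pauli_word qs)"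
          using word_carrier[OF qs] U by (intro conj_by_kron) auto
        finally show "conj_by (mat_adjoint T) (?CP s qs)
          = pauli_sign ps qs \<cdot>\<^sub>m (?CQ s qs)"
          by (simp add: conj_by_one U_conj k ps qs kron_smult_right)
      qed
      finally have Y2_eq: "Y2 s = \<dots>" .
      have CQ: "?CQ s qs \<in> carrier_mat n n" if "qs \<in> W" for qs
        unfolding n_def using Q_carrier[OF k that] by auto
      have "conj_by (mat_adjoint B) (Y2 s) = mat_sum r W
          (\<lambda>qs. conj_by (mat_adjoint B) (pauli_sign ps qs \<cdot>\<^sub>m (?CQ s qs)))"
        unfolding Y2_eq using CQ by (intro conj_by_mat_sum[OF B']) auto
      also have "\<dots> = ?Z k ps s"
      proof (intro mat_sum_cong refl)
        fix qs assume qs: "qs \<in> W"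
        have "conj_by (mat_adjoint B) (?CQ s qs)
          = conj_by (1\<^sub>m r) (C s qs) \<otimes>\<^sub>k conj_by (mat_adjoint probe) (1\<^sub>m d \<otimes>\<^sub>k Q k qs)"
          unfolding B_def kron_adjoint[of "1\<^sub>m r"] mat_adjoint_one
          using Q_carrier[OF k qs] mat_adjoint_carrier[OF probe_carrier]
          by (intro conj_by_kron[where a = r and a' = r and b = "d * N" and b' = 1]) auto
        also have "\<dots> = overlap k qs \<cdot>\<^sub>m C s qs"
          unfolding probe_conj[OF k qs] kron_smult_right kron_one_right conj_by_one[OF C_carrier] ..
        finally show "conj_by (mat_adjoint B) (pauli_sign ps qs \<cdot>\<^sub>m (?CQ s qs))
          = pauli_sign ps qs \<cdot>\<^sub>m (overlap k qs \<cdot>\<^sub>m C s qs)"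
          using conj_by_smult[OF B' CQ[OF qs]] by simp
      qed
      finally show "conj_by (mat_adjoint B) (Y2 s) = ?Z k ps s" .
    qed
    finally have "conj_by (mat_adjoint B) (conj_by (mat_adjoint T) (attack_skip r d e A ?X1))
      = mat_sum r {..<p} (\<lambda>s. conj_by (?Z k ps s) \<rho>)" .
    then show ?thesis unfolding T_def[symmetric] by (auto simp: one_smult_mat intro!: eq_matI)
  qed
  have "sim_acc S r A \<rho> = mat_avg r (keys S) (\<lambda>k. mat_sum r {..<1::nat} (\<lambda>s. of_real 1 \<cdot>\<^sub>m
        conj_by (mat_adjoint B) (conj_by (mat_adjoint (1\<^sub>m (r * d) \<otimes>\<^sub>k enc_unitary S k))
          (attack_skip r d e A (conj_by (1\<^sub>m (r * d) \<otimes>\<^sub>k enc_unitary S k) (conj_by B \<rho>))))))"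
    unfolding sim_acc_def Let_def scheme_simps(1-5) B_def[symmetric] probe ..
  also have "\<dots> = mat_avg r (K \<times> W) (\<lambda>(k, ps). mat_sum r {..<p} (\<lambda>s. conj_by (?Z k ps s) \<rho>))"
    by (rule mat_avg_keys) (simp only: enc_unitary_eq trm[OF _ key_word] prod.case)
  also have "\<dots> = kraus r J (\<lambda>_. cK) (\<lambda>(k, s, qs). overlap k qs \<cdot>\<^sub>m C s qs) \<rho>"
    using \<rho> by (intro mat_avg_pauli_twirl) auto
  also have "\<dots> = ?R"
    unfolding kraus_def
  proof (intro mat_sum_cong refl)
    fix x assume "x \<in> J"
    then obtain k s qs where x: "x = (k, s, qs)" "k \<in> K" "s < p" "qs \<in> W" by auto
    have "conj_by (C s qs) \<rho> \<in> carrier_mat r r" using \<rho> by auto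
    then show "cK \<cdot>\<^sub>m conj_by ((\<lambda>(k, s, qs). overlap k qs \<cdot>\<^sub>m C s qs) x) \<rho>
      = (case x of (k, s, qs) \<Rightarrow> if tag_ok k qs \<and> msg_ok k qs then cK else 0)
          \<cdot>\<^sub>m conj_by ((\<lambda>(k, s, qs). C s qs) x) \<rho>"
      by (auto simp: x(1) conj_by_smult_left[OF C_carrier \<rho>] overlap_norm[OF x(2,4)] intro!:
          eq_matI)
  qed
  finally show ?thesis .
qed

text \<open>The weights complement those of \<open>sim_acc\<close> to \<open>cK\<close> in every
  term, so the two simulators add up to the effect of the averaged attack on R, which preserves the
  trace by \<open>C_complete\<close>.\<close>

definition sim_rej :: "complex mat \<Rightarrow> complex mat" where
  "sim_rej = kraus r J (\<lambda>(k, s, qs). if tag_ok k qs \<and> msg_ok k qs then 0 else cK)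
      (\<lambda>(k, s, qs). C s qs)"

text \<open>The terms in which the two maps differ: a forged message in the real map is missed
  by the ideal
  map, which outputs the reject state instead.\<close>

definition forged :: "'k \<Rightarrow> pauli_string \<Rightarrow> bool" where
  "forged k qs \<longleftrightarrow> tag_ok k qs \<and> \<not> msg_ok k qs"

abbreviation msg_op where "msg_op k qs \<equiv> msg_embed d * pauli_word (msg_word k qs)"

text \<open>Written as a Kraus map with weights 0 or \<open>cK\<close>, so that positivity survives
  an ancilla.\<close>

definition forged_part :: "complex mat \<Rightarrow> complex mat" where
  "forged_part = kraus (r * (d + 1)) J (\<lambda>(k, s, qs). if forged k qs then cK else 0)
      (\<lambda>(k, s, qs). C s qs \<otimes>\<^sub>k msg_op k qs)"

text \<open>The extra index runs over a message basis because discarding the message takes one Kraus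
  operator for each basis vector.\<close>

definition missed_part :: "complex mat \<Rightarrow> complex mat" where
  "missed_part = kraus (r * (d + 1)) (J \<times> {..<d}) (\<lambda>((k, s, qs), x). if forged k qs then cK else 0)
      (\<lambda>((k, s, qs), x). C s qs \<otimes>\<^sub>k bot_op d x)"

lemma cK_nonneg: "0 \<le> cK"
  by (simp add: less_eq_complex_def Re_divide Im_divide)

lemma msg_op_carrier: "k \<in> K \<Longrightarrow> qs \<in> W \<Longrightarrow> msg_op k qs \<in> carrier_mat (d + 1) d"
  by (rule mult_carrier_mat[OF msg_embed_carrier msg_carrier])

lemma C_carrier_J: "x \<in> J \<Longrightarrow> (\<lambda>(k, s, qs). C s qs) x \<in> carrier_mat r r"
  by auto

lemma forged_carrier: "x \<in> J \<Longrightarrow> (\<lambda>(k, s, qs). C s qs \<otimes>\<^sub>k msg_op k qs) x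
    \<in> carrier_mat (r * (d + 1)) (r * d)"
  using kron_carrier[OF C_carrier msg_op_carrier] by auto

lemma missed_carrier: "x \<in> J \<times> {..<d} \<Longrightarrow> (\<lambda>((k, s, qs), x). C s qs \<otimes>\<^sub>k bot_op d x) x
    \<in> carrier_mat (r * (d + 1)) (r * d)"
  using kron_carrier[OF C_carrier bot_op_carrier] by auto

lemma linear_superop_sim_acc: "linear_superop r r (sim_acc S r A)"
  by (rule linear_superop_cong[OF sim_acc_eq linear_superop_kraus[OF C_carrier_J]])

lemma cp_map_sim_rej: "cp_map r r sim_rej"
  unfolding sim_rej_def using cK_nonneg by (intro cp_map_kraus C_carrier_J) (auto simp: finite_K)

lemma sim_acc_add_rej:
  assumes "\<rho> \<in> carrier_mat r r"
  shows "sim_acc S r A \<rho> + sim_rej \<rho> = kraus r J (\<lambda>_. cK) (\<lambda>(k, s, qs). C s qs) \<rho>" (is "?L = ?R")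
proof -
  have c: "conj_by (C s qs) \<rho> \<in> carrier_mat r r" for s qs using assms by auto
  have "?L = mat_sum r J (\<lambda>x.
     (case x of (k, s, qs) \<Rightarrow> if tag_ok k qs \<and> msg_ok k qs then cK else 0)
         \<cdot>\<^sub>m conj_by (case x of (k, s, qs) \<Rightarrow> C s qs) \<rho> +
     (case x of (k, s, qs) \<Rightarrow> if tag_ok k qs \<and> msg_ok k qs then 0 else cK)
         \<cdot>\<^sub>m conj_by (case x of (k, s, qs) \<Rightarrow> C s qs) \<rho>)"
    unfolding sim_acc_eq[OF assms] sim_rej_def kraus_def using c
    by (intro mat_sum_add[symmetric]) auto
  also have "\<dots> = ?R"
    unfolding kraus_def by (intro mat_sum_cong refl) (auto intro!: eq_matI)
  finally show ?thesis .
qed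

text \<open>For a density \<rho> the summands act as probabilities of the attack Paulis;
  completeness of the coefficients makes them sum to 1.\<close>

lemma trace_sum_C:
  assumes "\<rho> \<in> carrier_mat (c * (r * d)) (c * (r * d))"
  shows "(\<Sum>(s, qs)\<in>{..<p} \<times> W. mtrace (conj_by (1\<^sub>m c \<otimes>\<^sub>k C s qs \<otimes>\<^sub>k 1\<^sub>m d) \<rho>)) = mtrace \<rho>"
proof -
  let ?G = "\<lambda>x. case x of (s, qs) \<Rightarrow> 1\<^sub>m c \<otimes>\<^sub>k C s qs \<otimes>\<^sub>k 1\<^sub>m d"
  have cc: "mat_adjoint (C s qs) * C s qs \<in> carrier_mat r r" for s qs
    by (rule mult_carrier_mat[OF mat_adjoint_carrier[OF C_carrier] C_carrier])
  have "(\<Sum>x\<in>{..<p} \<times> W. mtrace (conj_by ((\<lambda>(s, qs). 1\<^sub>m c \<otimes>\<^sub>k C s qs \<otimes>\<^sub>k 1\<^sub>m d) x) \<rho>)) = mtrace \<rho>"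
  proof (rule sum_mtrace_conj_by_one)
    have "mat_sum (c * (r * d)) ({..<p} \<times> W) (\<lambda>x. mat_adjoint (?G x) * ?G x)
      = mat_sum (c * (r * d)) ({..<p} \<times> W) (\<lambda>x. 1\<^sub>m c
          \<otimes>\<^sub>k ((case x of (s, qs) \<Rightarrow> mat_adjoint (C s qs) * C s qs) \<otimes>\<^sub>k 1\<^sub>m d))"
      by (intro mat_sum_cong refl) (auto simp: kron3_gram[OF C_carrier one_carrier_mat])
    also have "\<dots> = 1\<^sub>m c \<otimes>\<^sub>k (mat_sum r ({..<p} \<times> W) (\<lambda>(s, qs). mat_adjoint (C s qs) * C s qs)
        \<otimes>\<^sub>k 1\<^sub>m d)"
      using cc kron_carrier[OF cc one_carrier_mat]
      by (subst mat_sum_kron) (auto intro!: kron_mat_sum[symmetric])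
    also have "\<dots> = 1\<^sub>m (c * (r * d))" by (simp add: C_complete kron_one)
    finally show "mat_sum (c * (r * d)) ({..<p} \<times> W) (\<lambda>x. mat_adjoint (?G x) * ?G x)
        = 1\<^sub>m (c * (r * d))" .
  qed (use assms in auto)
  then show ?thesis by (simp add: case_prod_beta)
qed

lemma trace_preserving_sim: "trace_preserving r (\<lambda>\<rho>. sim_acc S r A \<rho> + sim_rej \<rho>)"
  unfolding trace_preserving_def
proof (intro ballI)
  fix \<rho> :: "complex mat" assume \<rho>: "\<rho> \<in> carrier_mat r r"
  have "mtrace (sim_acc S r A \<rho> + sim_rej \<rho>) = (\<Sum>x\<in>J. cK
      * mtrace (conj_by ((\<lambda>(k, s, qs). C s qs) x) \<rho>))"
    unfolding sim_acc_add_rej[OF \<rho>] by (intro mtrace_kraus[OF C_carrier_J \<rho>])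
  also have "\<dots> = (\<Sum>k\<in>K. cK * (\<Sum>(s, qs)\<in>{..<p} \<times> W. mtrace (conj_by (C s qs) \<rho>)))"
    by (simp add: sum.cartesian_product' sum_distrib_left)
  also have "(\<Sum>(s, qs)\<in>{..<p} \<times> W. mtrace (conj_by (C s qs) \<rho>)) = mtrace \<rho>"
  proof -
    have "(\<Sum>x\<in>{..<p} \<times> W. mtrace (conj_by ((\<lambda>(s, qs). C s qs) x) \<rho>)) = mtrace \<rho>"
      using C_complete \<rho> by (intro sum_mtrace_conj_by_one) (auto simp: case_prod_beta)
    then show ?thesis by (simp add: case_prod_beta)
  qed
  finally show "mtrace (sim_acc S r A \<rho> + sim_rej \<rho>) = mtrace \<rho>"
    using finite_K K_nonempty by simp
qed

text \<open>The same index set and weights as in \<open>real_map_kron\<close>, so that the two maps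
  can be subtracted term by term.\<close>

lemma ideal_map_kron:
  assumes E: "E \<in> carrier_mat r r" and F: "F \<in> carrier_mat d d"
  shows "ideal_map S r (sim_acc S r A) sim_rej (E \<otimes>\<^sub>k F)
      = mat_sum (r * (d + 1)) J (\<lambda>(k, s, qs). cK \<cdot>\<^sub>m (conj_by (C s qs) E \<otimes>\<^sub>k
    ideal_out k qs F))" (is "?L = ?R")
proof -
  have cE: "conj_by (C s qs) E \<in> carrier_mat r r" for s qs using E by auto
  have cF: "conj_by (msg_embed d) F \<in> carrier_mat (d + 1) (d + 1)"
    using conj_by_carrier[OF msg_embed_carrier F] .
  have bot: "bot_state d \<in> carrier_mat (d + 1) (d + 1)" by (simp add: bot_state_eq)
  have lin_rej: "linear_superop r r sim_rej" using cp_map_sim_rej by (simp add: cp_map_def)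
  let ?a = "\<lambda>x. case x of (k, s, qs) \<Rightarrow> (if tag_ok k qs \<and> msg_ok k qs then cK else 0)
      \<cdot>\<^sub>m conj_by (C s qs) E"
  let ?b = "\<lambda>x. case x of (k, s, qs) \<Rightarrow> (if tag_ok k qs \<and> msg_ok k qs then 0 else cK)
      \<cdot>\<^sub>m conj_by (C s qs) E"
  have "tensor_superop r r d (d + 1) (sim_acc S r A) (conj_by (msg_embed d)) (E \<otimes>\<^sub>k F)
      = sim_acc S r A E \<otimes>\<^sub>k conj_by (msg_embed d) F"
    by (rule tensor_superop_kron[OF linear_superop_sim_acc
        linear_superop_conj_by[OF msg_embed_carrier] E F])
  also have "\<dots> = mat_sum r J ?a \<otimes>\<^sub>k conj_by (msg_embed d) F"
    unfolding sim_acc_eq[OF E] kraus_def by (rule arg_cong2[where f = kron], rule mat_sum_cong) auto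
  also have "\<dots> = mat_sum (r * (d + 1)) J (\<lambda>x. ?a x \<otimes>\<^sub>k conj_by (msg_embed d) F)"
    using cE by (intro mat_sum_kron[OF cF]) auto
  finally have 1: "tensor_superop r r d (d + 1) (sim_acc S r A) (conj_by (msg_embed d)) (E \<otimes>\<^sub>k F)
      = \<dots>" .
  have "sim_rej (ptrace2 r d (E \<otimes>\<^sub>k F)) \<otimes>\<^sub>k bot_state d = sim_rej E \<otimes>\<^sub>k (mtrace F \<cdot>\<^sub>m bot_state d)"
    unfolding ptrace2_kron[OF E F] linear_superop_smult[OF lin_rej E]
    by (simp add: kron_smult_left kron_smult_right)
  also have "\<dots> = mat_sum r J ?b \<otimes>\<^sub>k (mtrace F \<cdot>\<^sub>m bot_state d)"
    unfolding sim_rej_def kraus_def by (rule arg_cong2[where f = kron], rule mat_sum_cong) auto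
  also have "\<dots> = mat_sum (r * (d + 1)) J (\<lambda>x. ?b x \<otimes>\<^sub>k (mtrace F \<cdot>\<^sub>m bot_state d))"
    using cE bot by (intro mat_sum_kron) auto
  finally have 2: "sim_rej (ptrace2 r d (E \<otimes>\<^sub>k F)) \<otimes>\<^sub>k bot_state d = \<dots>" .
  have "?L = mat_sum (r * (d + 1)) J (\<lambda>x. ?a x \<otimes>\<^sub>k conj_by (msg_embed d) F + ?b x
      \<otimes>\<^sub>k (mtrace F \<cdot>\<^sub>m bot_state d))"
    unfolding ideal_map_def Let_def scheme_simps 1 2
    using kron_carrier[OF smult_carrier_mat[OF cE] cF]
        kron_carrier[OF smult_carrier_mat[OF cE] smult_carrier_mat[OF bot]]
    by (intro mat_sum_add[symmetric]) (auto split: prod.splits)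
  also have "\<dots> = ?R"
  proof (intro mat_sum_cong refl)
    fix x assume "x \<in> J"
    obtain k s qs where x: "x = (k, s, qs)" by (metis prod.exhaust)
    have z: "(0 \<cdot>\<^sub>m Z) \<otimes>\<^sub>k Z' + (c \<cdot>\<^sub>m Z) \<otimes>\<^sub>k Z'' = c \<cdot>\<^sub>m (Z \<otimes>\<^sub>k Z'')" "(c \<cdot>\<^sub>m Z) \<otimes>\<^sub>k Z''
        + (0 \<cdot>\<^sub>m Z) \<otimes>\<^sub>k Z' = c \<cdot>\<^sub>m (Z \<otimes>\<^sub>k Z'')"
      if "dim_row Z' = dim_row Z''" "dim_col Z' = dim_col Z''" for Z Z' Z'' c
      using that by (auto simp: kron_smult_left intro!: eq_matI)
    have dims: "dim_row (conj_by (msg_embed d) F) = dim_row (mtrace F \<cdot>\<^sub>m bot_state d)"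
      "dim_col (conj_by (msg_embed d) F) = dim_col (mtrace F \<cdot>\<^sub>m bot_state d)" using cF bot by auto
    show "?a x \<otimes>\<^sub>k conj_by (msg_embed d) F + ?b x \<otimes>\<^sub>k (mtrace F \<cdot>\<^sub>m bot_state d)
        = (case x of (k, s, qs) \<Rightarrow> cK \<cdot>\<^sub>m (conj_by (C s qs) E \<otimes>\<^sub>k
      ideal_out k qs F))"
      unfolding x prod.case by (cases "tag_ok k qs"; cases "msg_ok k qs")
          (simp_all add: z[OF dims] z[OF dims[symmetric]])
  qed
  finally show ?thesis .
qed

lemma real_minus_ideal_kron:
  assumes E: "E \<in> carrier_mat r r" and F: "F \<in> carrier_mat d d"
  shows "real_map S r A (E \<otimes>\<^sub>k F) - ideal_map S r (sim_acc S r A) sim_rej (E \<otimes>\<^sub>k F)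
    = forged_part (E \<otimes>\<^sub>k F) - missed_part (E \<otimes>\<^sub>k F)"
proof -
  have EF: "E \<otimes>\<^sub>k F \<in> carrier_mat (r * d) (r * d)" using E F by auto
  have cE: "conj_by (C s qs) E \<in> carrier_mat r r" for s qs using E by auto
  have cF: "conj_by (msg_embed d) F \<in> carrier_mat (d + 1) (d + 1)"
    using conj_by_carrier[OF msg_embed_carrier F] .
  have cP: "conj_by (msg_op k qs) F \<in> carrier_mat (d + 1) (d + 1)" if "k \<in> K" "qs \<in> W" for k qs
    using conj_by_carrier[OF msg_op_carrier[OF that] F] .
  have bot: "mtrace F \<cdot>\<^sub>m bot_state d \<in> carrier_mat (d + 1) (d + 1)" by (simp add: bot_state_eq)
  let ?R = "\<lambda>(k, s, qs). cK \<cdot>\<^sub>m (conj_by (C s qs) E \<otimes>\<^sub>k real_out k qs F)"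
  let ?I = "\<lambda>(k, s, qs). cK \<cdot>\<^sub>m (conj_by (C s qs) E \<otimes>\<^sub>k ideal_out k qs F)"
  let ?X = "\<lambda>(k, s, qs). (if forged k qs then cK else 0)
      \<cdot>\<^sub>m (conj_by (C s qs) E \<otimes>\<^sub>k conj_by (msg_op k qs) F)"
  let ?Y = "\<lambda>(k, s, qs). (if forged k qs then cK else 0)
      \<cdot>\<^sub>m (conj_by (C s qs) E \<otimes>\<^sub>k (mtrace F \<cdot>\<^sub>m bot_state d))"
  have X: "forged_part (E \<otimes>\<^sub>k F) = mat_sum (r * (d + 1)) J ?X"
    unfolding forged_part_def kraus_def
  proof (intro mat_sum_cong refl)
    fix x assume "x \<in> J"
    then obtain k s qs where x: "x = (k, s, qs)" "k \<in> K" "qs \<in> W" by auto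
    show "(case x of (k, s, qs) \<Rightarrow> if forged k qs then cK else 0)
        \<cdot>\<^sub>m conj_by (case x of (k, s, qs) \<Rightarrow> C s qs \<otimes>\<^sub>k msg_op k qs) (E \<otimes>\<^sub>k F) = ?X x"
      unfolding x(1) prod.case conj_by_kron[OF C_carrier msg_op_carrier[OF x(2,3)] E F] ..
  qed
  have Y: "missed_part (E \<otimes>\<^sub>k F) = mat_sum (r * (d + 1)) J ?Y"
    unfolding missed_part_def kraus_def mat_sum_product[of _ J]
  proof (intro mat_sum_cong refl, goal_cases)
    case (1 x)
    then obtain k s qs where x: "x = (k, s, qs)" "k \<in> K" "qs \<in> W" by auto
    let ?w = "if forged k qs then cK else 0"
    have cb: "conj_by (bot_op d y) F \<in> carrier_mat (d + 1) (d + 1)" for y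
      using conj_by_carrier[OF bot_op_carrier F] .
    have "mat_sum (r * (d + 1)) {..<d} (\<lambda>y. ?w \<cdot>\<^sub>m conj_by (C s qs \<otimes>\<^sub>k bot_op d y) (E \<otimes>\<^sub>k F))
      = ?w \<cdot>\<^sub>m mat_sum (r * (d + 1)) {..<d} (\<lambda>y. conj_by (C s qs) E \<otimes>\<^sub>k conj_by (bot_op d y) F)"
      unfolding conj_by_kron[OF C_carrier bot_op_carrier E F]
      using kron_carrier[OF cE cb] by (intro smult_mat_sum[symmetric]) auto
    also have "mat_sum (r * (d + 1)) {..<d} (\<lambda>y. conj_by (C s qs) E \<otimes>\<^sub>k conj_by (bot_op d y) F)
      = conj_by (C s qs) E \<otimes>\<^sub>k (mtrace F \<cdot>\<^sub>m bot_state d)"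
      unfolding mtrace_bot_state[OF F] by (rule kron_mat_sum[OF cE cb, symmetric])
    finally show ?case
      by (simp only: x(1) prod.case)
  qed
  have c: "?R x \<in> carrier_mat (r * (d + 1)) (r * (d + 1))" "?I x
      \<in> carrier_mat (r * (d + 1)) (r * (d + 1))"
    "?X x \<in> carrier_mat (r * (d + 1)) (r * (d + 1))" "?Y x
        \<in> carrier_mat (r * (d + 1)) (r * (d + 1))" if "x \<in> J" for x
    using that cP kron_carrier[OF cE cF] kron_carrier[OF cE bot] kron_carrier[OF cE cP]
    by (auto split: if_splits)
  have "mat_sum (r * (d + 1)) J ?R - mat_sum (r * (d + 1)) J ?I
      = mat_sum (r * (d + 1)) J (\<lambda>x. ?R x - ?I x)"
    using c by (intro mat_sum_minus[symmetric])
  also have "\<dots> = mat_sum (r * (d + 1)) J (\<lambda>x. ?X x - ?Y x)"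
  proof (intro mat_sum_cong refl)
    fix x assume xJ: "x \<in> J"
    then obtain k s qs where x: "x = (k, s, qs)" "k \<in> K" "qs \<in> W" by auto
    \<comment> \<open>Both error parts keep the full index set, so a cancelling pair of terms must
      appear as a difference of two terms of weight 0.\<close>
    have z: "Z - Z = 0 \<cdot>\<^sub>m Z' - 0 \<cdot>\<^sub>m Z''" if "Z \<in> carrier_mat n n" "Z' \<in> carrier_mat n n" "Z''
        \<in> carrier_mat n n" for Z Z' Z'' :: "complex mat" and n
      using that by (auto intro!: eq_matI)
    consider "tag_ok k qs" "msg_ok k qs" | "tag_ok k qs" "\<not> msg_ok k qs" | "\<not> tag_ok k qs" by blast
    then show "?R x - ?I x = ?X x - ?Y x"
    proof cases
      case 1
      have "msg_op k qs = msg_embed d"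
        using msg_ok_one[OF x(2,3) 1(2)] by (simp add: right_mult_one_mat[OF msg_embed_carrier])
      then show ?thesis
        using 1 z[OF smult_carrier_mat[OF kron_carrier[OF cE cF]] kron_carrier[OF cE cF]
            kron_carrier[OF cE bot]]
        by (simp add: x(1) forged_def)
    next
      case 2
      then show ?thesis by (simp add: x(1) forged_def)
    next
      case 3
      then show ?thesis
        using z[OF smult_carrier_mat[OF kron_carrier[OF cE bot]] kron_carrier[OF cE cP[OF x(2,3)]]
            kron_carrier[OF cE bot]]
        by (simp add: x(1) forged_def)
    qed
  qed
  also have "\<dots> = mat_sum (r * (d + 1)) J ?X - mat_sum (r * (d + 1)) J ?Y"
    using c by (intro mat_sum_minus)
  finally show ?thesis
    unfolding real_map_kron[OF E F] ideal_map_kron[OF E F] X Y .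
qed

section \<open>Weights and the diamond norm\<close>

lemma msg_op_gram:
  assumes "k \<in> K" "qs \<in> W"
  shows "mat_adjoint (msg_op k qs) * msg_op k qs = 1\<^sub>m d" (is "?L = _")
proof -
  let ?P = "pauli_word (msg_word k qs)"
  have c: "?P \<in> carrier_mat d d" "mat_adjoint ?P \<in> carrier_mat d d" using msg_carrier assms by auto
  note em = msg_embed_carrier[of d] mat_adjoint_carrier[OF msg_embed_carrier, of d]
  have "?L = mat_adjoint ?P * mat_adjoint (msg_embed d) * (msg_embed d * ?P)"
    using mat_adjoint_mult[OF em(1) c(1)] by simp
  also have "\<dots> = mat_adjoint ?P * (mat_adjoint (msg_embed d) * (msg_embed d * ?P))"
    by (rule assoc_mult_mat[OF c(2) em(2) mult_carrier_mat[OF em(1) c(1)]])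
  also have "mat_adjoint (msg_embed d) * (msg_embed d * ?P) = mat_adjoint (msg_embed d)
      * msg_embed d * ?P"
    by (rule assoc_mult_mat[OF em(2,1) c(1), symmetric])
  also have "mat_adjoint ?P * (mat_adjoint (msg_embed d) * msg_embed d * ?P) = mat_adjoint ?P * ?P"
    using c by (simp add: msg_embed_gram)
  also have "\<dots> = 1\<^sub>m d" using unitary_pauli_word(1)[OF msg_word[OF assms]] by (simp flip: d)
  finally show ?thesis .
qed

text \<open>Purity testing bounds an average over codes for one fixed attack Pauli. It fits because
  the weight of an attack Pauli in an input is independent of the code: after exchanging sums each
  Pauli contributes at most \<epsilon> times its weight.\<close>

lemma diamond_bound:
  assumes \<epsilon>: "\<And>qs. qs \<in> W \<Longrightarrow> real (card {k \<in> K. forged k qs}) / real (card K) \<le> \<epsilon>"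
    and \<rho>: "density (c * (r * d)) \<rho>"
  shows "trace_norm (c * (r * (d + 1))) (tensor_superop c c (r * d) (r * (d + 1)) id
    (\<lambda>\<rho>. real_map S r A \<rho> - ideal_map S r (sim_acc S r A) sim_rej \<rho>) \<rho>) \<le> 2 * \<epsilon>"
proof -
  define n where "n = c * (r * (d + 1))"
  let ?w = "\<lambda>k qs. if forged k qs then cK else 0"
  have psd: "psd (c * (r * d)) \<rho>" and tr: "mtrace \<rho> = 1" using \<rho> by (auto simp: density_def)
  have carr: "\<rho> \<in> carrier_mat (c * (r * d)) (c * (r * d))" using psd psd_carrier by auto
  define X where "X = kraus n J (\<lambda>(k, s, qs). ?w k qs)
      (\<lambda>x. 1\<^sub>m c \<otimes>\<^sub>k (\<lambda>(k, s, qs). C s qs \<otimes>\<^sub>k msg_op k qs) x) \<rho>"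
  define Y where "Y = kraus n (J \<times> {..<d}) (\<lambda>((k, s, qs), x). ?w k qs)
      (\<lambda>x. 1\<^sub>m c \<otimes>\<^sub>k (\<lambda>((k, s, qs), x). C s qs \<otimes>\<^sub>k bot_op d x) x) \<rho>"
  have GX: "1\<^sub>m c \<otimes>\<^sub>k (\<lambda>(k, s, qs). C s qs \<otimes>\<^sub>k msg_op k qs) x \<in> carrier_mat n (c * (r * d))" if "x
      \<in> J" for x
    unfolding n_def by (intro kron_carrier forged_carrier that) simp
  have GY: "1\<^sub>m c \<otimes>\<^sub>k (\<lambda>((k, s, qs), x). C s qs \<otimes>\<^sub>k bot_op d x) x \<in> carrier_mat n (c * (r * d))"
      if "x \<in> J \<times> {..<d}" for x
    unfolding n_def by (intro kron_carrier missed_carrier that) simp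
  have "tensor_superop c c (r * d) (r * (d + 1)) id
      (\<lambda>\<rho>. real_map S r A \<rho> - ideal_map S r (sim_acc S r A) sim_rej \<rho>) \<rho>
    = tensor_superop c c (r * d) (r * (d + 1)) id (\<lambda>\<rho>. forged_part \<rho> - missed_part \<rho>) \<rho>"
    by (intro tensor_superop_cong_right) (simp add: mat_unit_kron real_minus_ideal_kron)
  also have "\<dots> = tensor_superop c c (r * d) (r * (d + 1)) id forged_part \<rho>
      - tensor_superop c c (r * d) (r * (d + 1)) id missed_part \<rho>"
    unfolding forged_part_def missed_part_def
    by (intro tensor_superop_id_diff linear_superop_kraus forged_carrier missed_carrier)
  also have "tensor_superop c c (r * d) (r * (d + 1)) id forged_part \<rho> = X"
    unfolding forged_part_def X_def n_def by (intro tensor_superop_id_kraus forged_carrier carr)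
        (auto simp: finite_K)
  also have "tensor_superop c c (r * d) (r * (d + 1)) id missed_part \<rho> = Y"
    unfolding missed_part_def Y_def n_def by (intro tensor_superop_id_kraus missed_carrier carr)
        (auto simp: finite_K)
  finally have diff: "tensor_superop c c (r * d) (r * (d + 1)) id
    (\<lambda>\<rho>. real_map S r A \<rho> - ideal_map S r (sim_acc S r A) sim_rej \<rho>) \<rho> = X - Y" .
  have pX: "psd n X" unfolding X_def using cK_nonneg by (intro psd_kraus[OF psd] GX) auto
  have pY: "psd n Y" unfolding Y_def using cK_nonneg by (intro psd_kraus[OF psd] GY) auto
  \<comment> \<open>Regrouped so that the output message is the last digit; its value
    \<open>d\<close> stands for the reject state.\<close>
  have n: "n = (c * r) * (d + 1)" and cr: "c * (r * d) = (c * r) * d" unfolding n_def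
    by (simp_all only: mult.assoc)
  have CC: "1\<^sub>m c \<otimes>\<^sub>k C s qs \<in> carrier_mat (c * r) (c * r)" for s qs by auto
  have X0: "X $$ (i, j) = 0" if ij: "i < n" "j < n" "i mod (d + 1) = d \<or> j mod (d + 1) = d" for i j
    unfolding X_def
  proof (rule kraus_index_zero[OF GX ij(1,2)])
    fix x assume "x \<in> J"
    then obtain k s qs where x: "x = (k, s, qs)" "k \<in> K" "qs \<in> W" by auto
    have row: "msg_op k qs $$ (d, l) = 0" if "l < d" for l
    proof -
      have "msg_op k qs $$ (d, l) = (\<Sum>j<d. msg_embed d $$ (d, j)
          * pauli_word (msg_word k qs) $$ (j, l))"
        using that by (intro mult_mat_index[OF msg_embed_carrier msg_carrier[OF x(2,3)]]) auto
      also have "\<dots> = 0" by (intro sum.neutral) (simp add: msg_embed_def)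
      finally show ?thesis .
    qed
    have "conj_by ((1\<^sub>m c \<otimes>\<^sub>k C s qs) \<otimes>\<^sub>k msg_op k qs) \<rho> $$ (i, j) = 0"
      using ij row carr unfolding n cr by (intro conj_by_kron_zero[OF CC msg_op_carrier[OF x(2,3)]])
          auto
    then show "conj_by (1\<^sub>m c \<otimes>\<^sub>k (case x of (k, s, qs) \<Rightarrow> C s qs \<otimes>\<^sub>k msg_op k qs)) \<rho> $$ (i, j) = 0"
      by (simp add: x(1) kron_assoc)
  qed
  have Y0: "Y $$ (i, j) = 0" if ij: "i < n" "j < n" "i mod (d + 1) \<noteq> d \<or> j mod (d + 1) \<noteq> d" for i j
    unfolding Y_def
  proof (rule kraus_index_zero[OF GY ij(1,2)], assumption, goal_cases)
    case (1 x)
    then obtain k s qs y where x: "x = ((k, s, qs), y)" "k \<in> K" "qs \<in> W" by auto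
    have row: "bot_op d y $$ (q, l) = 0" if "q < d + 1" "l < d" "q \<noteq> d" for q l
      using that by (simp add: bot_op_def)
    have "conj_by ((1\<^sub>m c \<otimes>\<^sub>k C s qs) \<otimes>\<^sub>k bot_op d y) \<rho> $$ (i, j) = 0"
      using ij row carr unfolding n cr by (intro conj_by_kron_zero[OF CC bot_op_carrier]) auto
    then show ?case
      by (simp add: x(1) kron_assoc)
  qed
  have XY: "X * Y = 0\<^sub>m n n"
    using X0 Y0 by (intro mult_mat_zero_blocks[OF psd_carrier[OF pX] psd_carrier[OF pY], of "\<lambda>s. s
        mod (d + 1) = d"]) auto
  have YX: "Y * X = 0\<^sub>m n n"
    using X0 Y0 by (intro mult_mat_zero_blocks[OF psd_carrier[OF pY] psd_carrier[OF pX], of "\<lambda>s. s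
        mod (d + 1) \<noteq> d"]) auto
  \<comment> \<open>The common weight of the term in both error parts: \<open>msg_op\<close> has
    Gram matrix 1, and the Gram matrices of the \<open>bot_op d y\<close> sum to 1.\<close>
  define h where "h s qs = mtrace (conj_by (1\<^sub>m c \<otimes>\<^sub>k C s qs \<otimes>\<^sub>k 1\<^sub>m d) \<rho>)" for s qs
  have H: "1\<^sub>m c \<otimes>\<^sub>k C s qs \<otimes>\<^sub>k 1\<^sub>m d \<in> carrier_mat (c * (r * d)) (c * (r * d))" for s qs by auto
  have h_nonneg: "0 \<le> Re (h s qs)" for s qs
    using psd_mtrace_nonneg[OF psd_conj_by[OF psd H]] by (simp add: h_def less_eq_complex_def)
  have h_sum: "(\<Sum>s<p. \<Sum>qs\<in>W. Re (h s qs)) = 1"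
    using arg_cong[OF trace_sum_C[OF carr], of Re] by (simp add: tr h_def sum.cartesian_product')
  have trX: "mtrace X = (\<Sum>(k, s, qs)\<in>J. ?w k qs * h s qs)"
    unfolding X_def
  proof (rule trans[OF mtrace_kraus[OF GX carr]], assumption, intro sum.cong refl)
    fix x assume "x \<in> J"
    then obtain k s qs where x: "x = (k, s, qs)" "k \<in> K" "qs \<in> W" by auto
    have "mtrace (conj_by (1\<^sub>m c \<otimes>\<^sub>k C s qs \<otimes>\<^sub>k msg_op k qs) \<rho>) = h s qs"
      unfolding h_def
    proof (rule mtrace_conj_by_isometry[OF _ H carr])
      show "1\<^sub>m c \<otimes>\<^sub>k C s qs \<otimes>\<^sub>k msg_op k qs \<in> carrier_mat n (c * (r * d))"
        using GX[OF \<open>x \<in> J\<close>] by (simp add: x(1))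
    qed (simp add: kron3_gram[OF C_carrier msg_op_carrier[OF x(2,3)]]
        kron3_gram[OF C_carrier one_carrier_mat] msg_op_gram[OF x(2,3)])
    then show "(case x of (k, s, qs) \<Rightarrow> ?w k qs)
        * mtrace (conj_by (1\<^sub>m c \<otimes>\<^sub>k (case x of (k, s, qs) \<Rightarrow> C s qs \<otimes>\<^sub>k msg_op k qs)) \<rho>)
      = (case x of (k, s, qs) \<Rightarrow> ?w k qs * h s qs)" by (simp add: x(1))
  qed
  have trY: "mtrace Y = (\<Sum>(k, s, qs)\<in>J. ?w k qs * h s qs)"
  proof -
    have one: "(\<Sum>y<d. mtrace (conj_by (1\<^sub>m c \<otimes>\<^sub>k C s qs \<otimes>\<^sub>k bot_op d y) \<rho>)) = h s qs" for s qs
    proof -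
      have G1: "1\<^sub>m c \<otimes>\<^sub>k C s qs \<otimes>\<^sub>k bot_op d y \<in> carrier_mat n (c * (r * d))" for y
        unfolding n_def by (intro kron_carrier C_carrier bot_op_carrier one_carrier_mat)
      have CC': "mat_adjoint (C s qs) * C s qs \<in> carrier_mat r r"
        by (rule mult_carrier_mat[OF mat_adjoint_carrier[OF C_carrier] C_carrier])
      have "mat_sum (c * (r * d)) {..<d} (\<lambda>y. mat_adjoint (1\<^sub>m c \<otimes>\<^sub>k C s qs \<otimes>\<^sub>k bot_op d y)
          * (1\<^sub>m c \<otimes>\<^sub>k C s qs \<otimes>\<^sub>k bot_op d y))
        = mat_sum (c * (r * d)) {..<d} (\<lambda>y. 1\<^sub>m c
            \<otimes>\<^sub>k ((mat_adjoint (C s qs) * C s qs) \<otimes>\<^sub>k mat_unit d y y))"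
        by (intro mat_sum_cong refl) (simp add: kron3_gram[OF C_carrier bot_op_carrier] bot_op_gram)
      also have "\<dots> = 1\<^sub>m c \<otimes>\<^sub>k ((mat_adjoint (C s qs) * C s qs) \<otimes>\<^sub>k 1\<^sub>m d)"
        unfolding sum_mat_unit[of d, symmetric] kron_mat_sum[OF CC' mat_unit_carrier]
        by (rule kron_mat_sum[OF one_carrier_mat kron_carrier[OF CC' mat_unit_carrier], symmetric])
      also have "\<dots> = mat_adjoint (1\<^sub>m c \<otimes>\<^sub>k C s qs \<otimes>\<^sub>k 1\<^sub>m d) * (1\<^sub>m c \<otimes>\<^sub>k C s qs \<otimes>\<^sub>k 1\<^sub>m d)"
        by (simp add: kron3_gram[OF C_carrier one_carrier_mat])
      finally show ?thesis
        unfolding sum_mtrace_conj_by[OF G1 carr] h_def mtrace_conj_by[OF H carr] by simp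
    qed
    have "mtrace Y = (\<Sum>x\<in>J. \<Sum>y<d. (case x of (k, s, qs) \<Rightarrow> ?w k qs)
        * mtrace (conj_by (1\<^sub>m c \<otimes>\<^sub>k (case x of (k, s, qs) \<Rightarrow> C s qs \<otimes>\<^sub>k bot_op d y)) \<rho>))"
      unfolding Y_def
      by (rule trans[OF mtrace_kraus[OF GY carr]], assumption, subst sum.cartesian_product')
          (intro sum.cong refl, auto)
    also have "\<dots> = (\<Sum>(k, s, qs)\<in>J. ?w k qs * h s qs)"
      unfolding sum_distrib_left[symmetric] by (intro sum.cong refl) (auto simp: one)
    finally show ?thesis .
  qed
  have "Re (\<Sum>(k, s, qs)\<in>J. ?w k qs * h s qs) = (\<Sum>(k, s, qs)\<in>J.
      (if forged k qs then 1 / real (card K) else 0) * Re (h s qs))"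
    unfolding Re_sum by (intro sum.cong refl) (auto simp: Re_divide power2_eq_square)
  also have "\<dots> = (\<Sum>k\<in>K. \<Sum>x\<in>{..<p} \<times> W. (if forged k (snd x) then 1 / real (card K) else 0)
      * Re (h (fst x) (snd x)))"
    by (simp add: sum.cartesian_product')
  \<comment> \<open>With the codes innermost, the sum over \<open>k\<close> becomes the fraction of
    codes for which this attack Pauli is a forgery.\<close>
  also have "\<dots> = (\<Sum>x\<in>{..<p} \<times> W. \<Sum>k\<in>K. (if forged k (snd x) then 1 / real (card K) else 0)
      * Re (h (fst x) (snd x)))"
    by (rule sum.swap)
  also have "\<dots> = (\<Sum>s<p. \<Sum>qs\<in>W. (\<Sum>k\<in>K. if forged k qs then 1 / real (card K) else 0) * Re (h s qs))"
    by (simp add: sum.cartesian_product' sum_distrib_right)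
  also have "\<dots> \<le> (\<Sum>s<p. \<Sum>qs\<in>W. \<epsilon> * Re (h s qs))"
  proof (intro sum_mono mult_right_mono h_nonneg)
    fix qs assume "qs \<in> W"
    have "(\<Sum>k\<in>K. if forged k qs then 1 / real (card K) else 0)
        = (\<Sum>k\<in>{k \<in> K. forged k qs}. 1 / real (card K))"
      using finite_K by (intro sum.inter_filter[symmetric])
    then show "(\<Sum>k\<in>K. if forged k qs then 1 / real (card K) else 0) \<le> \<epsilon>"
      using \<epsilon>[OF \<open>qs \<in> W\<close>] by simp
  qed
  also have "\<dots> = \<epsilon>" by (simp add: h_sum flip: sum_distrib_left)
  finally have "Re (mtrace X) \<le> \<epsilon>" "Re (mtrace Y) \<le> \<epsilon>" by (simp_all only: trX trY)
  then show ?thesis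
    unfolding diff using trace_norm_orthogonal_diff[OF pX pY XY YX] by (simp add: n_def)
qed

end

section \<open>The authentication theorem\<close>

text \<open>Multiplying the code condition by the adjoint of \<open>V\<close> isolates the
  pulled-back Pauli; cutting its word after \<open>m\<close> letters separates message and
  tag.\<close>

lemma is_code_conj:
  assumes "is_code m t V" "qs \<in> pauli_words (m + t)"
  shows "\<exists>as bs \<theta>. as \<in> pauli_words m \<and> bs \<in> pauli_words t \<and>
    mat_adjoint V * pauli_word qs * V = cis \<theta> \<cdot>\<^sub>m (pauli_word as \<otimes>\<^sub>k pauli_word bs)"
proof -
  let ?N = "2 ^ (m + t) :: nat"
  have V: "V \<in> carrier_mat ?N ?N" "mat_adjoint V * V = 1\<^sub>m ?N" "mat_adjoint V \<in> carrier_mat ?N ?N"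
    using assms(1) by (auto simp: is_code_def unitary_mat_def)
  have P: "pauli_word qs \<in> carrier_mat ?N ?N" using assms(2) by (rule pauli_word_carrier)
  obtain P' \<theta> where P': "P' \<in> paulis (m + t)" "pauli_word qs * V = cis \<theta> \<cdot>\<^sub>m (V * P')"
    using assms unfolding is_code_def paulis_eq by blast
  then obtain ps where ps: "ps \<in> pauli_words (m + t)" "P' = pauli_word ps" by (auto simp: paulis_eq)
  have cP': "P' \<in> carrier_mat ?N ?N" using pauli_word_carrier[OF ps(1)] by (simp add: ps(2))
  have "mat_adjoint V * pauli_word qs * V = mat_adjoint V * (cis \<theta> \<cdot>\<^sub>m (V * P'))"
    using assoc_mult_mat[OF V(3) P V(1)] P'(2) by simp
  also have "\<dots> = cis \<theta> \<cdot>\<^sub>m (mat_adjoint V * (V * P'))"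
    by (rule mult_smult_distrib[OF V(3) mult_carrier_mat[OF V(1) cP']])
  also have "mat_adjoint V * (V * P') = P'"
    using assoc_mult_mat[OF V(3,1) cP'] V(2) cP' by simp
  also have "P' = pauli_word (take m ps) \<otimes>\<^sub>k pauli_word (drop m ps)"
    using pauli_word_append[of "take m ps" "drop m ps"] by (simp add: ps(2))
  finally show ?thesis
    using ps(1) by (intro exI[of _ "take m ps"] exI[of _ "drop m ps"] exI[of _ \<theta>])
        (auto simp: pauli_words_def)
qed

text \<open>For a non-identity Pauli, forgery implies the event of purity testing. The identity is
  pulled back to the identity, whose trace is nonzero, whereas a nontrivial message word would make
  it traceless; so no code is counted and the bound is \<open>0 \<le> \<epsilon>\<close>.\<close>

lemma (in pauli_codes) purity_testing_bound:
  assumes "purity_testing m t K V \<epsilon>" "0 \<le> \<epsilon>" "qs \<in> W"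
  shows "real (card {k \<in> K. tag_ok k qs \<and> \<not> msg_ok k qs}) / real (card K) \<le> \<epsilon>"
proof (cases "pauli_word qs = 1\<^sub>m N")
  case True
  have "msg_ok k qs" if k: "k \<in> K" for k
  proof (rule ccontr)
    assume "\<not> msg_ok k qs"
    then have z: "mtrace (pauli_word (msg_word k qs)) = 0" using msg_trace[OF k assms(3)] by simp
    have "mat_adjoint (V k) * V k = Q k qs"
      using V_conj[OF k assms(3)] V_carrier[OF k] by (simp add: True Q_def)
    then have "Q k qs = 1\<^sub>m N" using V_unitary[OF k] by (simp add: unitary_mat_def)
    moreover have "mtrace (Q k qs) = 0"
      unfolding Q_def using z
      by (simp add: mtrace_smult[OF kron_carrier[OF msg_carrier[OF k assms(3)]
          tag_carrier[OF k assms(3)]]]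
          mtrace_kron[OF msg_carrier[OF k assms(3)] tag_carrier[OF k assms(3)]])
    ultimately show False using pos(3) by (simp add: mtrace_def)
  qed
  then have "{k \<in> K. tag_ok k qs \<and> \<not> msg_ok k qs} = {}" by auto
  then show ?thesis using assms(2) by (simp only: card.empty)
next
  case False
  let ?S = "{A \<otimes>\<^sub>k B | A B. A \<in> paulis m - {1\<^sub>m (2 ^ m)} \<and> B \<in> IZ_paulis t}"
  let ?bad = "{k \<in> K. in_up_to_phase (mat_adjoint (V k) * pauli_word qs * V k) ?S}"
  have "{k \<in> K. tag_ok k qs \<and> \<not> msg_ok k qs} \<subseteq> ?bad"
  proof
    fix k assume "k \<in> {k \<in> K. tag_ok k qs \<and> \<not> msg_ok k qs}"
    then have k: "k \<in> K" "tag_ok k qs" "\<not> msg_ok k qs" by auto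
    have "mtrace (pauli_word (msg_word k qs)) = 0" using msg_trace[OF k(1) assms(3)] k(3) by simp
    \<comment> \<open>Purity testing excludes the identity as a matrix, not as a word; the trace
      shows that a nontrivial word never equals it.\<close>
    then have "pauli_word (msg_word k qs) \<noteq> 1\<^sub>m (2 ^ m)" by (auto simp: mtrace_def)
    moreover have "pauli_word (msg_word k qs) \<in> paulis m" using msg_word[OF k(1) assms(3)]
      by (auto simp: paulis_eq)
    moreover have "pauli_word (tag_word k qs) \<in> IZ_paulis t"
      using pauli_word_IZ[OF tag_word[OF k(1) assms(3)]] k(2) by (simp add: tag_ok_def)
    ultimately have "pauli_word (msg_word k qs) \<otimes>\<^sub>k pauli_word (tag_word k qs) \<in> ?S" by blast
    then have "in_up_to_phase (mat_adjoint (V k) * pauli_word qs * V k) ?S"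
      unfolding in_up_to_phase_def V_conj[OF k(1) assms(3)] by blast
    then show "k \<in> ?bad" using k(1) by blast
  qed
  then have "card {k \<in> K. tag_ok k qs \<and> \<not> msg_ok k qs} \<le> card ?bad"
    using finite_K by (intro card_mono) auto
  then have "real (card {k \<in> K. tag_ok k qs \<and> \<not> msg_ok k qs}) / real (card K)
      \<le> real (card ?bad) / real (card K)"
    by (intro divide_right_mono) auto
  also have "\<dots> \<le> \<epsilon>"
  proof -
    have "pauli_word qs \<in> paulis (m + t) - {1\<^sub>m (2 ^ (m + t))}"
      using False assms(3) by (auto simp: paulis_eq N_power)
    then show ?thesis using assms(1) unfolding purity_testing_def by blast
  qed
  finally show ?thesis .
qed

theorem theorem8:
  fixes m t :: nat and K :: "'k set" and V :: "'k \<Rightarrow> complex mat" and \<epsilon> :: real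
  assumes "finite K" and "K \<noteq> {}"
    and "0 \<le> \<epsilon>"
    and "\<And>k. k \<in> K \<Longrightarrow> is_code m t (V k)"
    and "purity_testing m t K V \<epsilon>"
  shows "QCA (canonical_scheme m t K V) \<epsilon>"
proof -
  define d e N :: nat where "d = 2 ^ m" and "e = 2 ^ t" and "N = d * e"
  define split where "split k qs x \<longleftrightarrow> (case x of (as, bs, \<theta>) \<Rightarrow> as \<in> pauli_words m \<and> bs
      \<in> pauli_words t \<and>
    mat_adjoint (V k) * pauli_word qs * V k = cis \<theta> \<cdot>\<^sub>m (pauli_word as \<otimes>\<^sub>k pauli_word bs))"
        for k qs x
  \<comment> \<open>\<open>is_code\<close> yields words and phase only existentially for each code
    and Pauli; a choice turns them into the functions that the locale expects.\<close>
  define ch where "ch k qs = (SOME x. split k qs x)" for k qs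
  have "split k qs (ch k qs)" if kq: "k \<in> K" "qs \<in> pauli_words (m + t)" for k qs
  proof -
    obtain as bs \<theta> where "split k qs (as, bs, \<theta>)"
      using is_code_conj[OF assms(4)[OF kq(1)] kq(2)] unfolding split_def by auto
    then show ?thesis unfolding ch_def by (rule someI)
  qed
  then interpret pauli_codes m t d e N K V "\<lambda>k qs. fst (ch k qs)" "\<lambda>k qs. fst (snd (ch k qs))" "\<lambda>k
      qs. snd (snd (ch k qs))"
    using assms by unfold_locales (auto simp: d_def e_def N_def power_add is_code_def split_def
        case_prod_beta)
  have bound: "real (card {k \<in> K. tag_ok k qs \<and> \<not> msg_ok k qs}) / real (card K) \<le> \<epsilon>" if "qs \<in> W"
      for qs
    using purity_testing_bound assms that by blast
  show ?thesis
    unfolding QCA_def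
  proof (intro conjI is_scheme_canonical allI impI)
    fix r :: nat and A assume "0 < r" and "cptp (r * (msg_dim S * tag_dim S))
        (r * (msg_dim S * tag_dim S)) A"
    then have A: "cp_map (r * N) (r * N) A" "trace_preserving (r * N) A"
      by (auto simp: cptp_def N_def)
    obtain p :: nat where "\<exists>G. (\<forall>s<p. G s \<in> carrier_mat (r * N) (r * N)) \<and>
        (\<forall>X\<in>carrier_mat (r * N) (r * N). A X = kraus (r * N) {..<p} (\<lambda>_. 1) G X)"
      using cp_map_has_kraus[OF A(1)] ..
    then obtain G where G: "(\<forall>s<p. G s \<in> carrier_mat (r * N) (r * N)) \<and>
        (\<forall>X\<in>carrier_mat (r * N) (r * N). A X = kraus (r * N) {..<p} (\<lambda>_. 1) G X)" ..
    interpret attacked_codes m t d e N K V "\<lambda>k qs. fst (ch k qs)" "\<lambda>k qs. fst (snd (ch k qs))" "\<lambda>k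
        qs. snd (snd (ch k qs))" r p A G
    proof unfold_locales
      show "G s \<in> carrier_mat (r * N) (r * N)" if "s < p" for s using G that by simp
      show "A X = kraus (r * N) {..<p} (\<lambda>_. 1) G X" if "X \<in> carrier_mat (r * N) (r * N)" for X
        using G that by simp
      show "mtrace (A X) = mtrace X" if "X \<in> carrier_mat (r * N) (r * N)" for X
        using A(2) that unfolding trace_preserving_def by (rule bspec)
    qed
    have "diamond_norm (r * d) (r * (d + 1)) (\<lambda>\<rho>. real_map S r A \<rho>
        - ideal_map S r (sim_acc S r A) sim_rej \<rho>) \<le> ereal (2 * \<epsilon>)"
      unfolding diamond_norm_def
    proof (rule SUP_least, goal_cases)
      case (1 x)
      then show ?case using diamond_bound[OF bound[folded forged_def]]
        by (auto simp: case_prod_beta)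
    qed
    then have "1 / 2 * diamond_norm (r * d) (r * (d + 1))
        (\<lambda>\<rho>. real_map S r A \<rho> - ideal_map S r (sim_acc S r A) sim_rej \<rho>) \<le> 1 / 2 * ereal (2 * \<epsilon>)"
      by (intro ereal_mult_left_mono) auto
    then show "\<exists>\<S>\<^sub>r. cp_map r r \<S>\<^sub>r \<and> trace_preserving r (\<lambda>\<rho>. sim_acc S r A \<rho> + \<S>\<^sub>r \<rho>) \<and>
      1 / 2 * diamond_norm (r * msg_dim S) (r * (msg_dim S + 1))
        (\<lambda>\<rho>. real_map S r A \<rho> - ideal_map S r (sim_acc S r A) \<S>\<^sub>r \<rho>) \<le> ereal \<epsilon>"
      using cp_map_sim_rej trace_preserving_sim
      by (intro exI[of _ sim_rej]) (simp add: one_ereal_def)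
  qed
qed

end
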